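(* Let $k\ge 3$ be an integer and let $F$ be a graph with $\chi(F)>k$. Then $$\mathrm{ex}_k(n,\text{Berge-}F)=\mathrm{ex}(n,K_k,F)+O(1),$$ where $k$ and $F$ are fixed, $n\to\infty$, and the constant implied by $O(1)$ may depend on $k$ and $F$ but not on $n$.
   Context: All graphs and hypergraphs are finite and simple; hyperedges of a hypergraph are distinct, and a hypergraph is $k$-uniform if each hyperedge has exactly $k$ vertices. Given a hypergraph $\mathcal{H}$ and a graph $G$ (with the vertices of $G$ being vertices of $\mathcal{H}$), $\mathcal{H}$ is a Berge-$G$ (a Berge copy of $G$) if there is a bijection between the hyperedges of $\mathcal{H}$ and the edges of $G$ such that each hyperedge contains its image. A hypergraph is Berge-$F$-free if no subhypergraph of it is a Berge-$F$. $\mathrm{ex}_k(n,\text{Berge-}F)$ denotes the largest number of hyperedges in an $n$-vertex $k$-uniform Berge-$F$-free hypergraph. A graph is $F$-free if it does not contain $F$ as a (not necessarily induced) subgraph. For graphs $H,G$, $\mathcal{N}(H,G)$ is the number of (not necessarily induced) copies of $H$ in $G$, and $\mathrm{ex}(n,H,F)=\max\{\mathcal{N}(H,G): G \text{ is an } n\text{-vertex } F\text{-free graph}\}$. $K_k$ is the complete graph on $k$ vertices and $\chi$ denotes the chromatic number. *)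

theory Defs
  imports Complex_Main "HOL-Library.Landau_Symbols"
begin

datatype 'a hypergraph = Hypergraph (verts: "'a set") (edges: "'a set set")

definition hypergraph :: "'a hypergraph \<Rightarrow> bool" where
  "hypergraph H \<longleftrightarrow> finite (verts H) \<and> (\<forall>e \<in> edges H. e \<subseteq> verts H)"

definition uniform :: "nat \<Rightarrow> 'a hypergraph \<Rightarrow> bool" where
  "uniform k H \<longleftrightarrow> hypergraph H \<and> (\<forall>e \<in> edges H. card e = k)"

abbreviation graph :: "'a hypergraph \<Rightarrow> bool" where
  "graph \<equiv> uniform 2"

text \<open>For graphs this is the usual (not necessarily induced) subgraph relation.\<close>

definition subhypergraph :: "'a hypergraph \<Rightarrow> 'a hypergraph \<Rightarrow> bool" where
  "subhypergraph H' H \<longleftrightarrow> hypergraph H' \<and> verts H' \<subseteq> verts H \<and> edges H' \<subseteq> edges H"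

definition isomorphic :: "'a hypergraph \<Rightarrow> 'b hypergraph \<Rightarrow> bool" where
  "isomorphic G H \<longleftrightarrow>
     (\<exists>f. bij_betw f (verts G) (verts H) \<and> edges H = (\<lambda>e. f ` e) ` edges G)"

definition proper_colouring :: "'a hypergraph \<Rightarrow> nat \<Rightarrow> ('a \<Rightarrow> nat) \<Rightarrow> bool" where
  "proper_colouring G c f \<longleftrightarrow>
     (\<forall>v \<in> verts G. f v < c) \<and> (\<forall>u v. {u, v} \<in> edges G \<and> u \<noteq> v \<longrightarrow> f u \<noteq> f v)"

definition chromatic_number :: "'a hypergraph \<Rightarrow> nat" where
  "chromatic_number G = (LEAST c. \<exists>f. proper_colouring G c f)"

definition complete_graph :: "nat \<Rightarrow> nat hypergraph" where
  "complete_graph k = Hypergraph {..<k} {e. e \<subseteq> {..<k} \<and> card e = 2}"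

definition copies :: "'a hypergraph \<Rightarrow> 'b hypergraph \<Rightarrow> 'b hypergraph set" where
  "copies H G = {S. subhypergraph S G \<and> isomorphic H S}"

definition num_copies :: "'a hypergraph \<Rightarrow> 'b hypergraph \<Rightarrow> nat" where
  "num_copies H G = card (copies H G)"

definition graph_free :: "'a hypergraph \<Rightarrow> 'b hypergraph \<Rightarrow> bool" where
  "graph_free F G \<longleftrightarrow> copies F G = {}"

text \<open>
  Here the hypergraph \<open>H\<close> and the graph \<open>G\<close> live on a common vertex type. The abstract
  graph \<open>F\<close> enters in \<open>berge_free\<close> below through its isomorphic images on vertices of \<open>H\<close>.
\<close>

definition is_berge :: "'a hypergraph \<Rightarrow> 'a hypergraph \<Rightarrow> bool" where
  "is_berge G H \<longleftrightarrow> verts G \<subseteq> verts H \<and>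
     (\<exists>\<phi>. bij_betw \<phi> (edges H) (edges G) \<and> (\<forall>h \<in> edges H. \<phi> h \<subseteq> h))"

definition berge_free :: "'a hypergraph \<Rightarrow> 'b hypergraph \<Rightarrow> bool" where
  "berge_free F H \<longleftrightarrow>
     \<not> (\<exists>H' F'. subhypergraph H' H \<and> isomorphic F F' \<and> is_berge F' H')"

text \<open>
  Every finite hypergraph is isomorphic to one with natural numbers as vertices, so the two
  extremal numbers are maxima over hypergraphs on \<^typ>\<open>nat\<close>. If \<open>F\<close> has an edge, the maxima
  are over non-empty finite sets, see \<open>ex_berge_set\<close> and \<open>ex_copies_set\<close>.
\<close>

definition ex_berge :: "nat \<Rightarrow> nat \<Rightarrow> 'a hypergraph \<Rightarrow> nat" where
  "ex_berge k n F = Max {card (edges H) | H :: nat hypergraph.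
     uniform k H \<and> card (verts H) = n \<and> berge_free F H}"

definition ex_copies :: "nat \<Rightarrow> 'b hypergraph \<Rightarrow> 'a hypergraph \<Rightarrow> nat" where
  "ex_copies n H F = Max {num_copies H G | G :: nat hypergraph.
     graph G \<and> card (verts G) = n \<and> graph_free F G}"

lemma card_edges_le:
  assumes "hypergraph H" shows "finite (edges H)" "card (edges H) \<le> 2 ^ card (verts H)"
proof -
  have *: "edges H \<subseteq> Pow (verts H)" "finite (Pow (verts H))"
    using assms by (auto simp: hypergraph_def)
  show "finite (edges H)" using * by (rule finite_subset)
  show "card (edges H) \<le> 2 ^ card (verts H)"
    using card_mono[OF *(2,1)] assms by (simp add: card_Pow hypergraph_def)
qed

lemma num_copies_le:
  assumes "hypergraph G"
  shows "finite (copies H G)" "num_copies H G \<le> 2 ^ card (verts G) * 2 ^ 2 ^ card (verts G)"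
proof -
  let ?P = "Pow (verts G) \<times> Pow (edges G)"
  have fin: "finite ?P"
    using assms card_edges_le(1)[OF assms] by (simp add: hypergraph_def)
  have sub: "copies H G \<subseteq> (\<lambda>(V, E). Hypergraph V E) ` ?P"
  proof
    fix S assume "S \<in> copies H G"
    then have "(verts S, edges S) \<in> ?P" by (auto simp: copies_def subhypergraph_def)
    then show "S \<in> (\<lambda>(V, E). Hypergraph V E) ` ?P"
      by (intro image_eqI[where x = "(verts S, edges S)"]) auto
  qed
  show "finite (copies H G)" using sub fin by (meson finite_imageI finite_subset)
  have "num_copies H G \<le> card ?P"
    unfolding num_copies_def using sub fin
    by (meson card_image_le card_mono finite_imageI order_trans)
  also have "\<dots> = 2 ^ card (verts G) * 2 ^ card (edges G)"
    using assms card_edges_le(1)[OF assms]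
    by (simp add: card_cartesian_product card_Pow hypergraph_def)
  also have "\<dots> \<le> 2 ^ card (verts G) * 2 ^ 2 ^ card (verts G)"
    using card_edges_le(2)[OF assms] by (intro mult_left_mono power_increasing) auto
  finally show "num_copies H G \<le> 2 ^ card (verts G) * 2 ^ 2 ^ card (verts G)" .
qed

lemma ex_berge_set:
  fixes F :: "'a hypergraph" and k n :: nat
  defines "A \<equiv> {card (edges H) | H :: nat hypergraph.
     uniform k H \<and> card (verts H) = n \<and> berge_free F H}"
  shows "finite A" "edges F \<noteq> {} \<Longrightarrow> A \<noteq> {}"
proof -
  have "A \<subseteq> {..2 ^ n}" using card_edges_le(2) by (force simp: A_def uniform_def)
  then show "finite A" using finite_subset by blast
  assume "edges F \<noteq> {}"
  then have "berge_free F (Hypergraph {..<n} {})"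
    by (auto simp: berge_free_def subhypergraph_def isomorphic_def is_berge_def bij_betw_def)
  moreover have "uniform k (Hypergraph {..<n} {})" by (simp add: uniform_def hypergraph_def)
  ultimately have "card (edges (Hypergraph {..<n} {})) \<in> A"
    unfolding A_def by force
  then show "A \<noteq> {}" by blast
qed

lemma ex_copies_set:
  fixes F :: "'a hypergraph" and H :: "'b hypergraph" and n :: nat
  defines "A \<equiv> {num_copies H G | G :: nat hypergraph.
     graph G \<and> card (verts G) = n \<and> graph_free F G}"
  shows "finite A" "edges F \<noteq> {} \<Longrightarrow> A \<noteq> {}"
proof -
  have "A \<subseteq> {..2 ^ n * 2 ^ 2 ^ n}" using num_copies_le(2) by (force simp: A_def uniform_def)
  then show "finite A" using finite_subset by blast
  assume "edges F \<noteq> {}"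
  then have "graph_free F (Hypergraph {..<n} {})"
    by (auto simp: graph_free_def copies_def subhypergraph_def isomorphic_def)
  moreover have "graph (Hypergraph {..<n} {})" by (simp add: uniform_def hypergraph_def)
  ultimately have "num_copies H (Hypergraph {..<n} {}) \<in> A"
    unfolding A_def by force
  then show "A \<noteq> {}" by blast
qed

end

theory Submission
  imports Defs "HOL-Analysis.Convex"
begin

text \<open>
  By Hall's theorem a Berge-\<open>F\<close>-free hypergraph yields an \<open>F\<close>-free graph with edges coloured red and
  blue such that the number of hyperedges is at most the number of red \<open>K\<^sub>k\<close> plus the number of blue
  edges. Consider such a coloured graph on \<open>n\<close> vertices maximising this weight, and let
  \<open>r = \<chi>(F) - 1 \<ge> k\<close>. Comparing with the Turan graph, it has almost as many red \<open>K\<^sub>k\<close> as possible, while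
  by Erdos's theorem on complete multipartite subhypergraphs it has only \<open>o(n^(r + 1))\<close> copies of
  \<open>K\<^bsub>r+1\<^esub>\<close>. Near-equality in the Moon-Moser inequalities then gives a large complete \<open>r\<close>-partite
  \<open>T\<^sub>0, \<dots>, T\<^bsub>r-1\<^esub>\<close> such that almost every vertex is joined to all of \<open>T\<close> except for exactly one class,
  to which it is not joined at all; sorting the vertices by the missed class shows that the red graph
  is close to a Turan graph.

  Replacing a vertex by a clone of \<open>|V(F)|\<close> vertices of one \<open>T\<^sub>i\<close> keeps the graph \<open>F\<close>-free, so by
  maximality every vertex lies in almost as many red \<open>K\<^sub>k\<close> as a vertex of the Turan graph. Hence all
  but a bounded number of vertices (those with many neighbours in every class) are joined to almost all
  of the other classes, and every pair that is not contained in the exceptional set has many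
  \<open>K\<^bsub>k-2\<^esub>\<close> in its common red neighbourhood. The blue edges outside the exceptional set are thus paid
  for by the \<open>K\<^sub>k\<close> they create, and only boundedly many remain.
\<close>

section \<open>Cliques and the Moon-Moser inequalities\<close>

text \<open>The obstacle is the size of the error. The number of blue edges alone gives only an
  error of order n^2, and reducing it to a constant needs information about every single pair of
  vertices, which stability up to o(n^2) edges cannot give. This is why a coloured graph of maximal
  weight is studied in place of the graph that comes from an extremal hypergraph: it can be altered
  at one vertex and compared with itself.

  With \<open>s = |V(F)|\<close>, the graph \<open>F\<close> embeds in the complete
  \<open>(r + 1)\<close>-partite graph with classes of size \<open>s\<close>, so that graph is the
  only consequence of \<open>F\<close> that the structural part has to exclude. The exceptional
  vertices are boundedly many because each has a positive proportion of all \<open>r\<close>-tuples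
  as cliques in its neighbourhood; too many of them would give \<open>s\<close> with many such
  cliques in common, hence the excluded graph.

  The condition \<open>k \<le> r\<close> lets a \<open>(k - 2)\<close>-clique avoid two classes, one
  for each end of a pair. The condition \<open>k \<ge> 3\<close> makes n^2 blue edges negligible
  against n^k and makes the number of \<open>(k - 2)\<close>-cliques grow with n.\<close>

definition cliques :: "'a set \<Rightarrow> 'a set set \<Rightarrow> nat \<Rightarrow> 'a set set" where
  "cliques U E j = {Q. Q \<subseteq> U \<and> card Q = j \<and> (\<forall>x\<in>Q. \<forall>y\<in>Q. x \<noteq> y \<longrightarrow> {x, y} \<in> E)}"

definition nbh :: "'a set \<Rightarrow> 'a set set \<Rightarrow> 'a set \<Rightarrow> 'a set" where
  "nbh U E Q = {v \<in> U. \<forall>x\<in>Q. {x, v} \<in> E}"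

text \<open>Edges are plain sets, so \<open>{x, y}\<close> with \<open>x = y\<close> is the
  singleton \<open>{x}\<close>. Excluding singletons makes a vertex a non-neighbour of itself and
  keeps common neighbourhoods disjoint from \<open>Q\<close>.\<close>

definition loopless :: "'a set set \<Rightarrow> bool" where
  "loopless E \<longleftrightarrow> (\<forall>x. {x} \<notin> E)"

text \<open>In a complete \<open>r\<close>-partite graph every vertex is near to every
  \<open>r\<close>-clique; this is the extremal behaviour that the stability argument detects. The
  members of a clique \<open>Q\<close> count as well, each missing only itself.\<close>

definition near :: "'a set \<Rightarrow> 'a set set \<Rightarrow> 'a set \<Rightarrow> 'a set" where
  "near U E Q = {v \<in> U. \<exists>!x. x \<in> Q \<and> {x, v} \<notin> E}"

lemma finite_cliques [simp]: "finite U \<Longrightarrow> finite (cliques U E j)"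
  by (rule finite_subset[of _ "Pow U"]) (auto simp: cliques_def)

lemma finite_nbh [simp]: "finite U \<Longrightarrow> finite (nbh U E Q)"
  by (simp add: nbh_def)

lemma finite_near [simp]: "finite U \<Longrightarrow> finite (near U E Q)"
  by (simp add: near_def)

lemma cliques_mono: "U \<subseteq> U' \<Longrightarrow> E \<subseteq> E' \<Longrightarrow> cliques U E j \<subseteq> cliques U' E' j"
  unfolding cliques_def by blast

lemma cliques_0 [simp]: "finite U \<Longrightarrow> cliques U E 0 = {{}}"
  by (auto simp: cliques_def finite_subset)

lemma cliques_1: "cliques U E (Suc 0) = (\<lambda>x. {x}) ` U"
  by (auto simp: cliques_def card_Suc_eq)

lemma card_cliques_1: "card (cliques U E (Suc 0)) = card U"
  unfolding cliques_1 by (rule card_image) (simp add: inj_on_def)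

lemma card_subsets_le_power:
  assumes "finite U" "\<Q> \<subseteq> {Q. Q \<subseteq> U \<and> card Q = j}"
  shows "card \<Q> \<le> card U ^ j"
proof (cases "j \<le> card U")
  case True
  have "card \<Q> \<le> card {Q. Q \<subseteq> U \<and> card Q = j}"
    using assms by (intro card_mono) auto
  also have "\<dots> = card U choose j" using assms by (simp add: n_subsets)
  also have "\<dots> \<le> card U ^ j" using True by (rule binomial_le_pow)
  finally show ?thesis .
next
  case False
  have "Q \<notin> \<Q>" for Q
  proof
    assume "Q \<in> \<Q>"
    then have "Q \<subseteq> U" "card Q = j" using assms(2) by auto
    then show False using card_mono[OF assms(1), of Q] False by simp
  qed
  then have "\<Q> = {}" by blast
  then show ?thesis by simp
qed

lemma card_cliques_le: "finite U \<Longrightarrow> card (cliques U E j) \<le> card U ^ j"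
  by (rule card_subsets_le_power) (auto simp: cliques_def)

lemma card_subsets_meeting_le:
  assumes "finite U" "X \<subseteq> U" "\<Q> \<subseteq> {Q. Q \<subseteq> U \<and> card Q = Suc j \<and> Q \<inter> X \<noteq> {}}"
  shows "card \<Q> \<le> card X * card U ^ j"
proof -
  let ?S = "{Q. Q \<subseteq> U \<and> card Q = j}"
  have "\<Q> \<subseteq> (\<lambda>(x, Q). insert x Q) ` (X \<times> ?S)"
  proof
    fix Q assume "Q \<in> \<Q>"
    then obtain x where x: "x \<in> Q" "x \<in> X" "Q \<subseteq> U" "card Q = Suc j" using assms by blast
    then have "(x, Q - {x}) \<in> X \<times> ?S" by auto
    moreover have "insert x (Q - {x}) = Q" using x by blast
    ultimately show "Q \<in> (\<lambda>(x, Q). insert x Q) ` (X \<times> ?S)"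
      by (metis (no_types, lifting) case_prod_conv image_eqI)
  qed
  moreover have fin: "finite (X \<times> ?S)" using assms finite_subset[of X U] by auto
  ultimately have "card \<Q> \<le> card (X \<times> ?S)"
    by (meson card_image_le card_mono finite_imageI order_trans)
  also have "\<dots> \<le> card X * card U ^ j"
    using card_subsets_le_power[OF assms(1), of ?S j] by (simp add: card_cartesian_product)
  finally show ?thesis .
qed

lemma nbh_disjoint: "loopless E \<Longrightarrow> x \<in> nbh U E Q \<Longrightarrow> x \<notin> Q"
  unfolding nbh_def loopless_def by (metis (no_types, lifting) insert_absorb2 mem_Collect_eq)

text \<open>Inserting or deleting one vertex is a bijection between pairs (clique, extending vertex)
  and pairs (larger clique, member). The weight \<open>g\<close> is arbitrary because both the first
  and the second moment of the codegrees are computed this way.\<close>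

lemma sum_clique_extensions:
  assumes "finite U" "loopless E"
  shows "(\<Sum>P\<in>cliques U E j. \<Sum>v\<in>nbh U E P. g P v)
       = (\<Sum>Q\<in>cliques U E (Suc j). \<Sum>x\<in>Q. g (Q - {x}) x)"
proof -
  have fin: "finite Q" if "Q \<in> cliques U E i" for Q i
    using that assms(1) by (auto simp: cliques_def intro: finite_subset)
  have "(\<Sum>P\<in>cliques U E j. \<Sum>v\<in>nbh U E P. g P v)
      = (\<Sum>(P, v)\<in>(SIGMA P:cliques U E j. nbh U E P). g P v)"
    using assms by (intro sum.Sigma) auto
  also have "\<dots> = (\<Sum>(Q, x)\<in>(SIGMA Q:cliques U E (Suc j). Q). g (Q - {x}) x)"
  proof (rule sum.reindex_bij_witness[where i = "\<lambda>(Q, x). (Q - {x}, x)" and j = "\<lambda>(P, v). (insert v P, v)"])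
    fix a assume "a \<in> (SIGMA P:cliques U E j. nbh U E P)"
    then obtain P v where a: "a = (P, v)" "P \<in> cliques U E j" "v \<in> nbh U E P" by auto
    have "v \<notin> P" using nbh_disjoint assms a by metis
    moreover have "insert v P \<in> cliques U E (Suc j)"
      using a \<open>v \<notin> P\<close> fin[OF a(2)] by (auto simp: cliques_def nbh_def insert_commute)
    ultimately show "(case case a of (P, v) \<Rightarrow> (insert v P, v) of (Q, x) \<Rightarrow> (Q - {x}, x)) = a"
      "(case a of (P, v) \<Rightarrow> (insert v P, v)) \<in> (SIGMA Q:cliques U E (Suc j). Q)"
      "(case case a of (P, v) \<Rightarrow> (insert v P, v) of (Q, x) \<Rightarrow> g (Q - {x}) x) = (case a of (P, v) \<Rightarrow> g P v)"
      using a by auto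
  next
    fix b assume "b \<in> (SIGMA Q:cliques U E (Suc j). Q)"
    then obtain Q x where b: "b = (Q, x)" "Q \<in> cliques U E (Suc j)" "x \<in> Q" by auto
    have "Q - {x} \<in> cliques U E j" "x \<in> nbh U E (Q - {x})"
      using b fin[OF b(2)] by (auto simp: cliques_def nbh_def)
    then show "(case case b of (Q, x) \<Rightarrow> (Q - {x}, x) of (P, v) \<Rightarrow> (insert v P, v)) = b"
      "(case b of (Q, x) \<Rightarrow> (Q - {x}, x)) \<in> (SIGMA P:cliques U E j. nbh U E P)"
      using b by auto
  qed
  also have "\<dots> = (\<Sum>Q\<in>cliques U E (Suc j). \<Sum>x\<in>Q. g (Q - {x}) x)"
    using assms fin by (intro sum.Sigma[symmetric]) auto
  finally show ?thesis .
qed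

lemma sum_codegree:
  assumes "finite U" "loopless E"
  shows "(\<Sum>P\<in>cliques U E j. real (card (nbh U E P))) = real (Suc j) * real (card (cliques U E (Suc j)))"
proof -
  have "(\<Sum>P\<in>cliques U E j. real (card (nbh U E P))) = (\<Sum>P\<in>cliques U E j. \<Sum>v\<in>nbh U E P. (1::real))"
    by simp
  also have "\<dots> = (\<Sum>Q\<in>cliques U E (Suc j). \<Sum>x\<in>Q. 1)"
    by (rule sum_clique_extensions[OF assms])
  also have "\<dots> = (\<Sum>Q\<in>cliques U E (Suc j). real (Suc j))"
    by (intro sum.cong) (auto simp: cliques_def)
  finally show ?thesis by simp
qed

lemma sum_codegree_remove:
  assumes "finite U" "loopless E" "Q \<in> cliques U E (Suc j)"
  shows "(\<Sum>x\<in>Q. real (card (nbh U E (Q - {x}))))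
       = real (card (near U E Q)) + real (Suc j) * real (card (nbh U E Q))"
proof -
  have Q: "finite Q" "card Q = Suc j" using assms by (auto simp: cliques_def intro: finite_subset)
  \<comment> \<open>The vertex \<open>v\<close> extends \<open>Q - {x}\<close> exactly when
    \<open>D v\<close> is contained in \<open>{x}\<close>, so it is counted for every
    \<open>x\<close>, for one \<open>x\<close>, or never.\<close>
  define D where "D v = {x\<in>Q. {x, v} \<notin> E}" for v
  have *: "{x\<in>Q. v \<in> nbh U E (Q - {x})} = (if D v = {} then Q else if \<exists>x. D v = {x} then D v else {})"
    if "v \<in> U" for v
  proof -
    have "v \<in> nbh U E (Q - {x}) \<longleftrightarrow> D v \<subseteq> {x}" for x
      using that by (auto simp: nbh_def D_def)
    moreover have "D v \<subseteq> Q" by (auto simp: D_def)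
    ultimately show ?thesis by (auto simp: subset_singleton_iff)
  qed
  have "(\<Sum>x\<in>Q. real (card (nbh U E (Q - {x})))) = (\<Sum>x\<in>Q. \<Sum>v\<in>U. of_bool (v \<in> nbh U E (Q - {x})))"
    using assms(1) by (intro sum.cong refl) (simp add: of_bool_def sum.If_cases Int_def nbh_def)
  also have "\<dots> = (\<Sum>v\<in>U. \<Sum>x\<in>Q. of_bool (v \<in> nbh U E (Q - {x})))"
    by (rule sum.swap)
  also have "\<dots> = (\<Sum>v\<in>U. real (card {x\<in>Q. v \<in> nbh U E (Q - {x})}))"
    using Q by (intro sum.cong refl) (simp add: of_bool_def sum.If_cases Int_def)
  also have "\<dots> = (\<Sum>v\<in>U. of_bool (v \<in> near U E Q) + real (Suc j) * of_bool (v \<in> nbh U E Q))"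
  proof (rule sum.cong[OF refl])
    fix v assume v: "v \<in> U"
    have n1: "v \<in> nbh U E Q \<longleftrightarrow> D v = {}" using v by (auto simp: nbh_def D_def)
    have n2: "v \<in> near U E Q \<longleftrightarrow> (\<exists>x. D v = {x})" 
    proof -
      have "(\<exists>!x. x \<in> D v) \<longleftrightarrow> (\<exists>x. D v = {x})" by (auto simp: Ex1_def set_eq_iff)
      then show ?thesis using v by (simp add: near_def D_def)
    qed
    show "real (card {x\<in>Q. v \<in> nbh U E (Q - {x})})
      = of_bool (v \<in> near U E Q) + real (Suc j) * of_bool (v \<in> nbh U E Q)"
      unfolding *[OF v] n1 n2 using Q by auto
  qed
  also have "\<dots> = real (card (near U E Q)) + real (Suc j) * real (card (nbh U E Q))"
    using assms(1) unfolding sum.distrib sum_distrib_left[symmetric]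
    by (simp add: of_bool_def sum.If_cases Int_def near_def nbh_def)
  finally show ?thesis .
qed

lemma near_nbh_le:
  assumes "finite U"
  shows "card (near U E Q) + card (nbh U E Q) \<le> card U"
proof -
  have "near U E Q \<inter> nbh U E Q = {}" "near U E Q \<union> nbh U E Q \<subseteq> U" by (auto simp: near_def nbh_def)
  then show ?thesis using assms by (metis card_Un_disjoint card_mono finite_near finite_nbh)
qed

lemma sum_codegree_squared:
  assumes "finite U" "loopless E"
  shows "(\<Sum>P\<in>cliques U E j. (real (card (nbh U E P)))\<^sup>2)
       = (\<Sum>Q\<in>cliques U E (Suc j). real (card (near U E Q)))
         + real (Suc j) * real (Suc (Suc j)) * real (card (cliques U E (Suc (Suc j))))"
proof -
  have "(\<Sum>P\<in>cliques U E j. (real (card (nbh U E P)))\<^sup>2)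
      = (\<Sum>P\<in>cliques U E j. \<Sum>v\<in>nbh U E P. real (card (nbh U E P)))"
    by (simp add: power2_eq_square)
  also have "\<dots> = (\<Sum>Q\<in>cliques U E (Suc j). \<Sum>x\<in>Q. real (card (nbh U E (Q - {x}))))"
    by (rule sum_clique_extensions[OF assms])
  also have "\<dots> = (\<Sum>Q\<in>cliques U E (Suc j). real (card (near U E Q)) + real (Suc j) * real (card (nbh U E Q)))"
    by (intro sum.cong refl sum_codegree_remove assms)
  also have "\<dots> = (\<Sum>Q\<in>cliques U E (Suc j). real (card (near U E Q)))
     + real (Suc j) * (\<Sum>Q\<in>cliques U E (Suc j). real (card (nbh U E Q)))"
    by (simp add: sum.distrib sum_distrib_left)
  finally show ?thesis unfolding sum_codegree[OF assms] by (simp add: mult.assoc)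
qed

text \<open>Cauchy-Schwarz for the codegrees of the \<open>j\<close>-cliques, with the two moments
  from \<open>sum_codegree\<close> and \<open>sum_codegree_squared\<close>. The \<open>near\<close>
  term is left unestimated: near-equality will force it to be almost \<open>card U\<close> for most
  cliques.\<close>

lemma moon_moser_near:
  assumes "finite U" "loopless E"
  shows "(real (Suc j) * real (card (cliques U E (Suc j))))\<^sup>2
     \<le> real (card (cliques U E j)) * ((\<Sum>Q\<in>cliques U E (Suc j). real (card (near U E Q)))
         + real (Suc j) * real (Suc (Suc j)) * real (card (cliques U E (Suc (Suc j)))))"
proof -
  have "(\<Sum>P\<in>cliques U E j. 1 * real (card (nbh U E P)))\<^sup>2
    \<le> (\<Sum>P\<in>cliques U E j. 1\<^sup>2) * (\<Sum>P\<in>cliques U E j. (real (card (nbh U E P)))\<^sup>2)"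
    by (rule Cauchy_Schwarz_ineq_sum)
  then show ?thesis
    unfolding mult_1 sum_codegree[OF assms] sum_codegree_squared[OF assms] by simp
qed

text \<open>Bounds \<open>near\<close> by the complement of the common neighbourhood, which yields
  the classical inequality between three consecutive clique numbers.\<close>

lemma moon_moser:
  assumes "finite U" "loopless E"
  shows "(real (Suc j) * real (card (cliques U E (Suc j))))\<^sup>2
     \<le> real (card (cliques U E j)) * (real (card U) * real (card (cliques U E (Suc j)))
         + real j * real (Suc (Suc j)) * real (card (cliques U E (Suc (Suc j)))))"
proof -
  have "(\<Sum>Q\<in>cliques U E (Suc j). real (card (near U E Q)))
     \<le> (\<Sum>Q\<in>cliques U E (Suc j). real (card U) - real (card (nbh U E Q)))"
    using near_nbh_le[OF assms(1), of E] by (intro sum_mono) (simp add: le_diff_eq flip: of_nat_add)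
  also have "\<dots> = real (card U) * real (card (cliques U E (Suc j)))
     - real (Suc (Suc j)) * real (card (cliques U E (Suc (Suc j))))"
    unfolding sum_subtractf sum_codegree[OF assms] by simp
  finally have "(\<Sum>Q\<in>cliques U E (Suc j). real (card (near U E Q)))
         + real (Suc j) * real (Suc (Suc j)) * real (card (cliques U E (Suc (Suc j))))
    \<le> real (card U) * real (card (cliques U E (Suc j)))
         + real j * real (Suc (Suc j)) * real (card (cliques U E (Suc (Suc j))))"
    by (simp add: algebra_simps)
  then show ?thesis
    using moon_moser_near[OF assms, of j] by (meson mult_left_mono of_nat_0_le_iff order_trans)
qed

text \<open>Erdos's theorem, by induction on \<open>j\<close>. Many \<open>j\<close>-sets have links
  of linear size, so by averaging one \<open>m\<close>-set \<open>S\<close> lies in the links of a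
  positive proportion of all \<open>j\<close>-sets; the induction hypothesis applies to these, and
  \<open>S\<close> is the new class. Disjointness of nonempty classes is implicit, since every
  transversal has \<open>j\<close> elements.\<close>

lemma dense_complete_multipartite:
  fixes m :: nat
  shows "\<epsilon> > 0 \<Longrightarrow> \<exists>n0. \<forall>(V :: 'a set) \<Q>. finite V \<longrightarrow> card V \<ge> n0 \<longrightarrow>
    \<Q> \<subseteq> {Q. Q \<subseteq> V \<and> card Q = j} \<longrightarrow> real (card \<Q>) \<ge> \<epsilon> * real (card V) ^ j \<longrightarrow>
    (\<exists>T. (\<forall>i<j. T i \<subseteq> V \<and> card (T i) = m) \<and> (\<forall>f. (\<forall>i<j. f i \<in> T i) \<longrightarrow> f ` {..<j} \<in> \<Q>))"
proof (induction j arbitrary: \<epsilon>)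
  case 0
  show ?case
  proof (intro exI[of _ 0] allI impI)
    fix V :: "'a set" and \<Q> :: "'a set set"
    assume "finite V" "\<Q> \<subseteq> {Q. Q \<subseteq> V \<and> card Q = 0}" "real (card \<Q>) \<ge> \<epsilon> * real (card V) ^ 0"
    then have "\<Q> \<noteq> {}" "\<Q> \<subseteq> {{}}" using 0 by (auto simp: finite_subset)
    then show "\<exists>T. (\<forall>i<0. T i \<subseteq> V \<and> card (T i) = m) \<and> (\<forall>f. (\<forall>i<0. f i \<in> T i) \<longrightarrow> f ` {..<0::nat} \<in> \<Q>)"
      by auto
  qed
next
  case (Suc j)
  \<comment> \<open>The factor \<open>\<epsilon> / 2\<close> is the proportion of
    \<open>j\<close>-sets with a large link; the power bounds from below the number of
    \<open>m\<close>-sets in such a link, relative to \<open>N ^ m\<close>.\<close>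
  define \<epsilon>' where "\<epsilon>' = (\<epsilon> / 2) * (\<epsilon> / (2 * (real m + 1))) ^ m"
  have "\<epsilon>' > 0" using Suc.prems by (simp add: \<epsilon>'_def)
  from Suc.IH[OF this] obtain n0 where n0: "\<And>(V :: 'a set) \<Q>. finite V \<Longrightarrow> card V \<ge> n0 \<Longrightarrow>
    \<Q> \<subseteq> {Q. Q \<subseteq> V \<and> card Q = j} \<Longrightarrow> real (card \<Q>) \<ge> \<epsilon>' * real (card V) ^ j \<Longrightarrow>
    (\<exists>T. (\<forall>i<j. T i \<subseteq> V \<and> card (T i) = m) \<and> (\<forall>f. (\<forall>i<j. f i \<in> T i) \<longrightarrow> f ` {..<j} \<in> \<Q>))"
    by blast
  obtain n1 :: nat where n1: "real n1 \<ge> 2 * (real m + 1) / \<epsilon>" using real_arch_simple by blast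
  show ?case
  proof (intro exI[of _ "max n0 (max 1 n1)"] allI impI)
    fix V :: "'a set" and \<Q> :: "'a set set"
    assume fin: "finite V" and n: "max n0 (max 1 n1) \<le> card V"
      and \<Q>: "\<Q> \<subseteq> {Q. Q \<subseteq> V \<and> card Q = Suc j}" and large: "real (card \<Q>) \<ge> \<epsilon> * real (card V) ^ Suc j"
    define N where "N = real (card V)"
    have N: "N \<ge> 1" "N \<ge> 2 * (real m + 1) / \<epsilon>" using n n1 by (auto simp: N_def)
    define L where "L P = {x\<in>V. x \<notin> P \<and> insert x P \<in> \<Q>}" for P
    define \<P> where "\<P> = {P. P \<subseteq> V \<and> card P = j}"
    define \<G> where "\<G> = {P\<in>\<P>. real (card (L P)) \<ge> \<epsilon> / 2 * N}"
    have finP: "finite \<P>" "finite \<G>" "\<G> \<subseteq> \<P>" using fin by (auto simp: \<P>_def \<G>_def)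
    have finL: "finite (L P)" "real (card (L P)) \<le> N" for P
      using fin by (auto simp: L_def N_def intro!: card_mono)
    have cardP: "real (card \<P>) \<le> N ^ j"
      using card_subsets_le_power[OF fin, of \<P> j] by (simp add: \<P>_def N_def flip: of_nat_power)
    have "\<Q> \<subseteq> (\<lambda>(P, x). insert x P) ` (SIGMA P:\<P>. L P)"
    proof
      fix Q assume Q: "Q \<in> \<Q>"
      then have "card Q = Suc j" using \<Q> by blast
      then obtain x where x: "x \<in> Q" by (metis card.empty ex_in_conv nat.distinct(1))
      have "insert x (Q - {x}) = Q" using x by blast
      moreover have "(Q - {x}, x) \<in> (SIGMA P:\<P>. L P)" using x Q \<Q> calculation by (auto simp: \<P>_def L_def)
      ultimately show "Q \<in> (\<lambda>(P, x). insert x P) ` (SIGMA P:\<P>. L P)"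
        by (metis (no_types, lifting) case_prod_conv image_eqI)
    qed
    then have "card \<Q> \<le> card (SIGMA P:\<P>. L P)"
      using finP finL by (meson card_image_le card_mono finite_SigmaI finite_imageI order_trans)
    then have "\<epsilon> * N ^ Suc j \<le> (\<Sum>P\<in>\<P>. real (card (L P)))"
      using large finP finL by (simp add: N_def flip: of_nat_sum)
    also have "\<dots> = (\<Sum>P\<in>\<G>. real (card (L P))) + (\<Sum>P\<in>\<P> - \<G>. real (card (L P)))"
      using finP by (metis sum.subset_diff add.commute)
    also have "\<dots> \<le> (\<Sum>P\<in>\<G>. N) + (\<Sum>P\<in>\<P> - \<G>. \<epsilon> / 2 * N)"
    proof (intro add_mono sum_mono)
      show "real (card (L P)) \<le> N" for P by (rule finL)
      show "real (card (L P)) \<le> \<epsilon> / 2 * N" if "P \<in> \<P> - \<G>" for P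
        using that unfolding \<G>_def by (metis (mono_tags, lifting) DiffE linear mem_Collect_eq)
    qed
    also have "\<dots> \<le> real (card \<G>) * N + \<epsilon> / 2 * N * N ^ j"
    proof -
      have "real (card (\<P> - \<G>)) \<le> N ^ j"
        using cardP card_mono[of \<P> "\<P> - \<G>"] finP by (metis Diff_subset of_nat_mono order_trans)
      then have "real (card (\<P> - \<G>)) * (\<epsilon> / 2 * N) \<le> N ^ j * (\<epsilon> / 2 * N)"
        using Suc.prems N by (intro mult_right_mono) auto
      then show ?thesis by (simp add: mult_ac)
    qed
    finally have "\<epsilon> / 2 * N ^ j * N \<le> real (card \<G>) * N" by (simp add: mult_ac)
    then have cardG: "\<epsilon> / 2 * N ^ j \<le> real (card \<G>)" using N by simp
    define \<S> where "\<S> = {S. S \<subseteq> V \<and> card S = m}"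
    define R where "R S = {P\<in>\<P>. S \<subseteq> L P}" for S
    have finS: "finite \<S>" using fin by (simp add: \<S>_def)
    have cardS: "real (card \<S>) \<le> N ^ m"
      using card_subsets_le_power[OF fin, of \<S> m] by (simp add: \<S>_def N_def flip: of_nat_power)
    have each: "(\<epsilon> / (2 * (real m + 1)) * N) ^ m \<le> real (card {S\<in>\<S>. S \<subseteq> L P})" if "P \<in> \<G>" for P
    proof -
      have l: "real (card (L P)) \<ge> \<epsilon> / 2 * N" using that by (simp add: \<G>_def)
      moreover have "\<epsilon> / 2 * N \<ge> real m + 1" using N Suc.prems by (simp add: field_simps)
      ultimately have m: "m \<le> card (L P)" by linarith
      have "{S\<in>\<S>. S \<subseteq> L P} = {S. S \<subseteq> L P \<and> card S = m}" by (auto simp: \<S>_def L_def)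
      then have c: "card {S\<in>\<S>. S \<subseteq> L P} = card (L P) choose m" using finL by (simp add: n_subsets)
      have "(\<epsilon> / (2 * (real m + 1)) * N) ^ m \<le> (real (card (L P)) / real m) ^ m"
      proof (cases "m = 0")
        case False
        have "\<epsilon> / (2 * (real m + 1)) * N = \<epsilon> / 2 * N / (real m + 1)" by simp
        also have "\<dots> \<le> real (card (L P)) / real m" using l False N Suc.prems by (intro frac_le) auto
        finally show ?thesis using Suc.prems N by (intro power_mono) auto
      qed simp
      also have "\<dots> \<le> real (card (L P) choose m)" using binomial_ge_n_over_k_pow_k[OF m, where 'a = real] by simp
      finally show ?thesis unfolding c .
    qed
    have "\<epsilon>' * N ^ j * N ^ m = (\<epsilon> / 2 * N ^ j) * (\<epsilon> / (2 * (real m + 1)) * N) ^ m"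
      unfolding \<epsilon>'_def power_mult_distrib by (simp only: mult_ac)
    also have "\<dots> \<le> real (card \<G>) * (\<epsilon> / (2 * (real m + 1)) * N) ^ m"
      using cardG N Suc.prems by (intro mult_right_mono) auto
    also have "\<dots> = (\<Sum>P\<in>\<G>. (\<epsilon> / (2 * (real m + 1)) * N) ^ m)" by simp
    also have "\<dots> \<le> (\<Sum>P\<in>\<G>. real (card {S\<in>\<S>. S \<subseteq> L P}))" by (intro sum_mono each)
    also have "\<dots> \<le> (\<Sum>P\<in>\<P>. real (card {S\<in>\<S>. S \<subseteq> L P}))" using finP by (intro sum_mono2) auto
    also have "\<dots> = (\<Sum>P\<in>\<P>. \<Sum>S\<in>\<S>. of_bool (S \<subseteq> L P))"
      using finS by (intro sum.cong refl) (simp add: of_bool_def sum.If_cases Int_def)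
    also have "\<dots> = (\<Sum>S\<in>\<S>. \<Sum>P\<in>\<P>. of_bool (S \<subseteq> L P))" by (rule sum.swap)
    also have "\<dots> = (\<Sum>S\<in>\<S>. real (card (R S)))"
      using finP by (intro sum.cong refl) (simp add: of_bool_def sum.If_cases Int_def R_def)
    finally have tot: "\<epsilon>' * N ^ j * N ^ m \<le> (\<Sum>S\<in>\<S>. real (card (R S)))" .
    \<comment> \<open>There are at most \<open>N ^ m\<close> sets \<open>S\<close>, so one of them
      reaches the average.\<close>
    have "\<exists>S\<in>\<S>. real (card (R S)) \<ge> \<epsilon>' * N ^ j"
    proof (rule ccontr)
      assume "\<not> ?thesis"
      then have lt: "real (card (R S)) < \<epsilon>' * N ^ j" if "S \<in> \<S>" for S using that by force
      have "\<epsilon>' * N ^ j * N ^ m > 0" using \<open>\<epsilon>' > 0\<close> N by simp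
      then have "\<S> \<noteq> {}" using tot by auto
      then have "(\<Sum>S\<in>\<S>. real (card (R S))) < (\<Sum>S\<in>\<S>. \<epsilon>' * N ^ j)"
        using lt finS by (intro sum_strict_mono) auto
      also have "\<dots> \<le> \<epsilon>' * N ^ j * N ^ m"
        using cardS \<open>\<epsilon>' > 0\<close> N by (simp add: mult.commute)
      finally show False using tot by simp
    qed
    then obtain S where S: "S \<subseteq> V" "card S = m" "real (card (R S)) \<ge> \<epsilon>' * N ^ j"
      by (auto simp: \<S>_def)
    obtain T where T: "\<And>i. i < j \<Longrightarrow> T i \<subseteq> V \<and> card (T i) = m"
      "\<And>f. (\<forall>i<j. f i \<in> T i) \<Longrightarrow> f ` {..<j} \<in> R S"
    proof -
      have "R S \<subseteq> {Q. Q \<subseteq> V \<and> card Q = j}" by (auto simp: R_def \<P>_def)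
      then show ?thesis using n0[OF fin, of "R S"] n S(3) that unfolding N_def by auto
    qed
    define T' where "T' = T(j := S)"
    have "f ` {..<Suc j} \<in> \<Q>" if "\<forall>i<Suc j. f i \<in> T' i" for f
    proof -
      have "\<forall>i<j. f i \<in> T i" using that by (auto simp: T'_def less_Suc_eq split: if_splits)
      from T(2)[OF this] have "S \<subseteq> L (f ` {..<j})" by (simp add: R_def)
      moreover have "f j \<in> S" using that by (auto simp: T'_def)
      ultimately have "insert (f j) (f ` {..<j}) \<in> \<Q>" by (auto simp: L_def)
      then show ?thesis by (simp add: lessThan_Suc)
    qed
    moreover have "\<forall>i<Suc j. T' i \<subseteq> V \<and> card (T' i) = m"
      using T S by (auto simp: T'_def less_Suc_eq)
    ultimately show "\<exists>T. (\<forall>i<Suc j. T i \<subseteq> V \<and> card (T i) = m) \<and>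
      (\<forall>f. (\<forall>i<Suc j. f i \<in> T i) \<longrightarrow> f ` {..<Suc j} \<in> \<Q>)" by blast
  qed
qed

section \<open>Near-equality in the Moon-Moser inequalities\<close>

text \<open>Abstracts the clique counts of a graph on \<open>n\<close> vertices: the passage from
  clique densities to edge density uses nothing but these inequalities.\<close>

locale moon_moser_sequence =
  fixes n :: real and N :: "nat \<Rightarrow> real"
  assumes n_pos: "n > 0" and N_0: "N 0 = 1" and N_1: "N (Suc 0) = n" and N_nonneg: "N j \<ge> 0"
    and moon_moser: "(real (Suc j) * N (Suc j))\<^sup>2
      \<le> N j * (n * N (Suc j) + real j * real (Suc (Suc j)) * N (Suc (Suc j)))"
begin

text \<open>The average codegree of a \<open>j\<close>-clique divided by \<open>n\<close>. In a
  balanced complete \<open>r\<close>-partite graph it is \<open>1 - j / r\<close>; if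
  \<open>N j = 0\<close>, division by zero makes it 0.\<close>

definition \<rho> :: "nat \<Rightarrow> real" where
  "\<rho> j = real (Suc j) * N (Suc j) / (n * N j)"

text \<open>Normalised so that a balanced complete \<open>r\<close>-partite graph gives the constant
  \<open>1 / r\<close>. In these terms the Moon-Moser inequalities say that \<open>y\<close> does
  not increase (\<open>y_Suc\<close>). The index 0 carries no information.\<close>

definition y :: "nat \<Rightarrow> real" where
  "y j = (1 - \<rho> j) / real j"

lemma \<rho>_0: "\<rho> 0 = 1"
  using n_pos by (simp add: \<rho>_def N_0 N_1)

lemma \<rho>_nonneg: "\<rho> j \<ge> 0"
  using n_pos N_nonneg by (simp add: \<rho>_def)

lemma N_pos_Suc: "N (Suc j) > 0 \<Longrightarrow> N j > 0"
proof (rule ccontr)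
  assume a: "N (Suc j) > 0" "\<not> N j > 0"
  then have "N j = 0" using N_nonneg[of j] by simp
  then have "(real (Suc j) * N (Suc j))\<^sup>2 \<le> 0" using moon_moser[of j] by simp
  then show False using a by simp
qed

lemma N_pos_le: "i \<le> j \<Longrightarrow> N j > 0 \<Longrightarrow> N i > 0"
  by (induction j rule: dec_induct) (auto dest: N_pos_Suc)

lemma N_Suc: "N j > 0 \<Longrightarrow> real (Suc j) * N (Suc j) = \<rho> j * n * N j"
  using n_pos by (simp add: \<rho>_def)

lemma y_Suc:
  assumes "N (Suc j) > 0" "j > 0"
  shows "y (Suc j) \<le> y j"
proof -
  have pos: "N j > 0" using assms N_pos_Suc by blast
  have eq1: "real (Suc j) * N (Suc j) = \<rho> j * n * N j" and
    eq2: "real (Suc (Suc j)) * N (Suc (Suc j)) = \<rho> (Suc j) * n * N (Suc j)"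
    using N_Suc pos assms by blast+
  have "real (Suc j) * N (Suc j) * (\<rho> j * n * N j) = (real (Suc j) * N (Suc j))\<^sup>2"
    unfolding eq1 power2_eq_square ..
  also have "\<dots> \<le> N j * (n * N (Suc j) + real j * (real (Suc (Suc j)) * N (Suc (Suc j))))"
    using moon_moser[of j] by (simp only: mult.assoc)
  also have "\<dots> = (N j * n * N (Suc j)) * (1 + real j * \<rho> (Suc j))"
    unfolding eq2 by (simp add: algebra_simps)
  finally have "(N j * n * N (Suc j)) * (real (Suc j) * \<rho> j) \<le> (N j * n * N (Suc j)) * (1 + real j * \<rho> (Suc j))"
    by (simp add: mult_ac)
  then have *: "real (Suc j) * \<rho> j \<le> 1 + real j * \<rho> (Suc j)"
    using pos assms n_pos by (simp only: mult_le_cancel_left_pos mult_pos_pos)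
  have "real j * (1 - \<rho> (Suc j)) \<le> real (Suc j) * (1 - \<rho> j)"
    using * by (simp add: algebra_simps)
  then show ?thesis using assms by (simp add: y_def divide_simps mult.commute)
qed

lemma y_antimono: "i \<le> j \<Longrightarrow> 0 < i \<Longrightarrow> N j > 0 \<Longrightarrow> y j \<le> y i"
proof (induction j rule: dec_induct)
  case (step j)
  then have "N j > 0" using N_pos_Suc by blast
  then show ?case using step y_Suc[of j] by fastforce
qed simp

lemma \<rho>_eq: "j > 0 \<Longrightarrow> \<rho> j = 1 - real j * y j"
  by (simp add: y_def)

lemma N_prod: "(\<And>i. i < j \<Longrightarrow> N i > 0) \<Longrightarrow> fact j * N j = n ^ j * (\<Prod>i<j. \<rho> i)"
proof (induction j)
  case (Suc j)
  then have "fact (Suc j) * N (Suc j) = fact j * (real (Suc j) * N (Suc j))" by simp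
  also have "\<dots> = \<rho> j * n * (fact j * N j)" using N_Suc[of j] Suc by simp
  finally show ?case using Suc by simp
qed (simp add: N_0)

text \<open>As \<open>y j \<le> y 1\<close>, an edge density near \<open>1 - 1 / r\<close> bounds
  all later ratios from below. The condition on \<open>\<epsilon>\<close> keeps them above
  \<open>1 / (2 * r)\<close>, and this positivity carries \<open>N j > 0\<close> through the
  induction.\<close>

lemma \<rho>_lower:
  assumes "\<rho> 1 \<ge> 1 - 1 / real r - \<epsilon>" "0 \<le> \<epsilon>" "\<epsilon> \<le> 1 / (2 * (real r)\<^sup>2)" "j < r"
  shows "N j > 0 \<and> \<rho> j \<ge> 1 - real j / real r - real j * \<epsilon> \<and> \<rho> j \<ge> 1 / (2 * real r)"
  using assms(4)
proof (induction j)
  case 0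
  then show ?case by (simp add: \<rho>_0 N_0)
next
  case (Suc j)
  then have IH: "N j > 0" "\<rho> j \<ge> 1 / (2 * real r)" and r: "r > 0" by auto
  have "real (Suc j) * N (Suc j) > 0" unfolding N_Suc[OF IH(1)] using IH r n_pos
    by (intro mult_pos_pos) (auto intro: less_le_trans[rotated])
  then have pos: "N (Suc j) > 0" by (simp add: zero_less_mult_iff)
  have "y (Suc j) \<le> y 1" using pos by (intro y_antimono) auto
  also have "\<dots> \<le> 1 / real r + \<epsilon>" using assms by (simp add: y_def)
  finally have "real (Suc j) * y (Suc j) \<le> real (Suc j) * (1 / real r + \<epsilon>)" by (intro mult_left_mono) auto
  then have a: "\<rho> (Suc j) \<ge> 1 - real (Suc j) / real r - real (Suc j) * \<epsilon>"
    unfolding \<rho>_eq[OF zero_less_Suc] by (simp add: algebra_simps)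
  have "real (Suc j) * \<epsilon> \<le> real r * (1 / (2 * (real r)\<^sup>2))"
    using assms Suc.prems by (intro mult_mono) auto
  also have "\<dots> = 1 / (2 * real r)" using r by (simp add: power2_eq_square)
  finally have "real (Suc j) * \<epsilon> \<le> 1 / (2 * real r)" .
  moreover have "1 - real (Suc j) / real r \<ge> 1 / real r"
    using Suc.prems r by (simp add: field_simps)
  moreover have "1 / real r = 1 / (2 * real r) + 1 / (2 * real r)" by simp
  ultimately have "\<rho> (Suc j) \<ge> 1 / (2 * real r)" using a by linarith
  then show ?case using a pos by blast
qed

lemma N_lower:
  assumes "\<rho> 1 \<ge> 1 - 1 / real r - \<epsilon>" "0 \<le> \<epsilon>" "\<epsilon> \<le> 1 / (2 * (real r)\<^sup>2)"
  shows "fact r * N r \<ge> n ^ r * (1 / (2 * real r)) ^ r"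
proof -
  have "fact r * N r = n ^ r * (\<Prod>i<r. \<rho> i)" using \<rho>_lower[OF assms] by (intro N_prod) auto
  moreover have "(\<Prod>i<r. 1 / (2 * real r)) \<le> (\<Prod>i<r. \<rho> i)"
    using \<rho>_lower[OF assms] by (intro prod_mono) auto
  ultimately show ?thesis using n_pos by simp
qed

text \<open>If all ratios from \<open>k\<close> to \<open>r\<close> were at least
  \<open>\<theta>\<close>, multiplying them would give more \<open>(r + 1)\<close>-cliques than
  assumed.\<close>

lemma exists_small_\<rho>:
  assumes "N k > 0" "k \<le> r" "0 < \<theta>"
    and "fact (Suc r) * N (Suc r) < fact k * N k * (n * \<theta>) ^ (Suc r - k)"
  shows "\<exists>l. k \<le> l \<and> l \<le> r \<and> N l > 0 \<and> \<rho> l < \<theta>"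
proof (rule ccontr)
  assume "\<not> ?thesis"
  then have no: "\<And>l. k \<le> l \<Longrightarrow> l \<le> r \<Longrightarrow> N l > 0 \<Longrightarrow> \<rho> l \<ge> \<theta>" by force
  have "j \<le> Suc r \<Longrightarrow> N j > 0 \<and> fact j * N j \<ge> fact k * N k * (n * \<theta>) ^ (j - k)" if "k \<le> j" for j
    using that
  proof (induction j rule: dec_induct)
    case (step j)
    then have IH: "N j > 0" "fact j * N j \<ge> fact k * N k * (n * \<theta>) ^ (j - k)" by auto
    have \<rho>: "\<rho> j \<ge> \<theta>" using no IH step by auto
    have eq: "fact (Suc j) * N (Suc j) = (n * \<rho> j) * (fact j * N j)"
      using N_Suc[OF IH(1)] by (simp add: mult_ac)
    have "(n * \<theta>) * (fact k * N k * (n * \<theta>) ^ (j - k)) \<le> (n * \<rho> j) * (fact j * N j)"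
      using IH \<rho> n_pos assms by (intro mult_mono[OF _ IH(2)]) auto
    then have "fact k * N k * (n * \<theta>) ^ (Suc j - k) \<le> fact (Suc j) * N (Suc j)"
      unfolding eq using step by (simp add: Suc_diff_le mult_ac)
    moreover have "fact (Suc j) * N (Suc j) > 0"
      unfolding eq using n_pos \<rho> assms IH by (intro mult_pos_pos) auto
    ultimately show ?case
      using zero_less_mult_pos[of "fact (Suc j)" "N (Suc j)"] by (simp del: fact_Suc)
  qed (use assms in simp)
  then show False using assms by (meson le_SucI not_less order_refl)
qed

end

text \<open>The limit of \<open>k!\<close> times the number of \<open>k\<close>-cliques, divided by
  \<open>n ^ k\<close>, in the balanced complete \<open>r\<close>-partite graph.\<close>

definition turan_density :: "nat \<Rightarrow> nat \<Rightarrow> real" where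
  "turan_density r k = (\<Prod>i<k. 1 - real i / real r)"

lemma turan_density_pos: "k \<le> r \<Longrightarrow> turan_density r k > 0"
  unfolding turan_density_def by (intro prod_pos) (auto simp: field_simps)

text \<open>At \<open>\<theta> = 0\<close> only the factors with \<open>i = 0\<close> and
  \<open>i = 1\<close> survive in the quotient, so its value is \<open>1 - 1 / r\<close>; the claim
  is continuity at 0.\<close>

lemma exists_perturbed_quotient:
  assumes "2 \<le> k" "k \<le> r" "\<epsilon> > 0"
  shows "\<exists>\<theta>>0. \<theta> \<le> turan_density r k / 2 \<and> \<theta> < 1 \<and>
    (turan_density r k - \<theta>) / (\<Prod>i\<in>{2..<k}. 1 - real i / real r + \<theta>) > 1 - 1 / real r - \<epsilon>"
proof -
  define g where "g \<theta> = (turan_density r k - \<theta>) / (\<Prod>i\<in>{2..<k}. 1 - real i / real r + \<theta>)" for \<theta>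
  have nz: "(\<Prod>i\<in>{2..<k}. 1 - real i / real r + 0) \<noteq> 0" using assms by (auto simp: field_simps)
  have "{..<k} = {0, 1} \<union> {2..<k}" using assms by auto
  then have "turan_density r k = (1 - 1 / real r) * (\<Prod>i\<in>{2..<k}. 1 - real i / real r)"
    unfolding turan_density_def by (simp add: prod.union_disjoint)
  then have g0: "g 0 = 1 - 1 / real r" using nz by (simp add: g_def)
  have "isCont g 0" unfolding g_def using nz by (intro continuous_intros) auto
  then have "(g \<longlongrightarrow> g 0) (at_right 0)" by (simp add: isCont_def filterlim_at_split)
  then have "\<forall>\<^sub>F \<theta> in at_right 0. g \<theta> > 1 - 1 / real r - \<epsilon>"
    using assms by (intro order_tendstoD(1)[of g "g 0"]) (auto simp: g0)
  moreover have "\<forall>\<^sub>F \<theta> in at_right 0. \<theta> < min 1 (turan_density r k / 2)"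
    using eventually_at_right_real[of 0 "min 1 (turan_density r k / 2)"] turan_density_pos[OF assms(2)]
    by (auto elim: eventually_mono)
  moreover have "\<forall>\<^sub>F \<theta>::real in at_right 0. \<theta> > 0" by (rule eventually_at_right_less)
  ultimately have "\<forall>\<^sub>F \<theta> in at_right 0. \<theta> > 0 \<and> \<theta> < min 1 (turan_density r k / 2) \<and> g \<theta> > 1 - 1 / real r - \<epsilon>"
    by eventually_elim auto
  then obtain \<theta> where "\<theta> > 0" "\<theta> < min 1 (turan_density r k / 2)" "g \<theta> > 1 - 1 / real r - \<epsilon>"
    using eventually_happens'[OF trivial_limit_at_right_real] by blast
  then show ?thesis unfolding g_def by (intro exI[of _ \<theta>]) auto
qed

text \<open>Few \<open>(r + 1)\<close>-cliques force a small \<open>\<rho> l\<close> with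
  \<open>k \<le> l \<le> r\<close>. As \<open>y\<close> does not increase, this caps every
  \<open>\<rho> j\<close> with \<open>0 < j < k\<close> at about its Turan value. The product of
  these ratios can then be close to \<open>turan_density r k\<close> only if \<open>\<rho> 1\<close>
  nearly attains its cap.\<close>

lemma moon_moser_edge_density:
  assumes "2 \<le> k" "k \<le> r" "\<epsilon> > 0"
  shows "\<exists>\<delta>>0. \<forall>n N. moon_moser_sequence n N \<longrightarrow> N (Suc r) \<le> \<delta> * n ^ Suc r \<longrightarrow>
    fact k * N k \<ge> (turan_density r k - \<delta>) * n ^ k \<longrightarrow>
    moon_moser_sequence.\<rho> n N 1 \<ge> 1 - 1 / real r - \<epsilon>"
proof -
  obtain \<theta> where \<theta>: "\<theta> > 0" "\<theta> \<le> turan_density r k / 2" "\<theta> < 1"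
    "(turan_density r k - \<theta>) / (\<Prod>i\<in>{2..<k}. 1 - real i / real r + \<theta>) > 1 - 1 / real r - \<epsilon>"
    using exists_perturbed_quotient[OF assms] by blast
  \<comment> \<open>With at least half of the Turan number of \<open>k\<close>-cliques,
    \<open>\<delta>'\<close> makes the \<open>(r + 1)\<close>-cliques too few for
    \<open>exists_small_\<rho>\<close> to fail; the last division by 2 gives a strict
    inequality.\<close>
  define \<delta>' where "\<delta>' = turan_density r k / 2 * \<theta> ^ (Suc r - k) / fact (Suc r) / 2"
  define \<delta> where "\<delta> = min \<theta> \<delta>'"
  have t: "turan_density r k > 0" using turan_density_pos assms by blast
  have \<delta>': "\<delta>' > 0" using t \<theta> by (simp add: \<delta>'_def)
  show ?thesis
  proof (intro exI[of _ \<delta>] conjI allI impI)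
    show "\<delta> > 0" using \<theta> \<delta>' by (simp add: \<delta>_def)
    fix n N
    assume "moon_moser_sequence n N" and few: "N (Suc r) \<le> \<delta> * n ^ Suc r"
      and many: "fact k * N k \<ge> (turan_density r k - \<delta>) * n ^ k"
    then interpret moon_moser_sequence n N by simp
    have "(turan_density r k / 2) * n ^ k \<le> (turan_density r k - \<delta>) * n ^ k"
      using \<theta> n_pos by (intro mult_right_mono) (auto simp: \<delta>_def)
    then have many2: "fact k * N k \<ge> turan_density r k / 2 * n ^ k" using many by linarith
    moreover have "turan_density r k / 2 * n ^ k > 0" using t n_pos by simp
    ultimately have "fact k * N k > 0" by linarith
    then have Nk: "N k > 0" by (simp add: zero_less_mult_iff)
    have "fact (Suc r) * N (Suc r) \<le> fact (Suc r) * (\<delta>' * n ^ Suc r)"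
      using few n_pos by (intro mult_left_mono order_trans[OF few] mult_right_mono) (auto simp: \<delta>_def)
    also have "\<dots> < turan_density r k / 2 * \<theta> ^ (Suc r - k) * n ^ Suc r"
    proof -
      have "fact (Suc r) * \<delta>' = turan_density r k / 2 * \<theta> ^ (Suc r - k) / 2"
        by (simp add: \<delta>'_def del: fact_Suc)
      also have "\<dots> < turan_density r k / 2 * \<theta> ^ (Suc r - k)" using t \<theta> by simp
      finally have "fact (Suc r) * \<delta>' < turan_density r k / 2 * \<theta> ^ (Suc r - k)" .
      then have "fact (Suc r) * \<delta>' * n ^ Suc r < turan_density r k / 2 * \<theta> ^ (Suc r - k) * n ^ Suc r"
        using n_pos by (intro mult_strict_right_mono) auto
      then show ?thesis by (simp only: mult.assoc)
    qed
    also have "\<dots> = turan_density r k / 2 * n ^ k * (n * \<theta>) ^ (Suc r - k)"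
    proof -
      have "n ^ Suc r = n ^ k * n ^ (Suc r - k)" using assms by (simp flip: power_add)
      then show ?thesis by (simp only: power_mult_distrib mult_ac)
    qed
    also have "\<dots> \<le> fact k * N k * (n * \<theta>) ^ (Suc r - k)"
      using many2 n_pos \<theta> by (intro mult_right_mono) auto
    finally obtain l where l: "k \<le> l" "l \<le> r" "N l > 0" "\<rho> l < \<theta>"
      using exists_small_\<rho>[OF Nk assms(2) \<theta>(1)] by blast
    have yl: "y l \<ge> (1 - \<theta>) / real r"
    proof -
      have "(1 - \<theta>) / real r \<le> (1 - \<theta>) / real l" using l assms \<theta> by (intro divide_left_mono) auto
      also have "\<dots> \<le> y l" unfolding y_def using l by (intro divide_right_mono) auto
      finally show ?thesis .
    qed
    have up: "\<rho> j \<le> 1 - real j / real r + \<theta>" if "0 < j" "j < k" for j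
    proof -
      have "y j \<ge> (1 - \<theta>) / real r" using y_antimono[of j l] yl that l by auto
      then have "real j * y j \<ge> real j * ((1 - \<theta>) / real r)" by (intro mult_left_mono) auto
      moreover have "real j * ((1 - \<theta>) / real r) = real j / real r - \<theta> * (real j / real r)"
        by (simp add: algebra_simps diff_divide_distrib)
      moreover have "\<theta> * (real j / real r) \<le> \<theta> * 1"
        using that assms \<theta> by (intro mult_left_mono) auto
      ultimately show ?thesis unfolding \<rho>_eq[OF that(1)] by linarith
    qed
    have "(turan_density r k - \<theta>) * n ^ k \<le> (turan_density r k - \<delta>) * n ^ k"
      using n_pos by (intro mult_right_mono) (auto simp: \<delta>_def)
    also have "\<dots> \<le> n ^ k * (\<Prod>i<k. \<rho> i)"
      using many N_prod[of k] N_pos_le[OF _ Nk] by auto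
    finally have "turan_density r k - \<theta> \<le> (\<Prod>i<k. \<rho> i)" using n_pos by (simp add: mult.commute)
    also have "{..<k} = {0, 1} \<union> {2..<k}" using assms by auto
    then have "(\<Prod>i<k. \<rho> i) = \<rho> 1 * (\<Prod>i\<in>{2..<k}. \<rho> i)"
      by (simp add: prod.union_disjoint \<rho>_0)
    also have "\<dots> \<le> \<rho> 1 * (\<Prod>i\<in>{2..<k}. 1 - real i / real r + \<theta>)"
      using up \<rho>_nonneg by (intro mult_left_mono prod_mono) auto
    finally have "turan_density r k - \<theta> \<le> \<rho> 1 * (\<Prod>i\<in>{2..<k}. 1 - real i / real r + \<theta>)" .
    moreover have "(\<Prod>i\<in>{2..<k}. 1 - real i / real r + \<theta>) > 0"
      using assms \<theta> by (intro prod_pos add_nonneg_pos) (auto simp: field_simps)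
    ultimately have "(turan_density r k - \<theta>) / (\<Prod>i\<in>{2..<k}. 1 - real i / real r + \<theta>) \<le> \<rho> 1"
      by (simp add: pos_divide_le_eq)
    then show "1 - 1 / real r - \<epsilon> \<le> \<rho> 1" using \<theta>(4) by linarith
  qed
qed

lemma moon_moser_sequence_cliques:
  assumes "finite V" "loopless E" "V \<noteq> {}"
  shows "moon_moser_sequence (real (card V)) (\<lambda>j. real (card (cliques V E j)))"
proof
  show "0 < real (card V)" using assms by (simp add: card_gt_0_iff)
qed (use assms moon_moser[OF assms(1,2)] in \<open>simp_all add: card_cliques_1\<close>)

section \<open>Stability\<close>

text \<open>In a loopless graph the classes are automatically disjoint, since a common vertex would
  give a singleton edge.\<close>

definition has_multipartite :: "'a set \<Rightarrow> 'a set set \<Rightarrow> nat \<Rightarrow> nat \<Rightarrow> bool" where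
  "has_multipartite V E q s \<longleftrightarrow> (\<exists>T. (\<forall>i<q. T i \<subseteq> V \<and> s \<le> card (T i)) \<and>
     (\<forall>i<q. \<forall>j<q. i \<noteq> j \<longrightarrow> (\<forall>x\<in>T i. \<forall>y\<in>T j. {x, y} \<in> E)))"

text \<open>Complete \<open>x\<close> and \<open>y\<close> to a full transversal by arbitrary
  choices. Its image is a clique with \<open>q\<close> elements, so the choice is injective and
  \<open>x\<close>, \<open>y\<close> are adjacent.\<close>

lemma transversal_pair:
  assumes "\<And>f. (\<forall>i<q. f i \<in> T i) \<Longrightarrow> f ` {..<q} \<in> cliques V E q" "\<And>i. i < q \<Longrightarrow> T i \<noteq> {}"
    and "i < q" "j < q" "i \<noteq> j" "x \<in> T i" "y \<in> T j"
  shows "x \<noteq> y" "{x, y} \<in> E"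
proof -
  define f where "f l = (if l = i then x else if l = j then y else (SOME z. z \<in> T l))" for l
  have "\<forall>l<q. f l \<in> T l" using assms by (auto simp: f_def some_in_eq)
  then have c: "f ` {..<q} \<in> cliques V E q" by (rule assms(1))
  then have "card (f ` {..<q}) = card {..<q}" by (simp add: cliques_def)
  then have "inj_on f {..<q}" by (intro eq_card_imp_inj_on) auto
  then have "f i \<noteq> f j" using assms by (auto dest: inj_onD)
  then show "x \<noteq> y" using assms by (auto simp: f_def)
  moreover have "x \<in> f ` {..<q}" "y \<in> f ` {..<q}"
    using assms by (auto simp: f_def intro: image_eqI[where x = i] image_eqI[where x = j])
  ultimately show "{x, y} \<in> E" using c by (auto simp: cliques_def)
qed

text \<open>Density is measured against \<open>V\<close> while the cliques lie in \<open>U\<close>,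
  so one threshold \<open>n0\<close> also serves for neighbourhoods and for single classes of a
  partition.\<close>

lemma many_cliques_multipartite:
  assumes "\<epsilon> > 0" "s > 0"
  shows "\<exists>n0. \<forall>(V :: 'a set) U E. finite V \<longrightarrow> card V \<ge> n0 \<longrightarrow> U \<subseteq> V \<longrightarrow>
    real (card (cliques U E q)) \<ge> \<epsilon> * real (card V) ^ q \<longrightarrow> has_multipartite U E q s"
proof -
  obtain n0 where n0: "\<forall>(V :: 'a set) \<Q>. finite V \<longrightarrow> card V \<ge> n0 \<longrightarrow>
    \<Q> \<subseteq> {Q. Q \<subseteq> V \<and> card Q = q} \<longrightarrow> real (card \<Q>) \<ge> \<epsilon> * real (card V) ^ q \<longrightarrow>
    (\<exists>T. (\<forall>i<q. T i \<subseteq> V \<and> card (T i) = s) \<and> (\<forall>f. (\<forall>i<q. f i \<in> T i) \<longrightarrow> f ` {..<q} \<in> \<Q>))"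
    using dense_complete_multipartite[OF assms(1), of q s, where 'a = 'a] by (elim exE)
  show ?thesis
  proof (intro exI[of _ n0] allI impI)
    fix V U :: "'a set" and E :: "'a set set"
    assume a: "finite V" "n0 \<le> card V" "U \<subseteq> V" "real (card (cliques U E q)) \<ge> \<epsilon> * real (card V) ^ q"
    have "cliques U E q \<subseteq> {Q. Q \<subseteq> V \<and> card Q = q}" using a by (auto simp: cliques_def)
    from n0[rule_format, OF a(1,2) this a(4)] obtain T where T: "\<And>i. i < q \<Longrightarrow> T i \<subseteq> V \<and> card (T i) = s"
      "\<And>f. (\<forall>i<q. f i \<in> T i) \<Longrightarrow> f ` {..<q} \<in> cliques U E q" by blast
    have ne: "T i \<noteq> {}" if "i < q" for i using T(1)[OF that] assms by auto
    have TU: "T i \<subseteq> U" if "i < q" for i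
    proof
      fix x assume "x \<in> T i"
      then have "\<forall>l<q. (\<lambda>l. if l = i then x else (SOME z. z \<in> T l)) l \<in> T l" using ne by (auto simp: some_in_eq)
      from T(2)[OF this] show "x \<in> U" using that by (auto simp: cliques_def)
    qed
    show "has_multipartite U E q s" unfolding has_multipartite_def
      using T TU transversal_pair[OF T(2) ne] by (intro exI[of _ T]) auto
  qed
qed

section \<open>Ordered pairs across a partition and closeness to a Turan graph\<close>

lemma card_adjacent_pairs:
  assumes "finite U" "loopless E"
  shows "card {(x, y). x \<in> U \<and> y \<in> U \<and> {x, y} \<in> E} = 2 * card (cliques U E 2)"
proof -
  have "{(x, y). x \<in> U \<and> y \<in> U \<and> {x, y} \<in> E} = (SIGMA x:U. nbh U E {x})"
    by (auto simp: nbh_def)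
  then have "real (card {(x, y). x \<in> U \<and> y \<in> U \<and> {x, y} \<in> E}) = (\<Sum>x\<in>U. real (card (nbh U E {x})))"
    using assms by simp
  also have "\<dots> = (\<Sum>P\<in>cliques U E (Suc 0). real (card (nbh U E P)))"
    unfolding cliques_1 by (subst sum.reindex) (auto simp: inj_on_def)
  also have "\<dots> = 2 * real (card (cliques U E 2))"
    using sum_codegree[OF assms, of "Suc 0"] by (simp add: numeral_2_eq_2)
  finally show ?thesis by linarith
qed

definition cross :: "nat \<Rightarrow> (nat \<Rightarrow> 'a set) \<Rightarrow> ('a \<times> 'a) set" where
  "cross r W = {(x, y). \<exists>i<r. \<exists>j<r. i \<noteq> j \<and> x \<in> W i \<and> y \<in> W j}"

definition missing :: "'a set set \<Rightarrow> nat \<Rightarrow> (nat \<Rightarrow> 'a set) \<Rightarrow> ('a \<times> 'a) set" where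
  "missing E r W = {(x, y) \<in> cross r W. {x, y} \<notin> E}"

lemma card_cross:
  assumes "\<And>i. i < r \<Longrightarrow> finite (W i)" "\<And>i j. i < r \<Longrightarrow> j < r \<Longrightarrow> i \<noteq> j \<Longrightarrow> W i \<inter> W j = {}"
  shows "finite (cross r W)"
    "real (card (cross r W)) = (\<Sum>i<r. real (card (W i)))\<^sup>2 - (\<Sum>i<r. (real (card (W i)))\<^sup>2)"
proof -
  let ?U = "\<Union>i<r. W i" and ?D = "\<Union>i<r. W i \<times> W i"
  have eq: "?U \<times> ?U = cross r W \<union> ?D" by (auto simp: cross_def)
  have dis: "cross r W \<inter> ?D = {}" 
  proof -
    have "False" if "x \<in> W i" "y \<in> W j" "x \<in> W l" "y \<in> W l" "i < r" "j < r" "l < r" "i \<noteq> j" for x y i j l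
      using assms(2)[of i l] assms(2)[of j l] that by (cases "i = l") auto
    then show ?thesis by (auto simp: cross_def)
  qed
  have fU: "finite ?U" using assms(1) by simp
  then have "finite (?U \<times> ?U)" by (intro finite_cartesian_product)
  then have fin: "finite (cross r W)" "finite ?D" unfolding eq by (auto simp only: finite_Un)
  then show "finite (cross r W)" by simp
  have "card ?U = (\<Sum>i<r. card (W i))" using assms by (intro card_UN_disjoint) auto
  moreover have "card ?D = (\<Sum>i<r. card (W i \<times> W i))"
  proof (intro card_UN_disjoint ballI impI)
    fix i j assume "i \<in> {..<r}" "j \<in> {..<r}" "i \<noteq> j"
    then show "W i \<times> W i \<inter> W j \<times> W j = {}" using assms(2)[of i j] by auto
  qed (use assms in auto)
  moreover have "card (?U \<times> ?U) = card (cross r W) + card ?D"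
    unfolding eq by (rule card_Un_disjoint[OF fin dis])
  ultimately have "(\<Sum>i<r. card (W i)) * (\<Sum>i<r. card (W i)) = card (cross r W) + (\<Sum>i<r. card (W i) * card (W i))"
    by (simp add: card_cartesian_product)
  then have "real ((\<Sum>i<r. card (W i)) * (\<Sum>i<r. card (W i))) = real (card (cross r W) + (\<Sum>i<r. card (W i) * card (W i)))"
    by (rule arg_cong)
  then show "real (card (cross r W)) = (\<Sum>i<r. real (card (W i)))\<^sup>2 - (\<Sum>i<r. (real (card (W i)))\<^sup>2)"
    by (simp add: power2_eq_square)
qed

text \<open>The large sets \<open>W i\<close> form the approximate partition. The small sets
  \<open>T i\<close> are kept because their vertices are joined to all of every other
  \<open>W j\<close> without exception, which makes them suitable as models for cloning.\<close>

definition near_turan :: "'a set \<Rightarrow> 'a set set \<Rightarrow> nat \<Rightarrow> nat \<Rightarrow> real \<Rightarrow> (nat \<Rightarrow> 'a set) \<Rightarrow> (nat \<Rightarrow> 'a set) \<Rightarrow> bool" where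
  "near_turan V E r m \<eta> W T \<longleftrightarrow>
     (\<forall>i<r. W i \<subseteq> V \<and> T i \<subseteq> V \<and> card (T i) = m \<and> real (card (W i)) \<ge> real (card V) / (2 * real r)) \<and>
     (\<forall>i<r. \<forall>j<r. i \<noteq> j \<longrightarrow> W i \<inter> W j = {} \<and> (\<forall>x\<in>T i. \<forall>w\<in>W j. {x, w} \<in> E)) \<and>
     real (card (V - (\<Union>i<r. W i))) \<le> \<eta> * real (card V) \<and>
     real (card (missing E r W)) \<le> \<eta> * (real (card V))\<^sup>2"

text \<open>Ordered adjacent pairs that meet the uncovered set or lie inside a class are few, and by
  Cauchy-Schwarz there are at most about \<open>(1 - 1 / r) * n^2\<close> cross pairs. As the edges
  almost reach this number, few cross pairs are missing, and the squares of the class sizes have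
  almost minimal sum, so the classes are balanced.\<close>

lemma near_turan_of_partition:
  assumes V: "finite V" "loopless E" and r: "r \<ge> 2" and \<mu>: "0 < \<mu>" "\<mu> \<le> \<eta>" "\<mu> \<le> 1 / (4 * (real r)\<^sup>2)"
    and T: "\<And>i. i < r \<Longrightarrow> T i \<subseteq> V \<and> card (T i) = m"
    and W: "\<And>i. i < r \<Longrightarrow> W i \<subseteq> V"
      "\<And>i j. i < r \<Longrightarrow> j < r \<Longrightarrow> i \<noteq> j \<Longrightarrow> W i \<inter> W j = {} \<and> (\<forall>x\<in>T i. \<forall>w\<in>W j. {x, w} \<in> E)"
    and bad: "real (card (V - (\<Union>i<r. W i))) \<le> \<mu> / (8 * real r) * real (card V)"
    and inside: "\<And>i. i < r \<Longrightarrow> real (card (cliques (W i) E 2)) \<le> \<mu> / (8 * real r) * (real (card V))\<^sup>2"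
    and edges: "2 * real (card (cliques V E 2)) \<ge> (1 - 1 / real r - \<mu> / 4) * (real (card V))\<^sup>2"
  shows "near_turan V E r m \<eta> W T"
proof -
  define n where "n = real (card V)"
  define w where "w i = real (card (W i))" for i
  \<comment> \<open>The uncovered and inside pairs then cost at most \<open>\<mu> / 2 * n^2\<close>;
    with the edge deficit \<open>\<mu> / 4\<close> this makes \<open>3 / 4 * \<mu>\<close> in
    total.\<close>
  define \<eta>1 where "\<eta>1 = \<mu> / (8 * real r)"
  define B where "B = V - (\<Union>i<r. W i)"
  define Adj where "Adj U = {(x, y). x \<in> U \<and> y \<in> U \<and> {x, y} \<in> E}" for U
  have finW: "finite (W i)" if "i < r" for i using W(1)[OF that] V finite_subset by blast
  have finB: "finite B" using V by (simp add: B_def)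
  have finAdj: "finite (Adj U)" if "U \<subseteq> V" for U
    using that V by (intro finite_subset[of "Adj U" "V \<times> V"]) (auto simp: Adj_def)
  have cr1: "finite (cross r W)" using card_cross(1)[of r W] finW W(2) by blast
  have cr2: "real (card (cross r W)) = (\<Sum>i<r. w i)\<^sup>2 - (\<Sum>i<r. (w i)\<^sup>2)"
    unfolding w_def using card_cross(2)[of r W] finW W(2) by blast
  have sub: "Adj V \<subseteq> (B \<times> V \<union> V \<times> B) \<union> ((\<Union>i<r. Adj (W i)) \<union> (cross r W - missing E r W))"
    by (auto simp: Adj_def B_def missing_def cross_def)
  have finM: "finite (missing E r W)" "missing E r W \<subseteq> cross r W"
    using cr1 by (auto simp: missing_def intro: finite_subset)
  have "card (Adj V) \<le> card (B \<times> V \<union> V \<times> B) + card ((\<Union>i<r. Adj (W i)) \<union> (cross r W - missing E r W))"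
    using sub finB V cr1 finAdj W(1)
    by (intro order_trans[OF card_mono card_Un_le]) auto
  also have "card (B \<times> V \<union> V \<times> B) \<le> card (B \<times> V) + card (V \<times> B)" by (rule card_Un_le)
  also have "card ((\<Union>i<r. Adj (W i)) \<union> (cross r W - missing E r W))
      \<le> card (\<Union>i<r. Adj (W i)) + card (cross r W - missing E r W)" by (rule card_Un_le)
  also have "card (\<Union>i<r. Adj (W i)) \<le> (\<Sum>i<r. card (Adj (W i)))" by (rule card_UN_le) simp
  finally have "card (Adj V) \<le> card (B \<times> V) + card (V \<times> B) + ((\<Sum>i<r. card (Adj (W i))) + card (cross r W - missing E r W))"
    by simp
  then have "real (card (Adj V)) \<le> real (card (B \<times> V) + card (V \<times> B) + ((\<Sum>i<r. card (Adj (W i))) + card (cross r W - missing E r W)))"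
    by (rule of_nat_mono)
  also have "\<dots> = 2 * real (card B) * n + (\<Sum>i<r. real (card (Adj (W i)))) + (real (card (cross r W)) - real (card (missing E r W)))"
    using finM card_mono[OF cr1 finM(2)]
    by (simp add: card_cartesian_product card_Diff_subset n_def of_nat_diff)
  also have "(\<Sum>i<r. real (card (Adj (W i)))) \<le> (\<Sum>i<r. 2 * (\<eta>1 * n\<^sup>2))"
  proof (intro sum_mono)
    fix i assume "i \<in> {..<r}"
    then have "i < r" by simp
    then show "real (card (Adj (W i))) \<le> 2 * (\<eta>1 * n\<^sup>2)"
      unfolding Adj_def card_adjacent_pairs[OF finW[OF \<open>i < r\<close>] V(2)] \<eta>1_def n_def
      using inside[of i] by simp
  qed
  finally have a1: "real (card (Adj V)) + real (card (missing E r W))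
     \<le> 2 * real (card B) * n + 2 * real r * \<eta>1 * n\<^sup>2 + real (card (cross r W))" by simp
  have "2 * real (card B) * n \<le> 2 * \<eta>1 * n\<^sup>2"
  proof -
    have "real (card B) * n \<le> (\<eta>1 * n) * n"
      using bad by (intro mult_right_mono) (auto simp: B_def \<eta>1_def n_def)
    then show ?thesis by (simp add: power2_eq_square)
  qed
  moreover have "real (card (Adj V)) \<ge> (1 - 1 / real r - \<mu> / 4) * n\<^sup>2"
    using edges card_adjacent_pairs[OF V] by (simp add: Adj_def n_def)
  ultimately have a2: "(1 - 1 / real r - \<mu> / 4) * n\<^sup>2 + real (card (missing E r W))
    \<le> (2 + 2 * real r) * \<eta>1 * n\<^sup>2 + (\<Sum>i<r. w i)\<^sup>2 - (\<Sum>i<r. (w i)\<^sup>2)"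
    using a1 cr2 by (simp add: algebra_simps)
  have "(2 + 2 * real r) * \<eta>1 \<le> \<mu> / 2"
  proof -
    have "(2 + 2 * real r) * \<eta>1 \<le> (4 * real r) * \<eta>1" using r \<mu> by (intro mult_right_mono) (auto simp: \<eta>1_def)
    also have "\<dots> = \<mu> / 2" using r by (simp add: \<eta>1_def)
    finally show ?thesis .
  qed
  then have "(2 + 2 * real r) * \<eta>1 * n\<^sup>2 \<le> \<mu> / 2 * n\<^sup>2" by (intro mult_right_mono) auto
  then have a3: "(1 - 1 / real r) * n\<^sup>2 + real (card (missing E r W)) + (\<Sum>i<r. (w i)\<^sup>2)
    \<le> (3 / 4 * \<mu>) * n\<^sup>2 + (\<Sum>i<r. w i)\<^sup>2"
    using a2 by (simp add: algebra_simps)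
  have w_sum: "(\<Sum>i<r. w i) = real (card (\<Union>i<r. W i))"
    unfolding w_def of_nat_sum[symmetric]
    using finW W(2) by (subst card_UN_disjoint) auto
  have w_le: "(\<Sum>i<r. w i) \<le> n" unfolding w_sum n_def using W(1) V by (auto intro!: card_mono)
  have "card V \<le> card (\<Union>i<r. W i) + card B"
    using W(1) V by (intro order_trans[OF card_mono card_Un_le]) (auto simp: B_def intro: finW)
  then have w_ge: "(\<Sum>i<r. w i) \<ge> (1 - \<eta>1) * n"
    using bad unfolding w_sum n_def \<eta>1_def B_def by (simp add: algebra_simps)
  have w_nonneg: "w i \<ge> 0" for i by (simp add: w_def)
  have "(\<Sum>i<r. 1 * w i)\<^sup>2 \<le> (\<Sum>i<r. 1\<^sup>2) * (\<Sum>i<r. (w i)\<^sup>2)" by (rule Cauchy_Schwarz_ineq_sum)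
  then have cs: "(\<Sum>i<r. w i)\<^sup>2 / real r \<le> (\<Sum>i<r. (w i)\<^sup>2)"
    using r by (simp add: pos_divide_le_eq mult.commute)
  have "(\<Sum>i<r. w i)\<^sup>2 \<le> n\<^sup>2" using w_le w_nonneg by (intro power_mono) (auto intro: sum_nonneg)
  then have sq: "(1 - 1 / real r) * (\<Sum>i<r. w i)\<^sup>2 \<le> (1 - 1 / real r) * n\<^sup>2"
    using r by (intro mult_left_mono) auto
  have "real (card (missing E r W)) \<le> 3 / 4 * \<mu> * n\<^sup>2"
    using a3 cs sq by (simp add: algebra_simps)
  also have "\<dots> \<le> \<eta> * n\<^sup>2" using \<mu> by (intro mult_right_mono) auto
  finally have m_le: "real (card (missing E r W)) \<le> \<eta> * n\<^sup>2" .
  \<comment> \<open>The squared deviations of the class sizes from \<open>n / r\<close> add up to at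
    most \<open>\<mu> * n^2\<close>, and \<open>\<mu> \<le> 1 / (4 * r^2)\<close> makes each
    deviation at most half of \<open>n / r\<close>.\<close>
  have w_big: "w i \<ge> n / (2 * real r)" if "i < r" for i
  proof -
    have q1: "(\<Sum>i<r. (w i)\<^sup>2) \<le> 1 / real r * n\<^sup>2 + 3 / 4 * \<mu> * n\<^sup>2"
      using a3 \<open>(\<Sum>i<r. w i)\<^sup>2 \<le> n\<^sup>2\<close> by (simp add: algebra_simps)
    have q2: "2 * (1 / real r) * n\<^sup>2 - 2 * \<eta>1 / real r * n\<^sup>2 \<le> 2 * (n / real r) * (\<Sum>i<r. w i)"
    proof -
      have "2 * (1 / real r) * n\<^sup>2 - 2 * \<eta>1 / real r * n\<^sup>2 = 2 * (n / real r) * ((1 - \<eta>1) * n)"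
        by (simp add: algebra_simps power2_eq_square diff_divide_distrib)
      also have "\<dots> \<le> 2 * (n / real r) * (\<Sum>i<r. w i)"
        using w_ge by (intro mult_left_mono) (auto simp: n_def)
      finally show ?thesis .
    qed
    have "(\<Sum>i<r. (w i - n / real r)\<^sup>2) = (\<Sum>i<r. (w i)\<^sup>2 - 2 * (n / real r) * w i + (n / real r)\<^sup>2)"
      by (intro sum.cong) (auto simp: power2_diff)
    also have "\<dots> = (\<Sum>i<r. (w i)\<^sup>2) - 2 * (n / real r) * (\<Sum>i<r. w i) + real r * (n / real r)\<^sup>2"
      by (simp add: sum.distrib sum_subtractf sum_distrib_left)
    also have "real r * (n / real r)\<^sup>2 = 1 / real r * n\<^sup>2" using r by (simp add: power2_eq_square)
    also have "(\<Sum>i<r. (w i)\<^sup>2) - 2 * (n / real r) * (\<Sum>i<r. w i) + 1 / real r * n\<^sup>2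
      \<le> (1 / real r * n\<^sup>2 + 3 / 4 * \<mu> * n\<^sup>2) - (2 * (1 / real r) * n\<^sup>2 - 2 * \<eta>1 / real r * n\<^sup>2) + 1 / real r * n\<^sup>2"
      by (intro add_mono diff_mono q1 q2 order_refl)
    also have "\<dots> = (3 / 4 * \<mu> + 2 * \<eta>1 / real r) * n\<^sup>2" by (simp add: distrib_right)
    also have "\<dots> \<le> \<mu> * n\<^sup>2"
    proof (intro mult_right_mono)
      have "2 * \<eta>1 / real r = \<mu> / (4 * (real r)\<^sup>2)" by (simp add: \<eta>1_def power2_eq_square)
      also have "\<dots> \<le> \<mu> / 4" using r \<mu> by (intro divide_left_mono) (auto simp: power2_eq_square intro!: mult_ge1_I)
      finally show "3 / 4 * \<mu> + 2 * \<eta>1 / real r \<le> \<mu>" by simp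
    qed simp
    also have "\<dots> \<le> 1 / (4 * (real r)\<^sup>2) * n\<^sup>2" using \<mu> by (intro mult_right_mono) auto
    also have "\<dots> = (n / (2 * real r))\<^sup>2" by (simp add: power_divide power_mult_distrib)
    finally have "(\<Sum>i<r. (w i - n / real r)\<^sup>2) \<le> (n / (2 * real r))\<^sup>2" .
    moreover have "(w i - n / real r)\<^sup>2 \<le> (\<Sum>i<r. (w i - n / real r)\<^sup>2)"
      using that by (intro member_le_sum) auto
    ultimately have "(w i - n / real r)\<^sup>2 \<le> (n / (2 * real r))\<^sup>2" by linarith
    then have "\<bar>w i - n / real r\<bar> \<le> n / (2 * real r)"
      using abs_le_square_iff[of "w i - n / real r" "n / (2 * real r)"] by (simp add: n_def)
    moreover have "n / real r = n / (2 * real r) + n / (2 * real r)" by simp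
    ultimately show ?thesis by linarith
  qed
  have "real (card B) \<le> \<eta> * n"
  proof -
    have "\<mu> / (8 * real r) \<le> \<mu> / 1" using \<mu> r by (intro divide_left_mono) auto
    then have "\<mu> / (8 * real r) * n \<le> \<eta> * n" using \<mu> by (intro mult_right_mono) (auto simp: n_def)
    then show ?thesis using bad by (simp add: B_def n_def)
  qed
  then show ?thesis
    unfolding near_turan_def using T W m_le w_big by (auto simp: B_def n_def w_def)
qed


text \<open>A vertex near to every transversal misses the same class each time, as exchanging the
  members of a transversal one by one shows, and so lies in some \<open>W i\<close>. An uncovered
  vertex therefore fails to be near to one of the \<open>m ^ r\<close> transversals.\<close>

lemma uncovered_le:
  assumes V: "finite V" and r: "r > 0"
    and T: "\<And>i. i < r \<Longrightarrow> finite (T i) \<and> card (T i) = m \<and> T i \<noteq> {}"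
      "\<And>i j. i < r \<Longrightarrow> j < r \<Longrightarrow> i \<noteq> j \<Longrightarrow> T i \<inter> T j = {}"
    and near: "\<And>f. (\<forall>i<r. f i \<in> T i) \<Longrightarrow> real (card V) - real (card (near V E (f ` {..<r}))) \<le> \<beta>"
  defines "W \<equiv> \<lambda>i. {v\<in>V. (\<forall>x\<in>T i. {x, v} \<notin> E) \<and> (\<forall>j<r. j \<noteq> i \<longrightarrow> (\<forall>x\<in>T j. {x, v} \<in> E))}"
  shows "real (card (V - (\<Union>i<r. W i))) \<le> real m ^ r * \<beta>"
proof -
  define \<F> where "\<F> = PiE {..<r} T"
  have finF: "finite \<F>" unfolding \<F>_def using T by (intro finite_PiE) auto
  have cardF: "card \<F> = m ^ r" unfolding \<F>_def using T by (simp add: card_PiE)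
  have "V - (\<Union>i<r. W i) \<subseteq> (\<Union>f\<in>\<F>. V - near V E (f ` {..<r}))"
  proof (rule ccontr)
    assume "\<not> ?thesis"
    then obtain v where v: "v \<in> V" "\<And>i. i < r \<Longrightarrow> v \<notin> W i"
      "\<And>f. f \<in> \<F> \<Longrightarrow> v \<in> near V E (f ` {..<r})" by blast
    have inj: "f i \<noteq> f j" if "f \<in> \<F>" "i < r" "j < r" "i \<noteq> j" for f i j
      using that T(2)[OF that(2-4)] by (auto simp: \<F>_def PiE_iff)
    have upd: "f(j := x) \<in> \<F>" if "f \<in> \<F>" "j < r" "x \<in> T j" for f j x
      using that by (auto simp: \<F>_def PiE_iff extensional_def)
    have "\<F> \<noteq> {}" unfolding \<F>_def using T by (simp add: PiE_eq_empty_iff)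
    then obtain f where f: "f \<in> \<F>" by blast
    have one: "\<exists>i<r. {g i, v} \<notin> E \<and> (\<forall>j<r. j \<noteq> i \<longrightarrow> {g j, v} \<in> E)" if "g \<in> \<F>" for g
    proof -
      define x where "x = (THE x. x \<in> g ` {..<r} \<and> {x, v} \<notin> E)"
      have ex1: "\<exists>!x. x \<in> g ` {..<r} \<and> {x, v} \<notin> E" using v(3)[OF that] by (simp add: near_def)
      from theI'[OF this] have x: "x \<in> g ` {..<r}" "{x, v} \<notin> E" by (simp_all add: x_def)
      then obtain i where i: "i < r" "x = g i" by auto
      have "{g j, v} \<in> E" if "j < r" "j \<noteq> i" for j
      proof (rule ccontr)
        assume "{g j, v} \<notin> E"
        then have "x = g j" unfolding x_def using that by (intro the1_equality[OF ex1]) auto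
        then show False using inj[OF \<open>g \<in> \<F>\<close> i(1) that(1)] that i by simp
      qed
      then show ?thesis using x i by (intro exI[of _ i]) simp
    qed
    obtain i where i: "i < r" "{f i, v} \<notin> E" "\<And>j. j < r \<Longrightarrow> j \<noteq> i \<Longrightarrow> {f j, v} \<in> E" using one[OF f] by blast
    \<comment> \<open>After an exchange in class \<open>j\<close> the vertex \<open>f i\<close> is
      still the one missed, so the new vertex is adjacent to \<open>v\<close>. An exchange in class
      \<open>i\<close> keeps all other adjacencies, so there the new vertex must be missed.\<close>
    have "{x, v} \<in> E" if j: "j < r" "j \<noteq> i" and x: "x \<in> T j" for j x
    proof (rule ccontr)
      assume "{x, v} \<notin> E"
      with one[OF upd[OF f j(1) x]] i(1,2) j show False
        by (metis fun_upd_apply)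
    qed
    moreover have "{x, v} \<notin> E" if x: "x \<in> T i" for x
    proof
      assume "{x, v} \<in> E"
      with one[OF upd[OF f i(1) x]] i(1,3) show False
        by (metis fun_upd_apply)
    qed
    ultimately have "v \<in> W i" using v(1) by (auto simp: W_def)
    then show False using v(2) i(1) by blast
  qed
  then have "card (V - (\<Union>i<r. W i)) \<le> card (\<Union>f\<in>\<F>. V - near V E (f ` {..<r}))"
    using V finF by (intro card_mono) auto
  also have "\<dots> \<le> (\<Sum>f\<in>\<F>. card (V - near V E (f ` {..<r})))" by (rule card_UN_le[OF finF])
  finally have "real (card (V - (\<Union>i<r. W i))) \<le> (\<Sum>f\<in>\<F>. real (card (V - near V E (f ` {..<r}))))"
    by (simp flip: of_nat_sum)
  also have "\<dots> \<le> (\<Sum>f\<in>\<F>. \<beta>)"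
  proof (rule sum_mono)
    fix f assume "f \<in> \<F>"
    then have "\<forall>i<r. f i \<in> T i" by (auto simp: \<F>_def PiE_iff)
    moreover have "near V E (f ` {..<r}) \<subseteq> V" by (auto simp: near_def)
    ultimately show "real (card (V - near V E (f ` {..<r}))) \<le> \<beta>"
      using near V by (simp add: card_Diff_subset finite_subset card_mono of_nat_diff)
  qed
  also have "\<dots> = real m ^ r * \<beta>" by (simp add: cardF)
  finally show ?thesis .
qed

text \<open>\<open>moon_moser_near\<close> for \<open>(r - 1)\<close>-cliques, together with
  \<open>\<rho> (r - 1)\<close> being at least about \<open>1 / r\<close>, shows that
  \<open>near\<close> has almost \<open>n\<close> elements on average over all
  \<open>r\<close>-cliques. Markov's inequality then discards at most half of them; \<open>c\<close>
  is half of the lower bound for their density.\<close>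

lemma many_near_cliques:
  assumes V: "finite V" "loopless E" "V \<noteq> {}" and r: "r \<ge> 2" and \<epsilon>: "0 \<le> \<epsilon>" "\<epsilon> \<le> 1 / (2 * (real r)\<^sup>2)"
    and \<delta>: "real (card (cliques V E (Suc r))) \<le> \<delta> * real (card V) ^ Suc r"
    and \<rho>: "moon_moser_sequence.\<rho> (real (card V)) (\<lambda>j. real (card (cliques V E j))) 1 \<ge> 1 - 1 / real r - \<epsilon>"
    and \<beta>: "\<beta> > 0" and small: "(real r)\<^sup>2 * \<epsilon> + (real r + 1)\<^sup>2 * \<delta> \<le> \<beta> * c"
    and c: "c = (1 / (2 * real r)) ^ r / fact r / 2"
  shows "real (card {Q\<in>cliques V E r. real (card V) - real (card (near V E Q)) \<le> \<beta> * real (card V)})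
     \<ge> c * real (card V) ^ r"
proof -
  define n where "n = real (card V)"
  define N where "N j = real (card (cliques V E j))" for j
  interpret moon_moser_sequence n N
    using moon_moser_sequence_cliques[OF V] unfolding n_def N_def .
  have \<rho>': "\<rho> 1 \<ge> 1 - 1 / real r - \<epsilon>" using \<rho> unfolding n_def N_def .
  define b where "b Q = n - real (card (near V E Q))" for Q
  define \<G> where "\<G> = {Q\<in>cliques V E r. b Q \<le> \<beta> * n}"
  obtain q where q: "r = Suc q" "q > 0" using r by (cases r) auto
  have b_nonneg: "b Q \<ge> 0" for Q
    using near_nbh_le[OF V(1), of E Q] by (simp add: b_def n_def flip: of_nat_add)
  have Npos: "N q > 0" and rq: "\<rho> q \<ge> 1 - real q / real r - real q * \<epsilon>"
    using \<rho>_lower[OF \<rho>' \<epsilon>, of q] q by auto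
  have "real q * \<epsilon> \<le> real r * \<epsilon>" using \<epsilon> q by (intro mult_right_mono) auto
  moreover have "1 - real q / real r = 1 / real r" using q by (simp add: field_simps)
  ultimately have rq: "\<rho> q \<ge> 1 / real r - real r * \<epsilon>" using rq by linarith
  have rN: "real r * N r = \<rho> q * n * N q" using N_Suc[OF Npos] q by simp
  have sq: "(real r * N r)\<^sup>2 = N q * (\<rho> q * n * (real r * N r))"
    unfolding power2_eq_square by (subst (1) rN) (simp only: mult_ac)
  have "(real r * N r)\<^sup>2 \<le> N q * ((\<Sum>Q\<in>cliques V E r. real (card (near V E Q))) + real r * (real r + 1) * N (Suc r))"
    using moon_moser_near[OF V(1,2), of q] by (simp add: N_def q algebra_simps)
  then have "N q * (\<rho> q * n * (real r * N r))
     \<le> N q * ((\<Sum>Q\<in>cliques V E r. real (card (near V E Q))) + real r * (real r + 1) * N (Suc r))"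
    unfolding sq .
  then have "\<rho> q * n * (real r * N r)
     \<le> (\<Sum>Q\<in>cliques V E r. real (card (near V E Q))) + real r * (real r + 1) * N (Suc r)"
    using Npos by simp
  moreover have "(1 / real r - real r * \<epsilon>) * (n * (real r * N r)) \<le> \<rho> q * (n * (real r * N r))"
    using rq n_pos N_nonneg by (intro mult_right_mono) auto
  moreover have "(1 / real r - real r * \<epsilon>) * (n * (real r * N r)) = n * N r - (real r)\<^sup>2 * \<epsilon> * (n * N r)"
    using q by (simp add: field_simps power2_eq_square)
  moreover have "(\<Sum>Q\<in>cliques V E r. b Q) = n * N r - (\<Sum>Q\<in>cliques V E r. real (card (near V E Q)))"
    by (simp add: b_def sum_subtractf N_def mult.commute)
  ultimately have sb: "(\<Sum>Q\<in>cliques V E r. b Q) \<le> (real r)\<^sup>2 * \<epsilon> * (n * N r) + real r * (real r + 1) * N (Suc r)"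
    by (simp add: mult.assoc)
  have Nr: "N r \<le> n ^ r" using card_cliques_le[OF V(1), of E r] by (simp add: N_def n_def flip: of_nat_power)
  have "n * N r \<le> n ^ Suc r" using Nr n_pos by simp
  then have "(real r)\<^sup>2 * \<epsilon> * (n * N r) \<le> (real r)\<^sup>2 * \<epsilon> * n ^ Suc r" using \<epsilon> by (intro mult_left_mono) auto
  moreover have "real r * (real r + 1) * N (Suc r) \<le> (real r + 1)\<^sup>2 * (\<delta> * n ^ Suc r)"
    using \<delta> N_nonneg[of "Suc r"] by (intro mult_mono) (auto simp: N_def n_def power2_eq_square algebra_simps)
  ultimately have "(\<Sum>Q\<in>cliques V E r. b Q) \<le> ((real r)\<^sup>2 * \<epsilon> + (real r + 1)\<^sup>2 * \<delta>) * n ^ Suc r"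
    using sb by (simp add: algebra_simps)
  also have "\<dots> \<le> \<beta> * c * n ^ Suc r" using small n_pos by (intro mult_right_mono) auto
  finally have sb2: "(\<Sum>Q\<in>cliques V E r. b Q) \<le> \<beta> * c * n ^ Suc r" .
  have "(\<Sum>Q\<in>cliques V E r - \<G>. \<beta> * n) \<le> (\<Sum>Q\<in>cliques V E r - \<G>. b Q)"
    by (intro sum_mono) (auto simp: \<G>_def)
  also have "\<dots> \<le> (\<Sum>Q\<in>cliques V E r. b Q)" using V b_nonneg by (intro sum_mono2) auto
  finally have "real (card (cliques V E r - \<G>)) * (\<beta> * n) \<le> c * n ^ r * (\<beta> * n)"
    using sb2 by (simp add: mult_ac)
  then have bad: "real (card (cliques V E r - \<G>)) \<le> c * n ^ r"
    using \<beta> n_pos by (simp only: mult_le_cancel_right_pos mult_pos_pos)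
  have sub: "\<G> \<subseteq> cliques V E r" by (auto simp: \<G>_def)
  then have "real (card (cliques V E r - \<G>)) = N r - real (card \<G>)"
    using V by (simp add: card_Diff_subset finite_subset[OF sub] N_def of_nat_diff card_mono)
  moreover have "N r \<ge> 2 * c * n ^ r"
  proof -
    have "2 * c * n ^ r = n ^ r * (1 / (2 * real r)) ^ r / fact r" by (simp add: c mult.commute)
    also have "\<dots> \<le> N r" using N_lower[OF \<rho>' \<epsilon>] by (simp add: pos_divide_le_eq mult.commute)
    finally show ?thesis .
  qed
  ultimately have "c * n ^ r \<le> real (card \<G>)" using bad by linarith
  then show ?thesis by (simp add: \<G>_def b_def n_def)
qed

text \<open>Erdos's theorem is applied not to all \<open>r\<close>-cliques but to those to which
  almost every vertex is near, so that every transversal of the resulting \<open>T\<close> has this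
  property. \<open>W i\<close> collects the vertices that miss \<open>T i\<close> entirely and see
  all of the other classes of \<open>T\<close>.\<close>

theorem near_turan_structure:
  assumes k: "2 \<le> k" "k \<le> r" and s: "0 < s" "s \<le> m" and \<eta>: "\<eta> > 0"
  shows "\<exists>\<delta>>0. \<exists>n0. \<forall>(V :: 'a set) E. finite V \<longrightarrow> loopless E \<longrightarrow> card V \<ge> n0 \<longrightarrow>
    \<not> has_multipartite V E (Suc r) s \<longrightarrow>
    fact k * real (card (cliques V E k)) \<ge> (turan_density r k - \<delta>) * real (card V) ^ k \<longrightarrow>
    (\<exists>W T. near_turan V E r m \<eta> W T)"
proof -
  have r: "r \<ge> 2" using k by simp
  define \<mu> where "\<mu> = min \<eta> (1 / (4 * (real r)\<^sup>2))"
  define \<eta>1 where "\<eta>1 = \<mu> / (8 * real r)"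
  \<comment> \<open>The exceptions to the \<open>m ^ r\<close> transversals must add up to at most
    \<open>\<eta>1 * n\<close> vertices.\<close>
  define \<beta> where "\<beta> = \<eta>1 / real m ^ r"
  define c where "c = (1 / (2 * real r)) ^ r / fact r / 2"
  define \<epsilon> where "\<epsilon> = min (\<mu> / 4) (min (1 / (2 * (real r)\<^sup>2)) (\<beta> * c / (2 * (real r)\<^sup>2)))"
  have \<mu>: "0 < \<mu>" "\<mu> \<le> \<eta>" "\<mu> \<le> 1 / (4 * (real r)\<^sup>2)" using \<eta> r by (auto simp: \<mu>_def)
  have \<eta>1: "\<eta>1 > 0" using \<mu> r by (simp add: \<eta>1_def)
  have \<beta>: "\<beta> > 0" using \<eta>1 s by (simp add: \<beta>_def)
  have c: "c > 0" using r by (simp add: c_def)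
  have \<epsilon>: "\<epsilon> > 0" "\<epsilon> \<le> \<mu> / 4" "\<epsilon> \<le> 1 / (2 * (real r)\<^sup>2)" "\<epsilon> \<le> \<beta> * c / (2 * (real r)\<^sup>2)"
    using \<mu> \<beta> c r by (auto simp: \<epsilon>_def)
  obtain \<delta>1 where \<delta>1: "\<delta>1 > 0" "\<And>n N. moon_moser_sequence n N \<Longrightarrow> N (Suc r) \<le> \<delta>1 * n ^ Suc r \<Longrightarrow>
    fact k * N k \<ge> (turan_density r k - \<delta>1) * n ^ k \<Longrightarrow>
    moon_moser_sequence.\<rho> n N 1 \<ge> 1 - 1 / real r - \<epsilon>"
    using moon_moser_edge_density[OF k \<epsilon>(1)] by blast
  define \<delta> where "\<delta> = min \<delta>1 (\<beta> * c / (2 * (real r + 1)\<^sup>2))"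
  have \<delta>: "\<delta> > 0" "\<delta> \<le> \<delta>1" "\<delta> \<le> \<beta> * c / (2 * (real r + 1)\<^sup>2)"
    using \<delta>1 \<beta> c by (auto simp: \<delta>_def intro!: divide_pos_pos add_nonneg_pos)
  obtain n1 where n1: "\<forall>(V :: 'a set) U E. finite V \<longrightarrow> card V \<ge> n1 \<longrightarrow> U \<subseteq> V \<longrightarrow>
    real (card (cliques U E (Suc r))) \<ge> \<delta> * real (card V) ^ Suc r \<longrightarrow> has_multipartite U E (Suc r) s"
    using many_cliques_multipartite[OF \<delta>(1) s(1), of "Suc r", where 'a = 'a] by (elim exE)
  obtain n2 where n2: "\<forall>(V :: 'a set) U E. finite V \<longrightarrow> card V \<ge> n2 \<longrightarrow> U \<subseteq> V \<longrightarrow>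
    real (card (cliques U E 2)) \<ge> \<eta>1 * real (card V) ^ 2 \<longrightarrow> has_multipartite U E 2 s"
    using many_cliques_multipartite[OF \<eta>1 s(1), of 2, where 'a = 'a] by (elim exE)
  obtain n3 where n3: "\<forall>(V :: 'a set) \<Q>. finite V \<longrightarrow> card V \<ge> n3 \<longrightarrow>
    \<Q> \<subseteq> {Q. Q \<subseteq> V \<and> card Q = r} \<longrightarrow> real (card \<Q>) \<ge> c * real (card V) ^ r \<longrightarrow>
    (\<exists>T. (\<forall>i<r. T i \<subseteq> V \<and> card (T i) = m) \<and> (\<forall>f. (\<forall>i<r. f i \<in> T i) \<longrightarrow> f ` {..<r} \<in> \<Q>))"
    using dense_complete_multipartite[OF c, of r m, where 'a = 'a] by (elim exE)
  show ?thesis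
  proof (intro exI[of _ \<delta>] conjI exI[of _ "max 1 (max n1 (max n2 n3))"] allI impI)
    show "\<delta> > 0" by (rule \<delta>)
    fix V :: "'a set" and E :: "'a set set"
    assume V: "finite V" "loopless E" and n: "max 1 (max n1 (max n2 n3)) \<le> card V"
      and free: "\<not> has_multipartite V E (Suc r) s"
      and many: "fact k * real (card (cliques V E k)) \<ge> (turan_density r k - \<delta>) * real (card V) ^ k"
    define N where "N j = real (card (cliques V E j))" for j
    have ne: "V \<noteq> {}" using n by auto
    have N_eq: "N = (\<lambda>j. real (card (cliques V E j)))" by (simp add: N_def fun_eq_iff)
    interpret moon_moser_sequence "real (card V)" N
      using moon_moser_sequence_cliques[OF V ne] unfolding N_def .
    have few: "N (Suc r) \<le> \<delta> * real (card V) ^ Suc r"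
      using n1[rule_format, of V V E] V n free unfolding N_def by fastforce
    have "N (Suc r) \<le> \<delta>1 * real (card V) ^ Suc r"
      by (rule order_trans[OF few mult_right_mono]) (use \<delta> in auto)
    moreover have "(turan_density r k - \<delta>1) * real (card V) ^ k \<le> (turan_density r k - \<delta>) * real (card V) ^ k"
      using \<delta> by (intro mult_right_mono) auto
    ultimately have \<rho>1: "\<rho> 1 \<ge> 1 - 1 / real r - \<epsilon>"
      using many moon_moser_sequence_axioms by (intro \<delta>1(2)) (auto simp: N_def)
    have small: "(real r)\<^sup>2 * \<epsilon> + (real r + 1)\<^sup>2 * \<delta> \<le> \<beta> * c"
    proof -
      have "(real r)\<^sup>2 * \<epsilon> \<le> \<beta> * c / 2" using \<epsilon>(4) r by (simp add: field_simps)
      moreover have "(real r + 1)\<^sup>2 * \<delta> \<le> (real r + 1)\<^sup>2 * (\<beta> * c / (2 * (real r + 1)\<^sup>2))"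
        using \<delta>(3) by (intro mult_left_mono) auto
      moreover have "(real r + 1)\<^sup>2 * (\<beta> * c / (2 * (real r + 1)\<^sup>2)) = \<beta> * c / 2" by (simp add: field_simps)
      ultimately show ?thesis by linarith
    qed
    define \<G> where "\<G> = {Q\<in>cliques V E r. real (card V) - real (card (near V E Q)) \<le> \<beta> * real (card V)}"
    have "real (card \<G>) \<ge> c * real (card V) ^ r" unfolding \<G>_def
      using few \<rho>1 \<epsilon> \<beta> small unfolding N_eq
      by (intro many_near_cliques[OF V ne r _ _ _ _ _ _ c_def, of \<epsilon> \<delta>]) auto
    moreover have "\<G> \<subseteq> {Q. Q \<subseteq> V \<and> card Q = r}" by (auto simp: \<G>_def cliques_def)
    moreover have "n3 \<le> card V" using n by simp
    ultimately have "\<exists>T. (\<forall>i<r. T i \<subseteq> V \<and> card (T i) = m) \<and> (\<forall>f. (\<forall>i<r. f i \<in> T i) \<longrightarrow> f ` {..<r} \<in> \<G>)"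
      using n3 V(1) by blast
    then obtain T where T: "\<And>i. i < r \<Longrightarrow> T i \<subseteq> V \<and> card (T i) = m"
      "\<And>f. (\<forall>i<r. f i \<in> T i) \<Longrightarrow> f ` {..<r} \<in> \<G>" by blast
    have Tne: "T i \<noteq> {}" "finite (T i)" if "i < r" for i using T(1)[OF that] s V finite_subset by auto
    have Tc: "f ` {..<r} \<in> cliques V E r" if "\<forall>i<r. f i \<in> T i" for f
      using T(2)[OF that] by (simp add: \<G>_def)
    note pair = transversal_pair[where T = T and q = r and V = V and E = E, OF Tc Tne(1)]
    define W where "W i = {v\<in>V. (\<forall>x\<in>T i. {x, v} \<notin> E) \<and> (\<forall>j<r. j \<noteq> i \<longrightarrow> (\<forall>x\<in>T j. {x, v} \<in> E))}" for i
    have disj: "W i \<inter> W j = {}" if "i < r" "j < r" "i \<noteq> j" for i j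
      using that Tne(1)[of i] by (auto simp: W_def)
    have "real (card (V - (\<Union>i<r. W i))) \<le> real m ^ r * (\<beta> * real (card V))"
      unfolding W_def
    proof (rule uncovered_le[OF V(1)])
      show "T i \<inter> T j = {}" if "i < r" "j < r" "i \<noteq> j" for i j
        using pair(1)[OF _ _ that] by blast
      show "real (card V) - real (card (near V E (f ` {..<r}))) \<le> \<beta> * real (card V)" if "\<forall>i<r. f i \<in> T i" for f
        using T(2)[OF that] by (simp add: \<G>_def)
    qed (use r T(1) Tne in auto)
    also have "\<dots> = \<eta>1 * real (card V)" using s by (simp add: \<beta>_def)
    finally have bad: "real (card (V - (\<Union>i<r. W i))) \<le> \<eta>1 * real (card V)" .
    \<comment> \<open>Many edges inside \<open>W i\<close> would contain a complete bipartite graph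
      with classes of size \<open>s\<close>. Together with the \<open>T l\<close> for
      \<open>l \<noteq> i\<close>, which are joined to all of \<open>W i\<close>, it would form the
      excluded \<open>(r + 1)\<close>-partite graph.\<close>
    have inside: "real (card (cliques (W i) E 2)) \<le> \<eta>1 * (real (card V))\<^sup>2" if i: "i < r" for i
    proof (rule ccontr)
      assume "\<not> ?thesis"
      moreover have "W i \<subseteq> V" by (auto simp: W_def)
      ultimately have "has_multipartite (W i) E 2 s" using n2 V n by fastforce
      then obtain S :: "nat \<Rightarrow> 'a set" where S': "\<forall>l<2. S l \<subseteq> W i \<and> s \<le> card (S l)"
        "\<forall>i<2. \<forall>j<2. i \<noteq> j \<longrightarrow> (\<forall>x\<in>S i. \<forall>y\<in>S j. {x, y} \<in> E)"
        unfolding has_multipartite_def by (elim exE conjE)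
      then have S: "\<And>l. l < 2 \<Longrightarrow> S l \<subseteq> W i \<and> s \<le> card (S l)"
        "\<And>l l' x y. l < 2 \<Longrightarrow> l' < 2 \<Longrightarrow> l \<noteq> l' \<Longrightarrow> x \<in> S l \<Longrightarrow> y \<in> S l' \<Longrightarrow> {x, y} \<in> E"
        by simp_all
      define X where "X l = (if l = i then S 0 else if l = r then S 1 else T l)" for l :: nat
      have S01: "{x, y} \<in> E" if "x \<in> S 0" "y \<in> S 1" for x y using S(2)[of 0 1] that by auto
      have SW: "{x, y} \<in> E" if "x \<in> T l" "y \<in> S a" "a < 2" "l < r" "l \<noteq> i" for x y l a
        using S(1)[of a] that by (auto simp: W_def)
      have X: "X i = S 0" "X r = S 1" "\<And>l. l \<noteq> i \<Longrightarrow> l \<noteq> r \<Longrightarrow> X l = T l" using i by (auto simp: X_def)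
      \<comment> \<open>Covers the pairs whose second class is one of the \<open>T l'\<close>, and
        the pair \<open>S 0\<close>, \<open>S 1\<close> in this order; the others follow by
        symmetry.\<close>
      have adj1: "{x, y} \<in> E" if "l < Suc r" "l' < Suc r" "l \<noteq> l'" "x \<in> X l" "y \<in> X l'" "l' \<noteq> i" "l' \<noteq> r \<or> l = i" for l l' x y
      proof -
        have l: "l < r \<or> l = r" "l' < r \<or> l' = r" using that by auto
        show ?thesis
        proof (cases "l = i")
          case True
          show ?thesis
          proof (cases "l' = r")
            case True
            then show ?thesis using that X S01 \<open>l = i\<close> by simp
          next
            case False
            then show ?thesis using that X l \<open>l = i\<close> SW[of y l' x 0] by (simp add: insert_commute)
          qed
        next
          case False
          then have l': "l' < r" "l' \<noteq> r" using that l by auto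
          show ?thesis
          proof (cases "l = r")
            case True
            then show ?thesis using that X l' SW[of y l' x 1] by (simp add: insert_commute)
          next
            case False
            then show ?thesis using that X l l' \<open>l \<noteq> i\<close> pair(2)[of l l' x y] by simp
          qed
        qed
      qed
      have adj: "{x, y} \<in> E" if "l < Suc r" "l' < Suc r" "l \<noteq> l'" "x \<in> X l" "y \<in> X l'" for l l' x y
      proof (cases "l' \<noteq> i \<and> (l' \<noteq> r \<or> l = i)")
        case True
        then show ?thesis using adj1[OF that] by blast
      next
        case False
        then have "{y, x} \<in> E" using adj1[OF that(2,1) not_sym[OF that(3)] that(5,4)] that(3) by blast
        then show ?thesis by (simp add: insert_commute)
      qed
      have "has_multipartite V E (Suc r) s"
        unfolding has_multipartite_def
      proof (intro exI[of _ X] conjI allI impI ballI)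
        fix l assume "l < Suc r"
        have "S 0 \<subseteq> V" "S 1 \<subseteq> V" "s \<le> card (S 0)" "s \<le> card (S 1)"
          using S(1)[of 0] S(1)[of 1] \<open>W i \<subseteq> V\<close> by auto
        then show "X l \<subseteq> V" "s \<le> card (X l)"
          using \<open>l < Suc r\<close> T(1)[of l] s by (auto simp: X_def less_Suc_eq)
      qed (use adj in blast)
      then show False using free by blast
    qed
    have "near_turan V E r m \<eta> W T"
    proof (rule near_turan_of_partition[OF V r \<mu>])
      have "2 * N 2 = \<rho> 1 * (real (card V))\<^sup>2"
        using N_Suc[of 1] n by (simp add: N_1 numeral_2_eq_2)
      moreover have "(1 - 1 / real r - \<mu> / 4) * (real (card V))\<^sup>2 \<le> \<rho> 1 * (real (card V))\<^sup>2"
        using \<rho>1 \<epsilon> by (intro mult_right_mono) auto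
      ultimately show "(1 - 1 / real r - \<mu> / 4) * (real (card V))\<^sup>2 \<le> 2 * real (card (cliques V E 2))"
        by (simp add: N_def)
      show "W i \<inter> W j = {} \<and> (\<forall>x\<in>T i. \<forall>w\<in>W j. {x, w} \<in> E)" if "i < r" "j < r" "i \<noteq> j" for i j
        using disj[OF that] that by (auto simp: W_def)
    qed (use T(1) bad inside in \<open>auto simp: W_def \<eta>1_def\<close>)
    then show "\<exists>W T. near_turan V E r m \<eta> W T" by blast
  qed
qed

section \<open>Common neighbourhoods\<close>

text \<open>Vertex sets instead of choice functions, so that they can be compared with
  \<open>cliques\<close> directly.\<close>

definition transversals :: "'a set set \<Rightarrow> nat set \<Rightarrow> (nat \<Rightarrow> 'a set) \<Rightarrow> 'a set set" where
  "transversals E J A = (\<lambda>f. f ` J) ` {f \<in> PiE J A. \<forall>i\<in>J. \<forall>j\<in>J. i \<noteq> j \<longrightarrow> {f i, f j} \<in> E}"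

lemma card_PiE_two_fixed_le:
  assumes "finite V" "finite J" "\<And>j. j \<in> J \<Longrightarrow> A j \<subseteq> V" "i \<in> J" "j \<in> J" "i \<noteq> j"
  shows "card {f \<in> PiE J A. f i = x \<and> f j = y} \<le> card V ^ (card J - 2)"
proof -
  let ?B = "A(i := {x}, j := {y})"
  have finA: "finite (A l)" if "l \<in> J" for l using assms that finite_subset by blast
  have "card {f \<in> PiE J A. f i = x \<and> f j = y} \<le> card (PiE J ?B)"
    using assms finA by (intro card_mono finite_PiE) (auto simp: PiE_iff extensional_def)
  also have "\<dots> = (\<Prod>l\<in>J. card (?B l))" using assms by (simp add: card_PiE)
  also have "\<dots> = (\<Prod>l\<in>J - {i, j}. card (A l))"
    using assms by (intro prod.mono_neutral_cong_right) auto
  also have "\<dots> \<le> (\<Prod>l\<in>J - {i, j}. card V)"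
    using assms by (intro prod_mono) (auto intro!: card_mono)
  also have "\<dots> = card V ^ (card J - 2)"
    using assms by (simp add: card_Diff_subset numeral_2_eq_2)
  finally show ?thesis .
qed

text \<open>A choice function whose image is not a clique takes a missing pair at two indices of
  \<open>J\<close>, and a fixed pair at fixed indices is taken by at most
  \<open>n ^ (card J - 2)\<close> functions. Disjointness of the \<open>A j\<close> makes distinct
  functions have distinct images.\<close>

lemma card_transversals_ge:
  assumes V: "finite V" and W: "\<And>i. i < r \<Longrightarrow> W i \<subseteq> V" "\<And>i j. i < r \<Longrightarrow> j < r \<Longrightarrow> i \<noteq> j \<Longrightarrow> W i \<inter> W j = {}"
    and J: "J \<subseteq> {..<r}" and A: "\<And>j. j \<in> J \<Longrightarrow> A j \<subseteq> W j"
    and miss: "real (card (missing E r W)) \<le> \<eta> * (real (card V))\<^sup>2"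
  shows "real (card (transversals E J A))
    \<ge> (\<Prod>j\<in>J. real (card (A j))) - (real (card J))\<^sup>2 * \<eta> * real (card V) ^ card J"
proof -
  define \<F> where "\<F> = {f \<in> PiE J A. \<forall>i\<in>J. \<forall>j\<in>J. i \<noteq> j \<longrightarrow> {f i, f j} \<in> E}"
  define n where "n = real (card V)"
  have finJ: "finite J" using J finite_subset by blast
  have AV: "A j \<subseteq> V" if "j \<in> J" for j using A[OF that] W(1) J that by blast
  have finP: "finite (PiE J A)" using finJ AV V by (intro finite_PiE) (auto intro: finite_subset)
  have disj: "A i \<inter> A j = {}" if "i \<in> J" "j \<in> J" "i \<noteq> j" for i j
    using W(2)[of i j] A that J by blast
  have "inj_on (\<lambda>f. f ` J) \<F>"
  proof (rule inj_onI)
    fix f g assume fg: "f \<in> \<F>" "g \<in> \<F>" "f ` J = g ` J"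
    show "f = g"
    proof (rule PiE_ext[of _ J A])
      show "f \<in> PiE J A" "g \<in> PiE J A" using fg by (auto simp: \<F>_def)
      then have m: "f i \<in> A i" "g i \<in> A i" if "i \<in> J" for i using that by (auto simp: PiE_iff)
      fix i assume i: "i \<in> J"
      then obtain j where j: "j \<in> J" "f i = g j" using fg(3) by (metis imageE imageI)
      then have "i = j" using disj[OF i j(1)] m i by (metis disjoint_iff)
      then show "f i = g i" using j by simp
    qed
  qed
  then have cT: "card (transversals E J A) = card \<F>"
    unfolding transversals_def \<F>_def by (rule card_image)
  define \<B> where "\<B> = PiE J A - \<F>"
  have cB: "real (card \<B>) \<le> (real (card J))\<^sup>2 * \<eta> * n ^ card J"
  proof (cases "card J \<ge> 2")
    case False
    have "\<B> = {}"
    proof -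
      have "i = j" if "i \<in> J" "j \<in> J" for i j
        using False that finJ card_le_Suc0_iff_eq[of J] by auto
      then show ?thesis by (auto simp: \<B>_def \<F>_def)
    qed
    \<comment> \<open>The sign of \<open>\<eta>\<close> is not given, but \<open>miss\<close> makes
      it nonnegative unless \<open>V\<close> is empty.\<close>
    moreover have "0 \<le> \<eta> * n\<^sup>2" using miss by (simp add: n_def)
    moreover have "\<eta> \<ge> 0 \<or> n = 0" using calculation(2) by (auto simp: zero_le_mult_iff)
    moreover have "card J = 0 \<or> card J > 0" by blast
    ultimately show ?thesis using finJ by (auto simp: n_def zero_power)
  next
    case True
    define I where "I = {(i, j). i \<in> J \<and> j \<in> J \<and> i \<noteq> j}"
    define Fx where "Fx p q = {f \<in> PiE J A. f (fst p) = fst q \<and> f (snd p) = snd q}" for p :: "nat \<times> nat" and q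
    have finI: "finite I" "card I \<le> (card J)\<^sup>2"
    proof -
      have "I \<subseteq> J \<times> J" by (auto simp: I_def)
      then show "finite I" "card I \<le> (card J)\<^sup>2"
        using finJ card_mono[of "J \<times> J" I] by (auto simp: card_cartesian_product power2_eq_square intro: finite_subset)
    qed
    have "finite (missing E r W)"
      using card_cross(1)[of r W] W V by (auto simp: missing_def intro: finite_subset)
    have "\<B> \<subseteq> (\<Union>p\<in>I. \<Union>q\<in>missing E r W. Fx p q)"
    proof
      fix f assume "f \<in> \<B>"
      then obtain i j where f: "f \<in> PiE J A" "i \<in> J" "j \<in> J" "i \<noteq> j" "{f i, f j} \<notin> E"
        by (auto simp: \<B>_def \<F>_def)
      then have "f i \<in> W i" "f j \<in> W j" using A by (auto simp: PiE_iff)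
      then have "(f i, f j) \<in> missing E r W" using f J by (auto simp: missing_def cross_def)
      then show "f \<in> (\<Union>p\<in>I. \<Union>q\<in>missing E r W. Fx p q)"
        using f by (intro UN_I[of "(i, j)"] UN_I[of "(f i, f j)"]) (auto simp: I_def Fx_def)
    qed
    moreover have finFx: "finite (Fx p q)" for p q using finP by (simp add: Fx_def)
    ultimately have "card \<B> \<le> card (\<Union>p\<in>I. \<Union>q\<in>missing E r W. Fx p q)"
      using finI \<open>finite (missing E r W)\<close> by (intro card_mono) auto
    also have "\<dots> \<le> (\<Sum>p\<in>I. card (\<Union>q\<in>missing E r W. Fx p q))" by (rule card_UN_le[OF finI(1)])
    also have "\<dots> \<le> (\<Sum>p\<in>I. \<Sum>q\<in>missing E r W. card (Fx p q))"
      by (intro sum_mono card_UN_le \<open>finite (missing E r W)\<close>)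
    also have "\<dots> \<le> (\<Sum>p\<in>I. \<Sum>q\<in>missing E r W. card V ^ (card J - 2))"
      unfolding Fx_def using V finJ AV by (intro sum_mono card_PiE_two_fixed_le) (auto simp: I_def)
    also have "\<dots> = card I * card (missing E r W) * card V ^ (card J - 2)" by simp
    also have "\<dots> \<le> (card J)\<^sup>2 * card (missing E r W) * card V ^ (card J - 2)"
      using finI by (intro mult_right_mono) auto
    finally have "real (card \<B>) \<le> real ((card J)\<^sup>2 * card (missing E r W) * card V ^ (card J - 2))"
      by (rule of_nat_mono)
    also have "\<dots> = (real (card J))\<^sup>2 * real (card (missing E r W)) * n ^ (card J - 2)"
      by (simp add: n_def)
    also have "\<dots> \<le> (real (card J))\<^sup>2 * (\<eta> * n\<^sup>2) * n ^ (card J - 2)"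
      using miss by (intro mult_right_mono mult_left_mono) (auto simp: n_def)
    also have "\<dots> = (real (card J))\<^sup>2 * \<eta> * n ^ card J"
    proof -
      have "n\<^sup>2 * n ^ (card J - 2) = n ^ card J" using True by (metis le_add_diff_inverse power_add)
      then show ?thesis by (simp only: mult.assoc)
    qed
    finally show ?thesis .
  qed
  have sub: "\<F> \<subseteq> PiE J A" by (auto simp: \<F>_def)
  have "card \<B> = card (PiE J A) - card \<F>"
    unfolding \<B>_def using sub finP by (intro card_Diff_subset) (auto intro: finite_subset)
  then have "real (card \<F>) = real (card (PiE J A)) - real (card \<B>)"
    using card_mono[OF finP sub] by (simp add: of_nat_diff)
  then show ?thesis using cT cB finJ by (simp add: card_PiE n_def)
qed

lemma transversals_cliques:
  assumes "finite J" "\<And>i j. i \<in> J \<Longrightarrow> j \<in> J \<Longrightarrow> i \<noteq> j \<Longrightarrow> A i \<inter> A j = {}" "Q \<in> transversals E J A"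
  shows "Q \<in> cliques (\<Union>j\<in>J. A j) E (card J)" "j \<in> J \<Longrightarrow> Q \<inter> A j \<noteq> {}"
proof -
  obtain f where f: "f \<in> PiE J A" "\<And>i j. i \<in> J \<Longrightarrow> j \<in> J \<Longrightarrow> i \<noteq> j \<Longrightarrow> {f i, f j} \<in> E" "Q = f ` J"
    using assms(3) by (auto simp: transversals_def)
  have m: "f i \<in> A i" if "i \<in> J" for i using f(1) that by (auto simp: PiE_iff)
  have "inj_on f J"
  proof (rule inj_onI)
    fix i j assume "i \<in> J" "j \<in> J" "f i = f j"
    then show "i = j" using assms(2)[of i j] m[of i] m[of j] by auto
  qed
  then have "card Q = card J" using f by (simp add: card_image)
  then show "Q \<in> cliques (\<Union>j\<in>J. A j) E (card J)" using m f by (auto simp: cliques_def)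
  show "Q \<inter> A j \<noteq> {}" if "j \<in> J" using m[OF that] f that by auto
qed

text \<open>Among \<open>C\<close> vertices of \<open>Z\<close>, double counting gives a positive
  proportion of \<open>r\<close>-tuples that are cliques in the neighbourhoods of at least
  \<open>s\<close> of them. Pigeonholing over the at most \<open>2 ^ C\<close> subsets fixes one
  \<open>s\<close>-set \<open>S\<close>; Erdos's theorem inside its common neighbourhood gives
  \<open>r\<close> classes, and \<open>S\<close> is the class number \<open>r + 1\<close>.\<close>

lemma few_rich_vertices:
  assumes g: "g > 0" and s: "s > 0"
  shows "\<exists>C n0. \<forall>(V :: 'a set) E Z. finite V \<longrightarrow> card V \<ge> n0 \<longrightarrow> Z \<subseteq> V \<longrightarrow>
    \<not> has_multipartite V E (Suc r) s \<longrightarrow>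
    (\<forall>z\<in>Z. real (card (cliques (nbh V E {z}) E r)) \<ge> g * real (card V) ^ r) \<longrightarrow> card Z \<le> C"
proof -
  \<comment> \<open>Cliques outside \<open>\<X>\<close> contribute at most \<open>s * n ^ r\<close>,
    which is to be at most half of the total \<open>C * g * n ^ r\<close>.\<close>
  obtain C :: nat where C': "real C \<ge> 2 * real s / g" using real_arch_simple by blast
  have "2 * real s / g > 0" using g s by simp
  then have C: "C > 0" "real s \<le> g / 2 * real C" using C' g by (auto simp: field_simps intro: gr0I)
  define \<epsilon> where "\<epsilon> = g / 2 / 2 ^ C"
  have \<epsilon>: "\<epsilon> > 0" using g by (simp add: \<epsilon>_def)
  obtain n0 where n0: "\<forall>(V :: 'a set) U E. finite V \<longrightarrow> card V \<ge> n0 \<longrightarrow> U \<subseteq> V \<longrightarrow>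
    real (card (cliques U E r)) \<ge> \<epsilon> * real (card V) ^ r \<longrightarrow> has_multipartite U E r s"
    using many_cliques_multipartite[OF \<epsilon> s, of r, where 'a = 'a] by (elim exE)
  show ?thesis
  proof (rule exI[of _ C], rule exI[of _ n0], intro allI impI)
    fix V Z :: "'a set" and E :: "'a set set"
    assume V: "finite V" "n0 \<le> card V" "Z \<subseteq> V" and free: "\<not> has_multipartite V E (Suc r) s"
      and rich: "\<forall>z\<in>Z. real (card (cliques (nbh V E {z}) E r)) \<ge> g * real (card V) ^ r"
    define n where "n = real (card V)"
    show "card Z \<le> C"
    proof (rule ccontr)
      assume "\<not> ?thesis"
      then obtain Z0 where Z0: "Z0 \<subseteq> Z" "card Z0 = C" "finite Z0"
        by (metis nat_le_linear obtain_subset_with_card_n)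
      define \<K> where "\<K> = cliques V E r"
      define d where "d Q = card {z\<in>Z0. Q \<subseteq> nbh V E {z}}" for Q
      define \<X> where "\<X> = {Q\<in>\<K>. d Q \<ge> s}"
      define \<S> where "\<S> = {S. S \<subseteq> Z0 \<and> card S = s}"
      have finK: "finite \<K>" "\<X> \<subseteq> \<K>" "finite \<X>" using V by (auto simp: \<K>_def \<X>_def)
      have dC: "d Q \<le> C" for Q unfolding d_def using Z0 by (auto intro!: card_mono)
      have eq: "{Q\<in>\<K>. Q \<subseteq> nbh V E {z}} = cliques (nbh V E {z}) E r" for z
        by (auto simp: \<K>_def cliques_def nbh_def)
      have "real C * (g * n ^ r) = (\<Sum>z\<in>Z0. g * n ^ r)" using Z0 by simp
      also have "\<dots> \<le> (\<Sum>z\<in>Z0. real (card (cliques (nbh V E {z}) E r)))"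
        using rich Z0 unfolding n_def by (intro sum_mono) auto
      also have "\<dots> = (\<Sum>z\<in>Z0. \<Sum>Q\<in>\<K>. of_bool (Q \<subseteq> nbh V E {z}))"
        unfolding eq[symmetric] using finK by (intro sum.cong refl) (simp add: of_bool_def sum.If_cases Int_def)
      also have "\<dots> = (\<Sum>Q\<in>\<K>. \<Sum>z\<in>Z0. of_bool (Q \<subseteq> nbh V E {z}))" by (rule sum.swap)
      also have "\<dots> = (\<Sum>Q\<in>\<K>. real (d Q))"
        unfolding d_def using Z0 by (intro sum.cong refl) (simp add: of_bool_def sum.If_cases Int_def)
      also have "\<dots> = (\<Sum>Q\<in>\<X>. real (d Q)) + (\<Sum>Q\<in>\<K> - \<X>. real (d Q))"
        using finK by (metis sum.subset_diff add.commute)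
      also have "\<dots> \<le> (\<Sum>Q\<in>\<X>. real C) + (\<Sum>Q\<in>\<K> - \<X>. real s)"
      proof (intro add_mono sum_mono)
        show "real (d Q) \<le> real C" for Q using dC by simp
        show "real (d Q) \<le> real s" if "Q \<in> \<K> - \<X>" for Q using that by (auto simp: \<X>_def not_le)
      qed
      also have "\<dots> \<le> real (card \<X>) * real C + real s * n ^ r"
      proof -
        have "card (\<K> - \<X>) \<le> card V ^ r"
          using card_cliques_le[OF V(1), of E r] card_mono[of \<K> "\<K> - \<X>"] finK by (simp add: \<K>_def)
        then have "real (card (\<K> - \<X>)) \<le> n ^ r" by (simp add: n_def flip: of_nat_power)
        then have "real (card (\<K> - \<X>)) * real s \<le> n ^ r * real s" by (intro mult_right_mono) auto
        then show ?thesis by (simp add: mult.commute)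
      qed
      also have "real s * n ^ r \<le> g / 2 * real C * n ^ r" using C by (intro mult_right_mono) (auto simp: n_def)
      finally have "real C * (g * n ^ r) \<le> real (card \<X>) * real C + g / 2 * real C * n ^ r" by simp
      then have "real C * (g / 2 * n ^ r) \<le> real C * real (card \<X>)" by (simp add: algebra_simps)
      then have X: "g / 2 * n ^ r \<le> real (card \<X>)" using C by simp
      have finS: "finite \<S>" "card \<S> \<le> 2 ^ C"
      proof -
        have "\<S> \<subseteq> Pow Z0" by (auto simp: \<S>_def)
        then show "finite \<S>" "card \<S> \<le> 2 ^ C"
          using Z0 card_mono[of "Pow Z0" \<S>] by (auto simp: card_Pow intro: finite_subset)
      qed
      have "\<X> \<subseteq> (\<Union>S\<in>\<S>. cliques (nbh V E S) E r)"
      proof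
        fix Q assume Q: "Q \<in> \<X>"
        then have "s \<le> card {z\<in>Z0. Q \<subseteq> nbh V E {z}}" by (simp add: \<X>_def d_def)
        from obtain_subset_with_card_n[OF this] obtain S where
          S: "S \<subseteq> {z\<in>Z0. Q \<subseteq> nbh V E {z}}" "card S = s" by blast
        then have "S \<in> \<S>" by (auto simp: \<S>_def)
        moreover have "Q \<in> cliques (nbh V E S) E r"
          using Q S by (fastforce simp: \<X>_def \<K>_def cliques_def nbh_def)
        ultimately show "Q \<in> (\<Union>S\<in>\<S>. cliques (nbh V E S) E r)" by blast
      qed
      then have "card \<X> \<le> card (\<Union>S\<in>\<S>. cliques (nbh V E S) E r)"
        using finS V by (intro card_mono) auto
      also have "\<dots> \<le> (\<Sum>S\<in>\<S>. card (cliques (nbh V E S) E r))" by (rule card_UN_le[OF finS(1)])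
      finally have X2: "real (card \<X>) \<le> (\<Sum>S\<in>\<S>. real (card (cliques (nbh V E S) E r)))"
        by (simp flip: of_nat_sum)
      have no: "real (card (cliques (nbh V E S) E r)) < \<epsilon> * n ^ r" if "S \<in> \<S>" for S
      proof (rule ccontr)
        assume "\<not> ?thesis"
        moreover have "nbh V E S \<subseteq> V" by (auto simp: nbh_def)
        ultimately have "has_multipartite (nbh V E S) E r s"
          using n0 V unfolding n_def by (meson not_less)
        then obtain X :: "nat \<Rightarrow> 'a set" where X': "\<forall>i<r. X i \<subseteq> nbh V E S \<and> s \<le> card (X i)"
          "\<forall>i<r. \<forall>j<r. i \<noteq> j \<longrightarrow> (\<forall>x\<in>X i. \<forall>y\<in>X j. {x, y} \<in> E)"
          unfolding has_multipartite_def by (elim exE conjE)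
        have S: "S \<subseteq> V" "card S = s" using that Z0 V by (auto simp: \<S>_def)
        have XS: "{x, y} \<in> E" if "x \<in> S" "y \<in> X i" "i < r" for x y i
          using X'(1) that by (auto simp: nbh_def)
        have "has_multipartite V E (Suc r) s"
          unfolding has_multipartite_def
        proof (intro exI[of _ "X(r := S)"] conjI allI impI ballI)
          fix i assume "i < Suc r"
          then show "(X(r := S)) i \<subseteq> V" "s \<le> card ((X(r := S)) i)"
            using X'(1) S \<open>nbh V E S \<subseteq> V\<close> by (auto simp: less_Suc_eq)
        next
          fix i j x y assume "i < Suc r" "j < Suc r" "i \<noteq> j" "x \<in> (X(r := S)) i" "y \<in> (X(r := S)) j"
          then show "{x, y} \<in> E" using X'(2) XS[of x y j] XS[of y x i]
            by (auto simp: less_Suc_eq insert_commute split: if_splits)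
        qed
        then show False using free by blast
      qed
      have Nr: "n > 0"
      proof -
        have "Z0 \<noteq> {}" using Z0 C by auto
        then have "V \<noteq> {}" using Z0 V by auto
        then show ?thesis using V by (simp add: n_def card_gt_0_iff)
      qed
      then have "g / 2 * n ^ r > 0" using g by simp
      then have "\<S> \<noteq> {}" using X X2 by auto
      then have "(\<Sum>S\<in>\<S>. real (card (cliques (nbh V E S) E r))) < (\<Sum>S\<in>\<S>. \<epsilon> * n ^ r)"
        using no finS by (intro sum_strict_mono) auto
      also have "\<dots> = real (card \<S>) * (\<epsilon> * n ^ r)" by simp
      also have "\<dots> \<le> 2 ^ C * (\<epsilon> * n ^ r)"
      proof (intro mult_right_mono)
        have "real (card \<S>) \<le> real (2 ^ C)" using finS(2) by (rule of_nat_mono)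
        then show "real (card \<S>) \<le> 2 ^ C" by simp
      qed (use \<epsilon> Nr in auto)
      also have "\<dots> = g / 2 * n ^ r" by (simp add: \<epsilon>_def)
      finally show False using X X2 by linarith
    qed
  qed
qed

text \<open>\<open>clone_max\<close> is all that is retained of maximality: turning \<open>v\<close>
  into a clone of vertices of \<open>T i\<close> would put it in every \<open>(k - 1)\<close>-clique
  across the other classes. The error terms pay for the blue edges at \<open>v\<close> and for
  cliques already containing \<open>v\<close>; \<open>large\<close> absorbs them into
  \<open>\<eta>\<close>.\<close>

locale near_turan_graph =
  fixes V :: "'a set" and E r m \<eta> W T k
  assumes V: "finite V" "loopless E" and nt: "near_turan V E r m \<eta> W T"
    and k: "3 \<le> k" "k \<le> r" and \<eta>: "\<eta> > 0" and large: "2 \<le> \<eta> * real (card V)"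
    and clone_max: "\<And>v i. v \<in> V \<Longrightarrow> i < r \<Longrightarrow> card (cliques (\<Union>j\<in>{..<r} - {i}. W j) E (k - 1))
      \<le> card (cliques (nbh V E {v}) E (k - 1)) + card V + card V ^ (k - 2)"
begin

abbreviation "n \<equiv> real (card V)"

abbreviation "N v \<equiv> nbh V E {v}"

lemma n_pos: "n > 0"
  using large \<eta> by (metis mult_zero_right not_numeral_le_zero of_nat_0_le_iff order_le_less)

lemma r_pos: "r > 0" using k by simp

lemma W: "i < r \<Longrightarrow> W i \<subseteq> V" "i < r \<Longrightarrow> j < r \<Longrightarrow> i \<noteq> j \<Longrightarrow> W i \<inter> W j = {}"
  "i < r \<Longrightarrow> real (card (W i)) \<ge> n / (2 * real r)"
  "real (card (V - (\<Union>i<r. W i))) \<le> \<eta> * n" "real (card (missing E r W)) \<le> \<eta> * n\<^sup>2"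
  using nt unfolding near_turan_def by blast+

lemma finite_W: "i < r \<Longrightarrow> finite (W i)"
  using W(1) V finite_subset by blast

lemma transversals_ge:
  assumes "J \<subseteq> {..<r}" "\<And>j. j \<in> J \<Longrightarrow> A j \<subseteq> W j"
  shows "real (card (transversals E J A)) \<ge> (\<Prod>j\<in>J. real (card (A j))) - (real (card J))\<^sup>2 * \<eta> * n ^ card J"
  using assms W V by (intro card_transversals_ge) auto

lemma transversals_in_cliques:
  assumes "J \<subseteq> {..<r}" "\<And>j. j \<in> J \<Longrightarrow> A j \<subseteq> W j" "Q \<in> transversals E J A"
  shows "Q \<in> cliques (\<Union>j\<in>J. A j) E (card J)" "j \<in> J \<Longrightarrow> Q \<inter> A j \<noteq> {}"
proof -
  have "finite J" using assms(1) finite_subset by blast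
  moreover have "A i \<inter> A j = {}" if "i \<in> J" "j \<in> J" "i \<noteq> j" for i j
    using W(2)[of i j] assms that by blast
  ultimately show "Q \<in> cliques (\<Union>j\<in>J. A j) E (card J)" "j \<in> J \<Longrightarrow> Q \<inter> A j \<noteq> {}"
    using assms(3) transversals_cliques[of J A Q E] by blast+
qed

text \<open>Compare the \<open>(k - 1)\<close>-cliques \<open>C\<close> in the neighbourhood of
  \<open>v\<close> with the \<open>(k - 1)\<close>-cliques \<open>K\<close> across the classes other
  than \<open>i\<close>. Few of \<open>C\<close> lie outside \<open>K\<close>, so by
  \<open>clone_max\<close> few of \<open>K\<close> lie outside \<open>C\<close>. But up to the
  missing pairs each non-neighbour of \<open>v\<close> in \<open>W j\<close> yields order
  \<open>n ^ (k - 2)\<close> of the latter.\<close>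

lemma few_nonneighbours:
  assumes v: "v \<in> V" and ij: "i < r" "j < r" "j \<noteq> i" and \<gamma>: "real (card (N v \<inter> W i)) \<le> \<gamma> * n"
  shows "real (card (W j - N v)) \<le> (2 * real r) ^ (k - 2) * (\<gamma> + (2 + (real k)\<^sup>2) * \<eta>) * n"
proof -
  define U where "U = (\<Union>j\<in>{..<r} - {i}. W j)"
  define C where "C = cliques (N v) E (k - 1)"
  define K where "K = cliques U E (k - 1)"
  define B where "B = (V - (\<Union>i<r. W i)) \<union> (N v \<inter> W i)"
  obtain l where l: "k - 1 = Suc l" "k - 2 = l" "l > 0" using k by (cases "k - 1") auto
  have NV: "N v \<subseteq> V" by (auto simp: nbh_def)
  have UV: "U \<subseteq> V" using W(1) by (auto simp: U_def)
  have fin: "finite C" "finite K" using V finite_subset[OF UV V(1)] by (auto simp: C_def K_def)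
  have BV: "B \<subseteq> V" using NV by (auto simp: B_def)
  have "card B \<le> card (V - (\<Union>i<r. W i)) + card (N v \<inter> W i)" unfolding B_def by (rule card_Un_le)
  then have cB: "real (card B) \<le> (\<eta> + \<gamma>) * n"
    using W(4) \<gamma> by (simp add: algebra_simps)
  have "C - K \<subseteq> {Q. Q \<subseteq> V \<and> card Q = Suc l \<and> Q \<inter> B \<noteq> {}}"
  proof
    fix Q assume Q: "Q \<in> C - K"
    then have "Q \<subseteq> N v" "card Q = Suc l" "\<not> Q \<subseteq> U" using l by (auto simp: C_def K_def cliques_def)
    then show "Q \<in> {Q. Q \<subseteq> V \<and> card Q = Suc l \<and> Q \<inter> B \<noteq> {}}"
    proof -
      obtain x where "x \<in> Q" "x \<notin> U" using \<open>\<not> Q \<subseteq> U\<close> by blast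
      then have "x \<in> B" using \<open>Q \<subseteq> N v\<close> NV by (auto simp: U_def B_def)
      then show ?thesis using \<open>x \<in> Q\<close> \<open>Q \<subseteq> N v\<close> NV \<open>card Q = Suc l\<close> by auto
    qed
  qed
  then have "card (C - K) \<le> card B * card V ^ l" by (rule card_subsets_meeting_le[OF V(1) BV])
  then have "real (card (C - K)) \<le> real (card B) * n ^ l" by (simp flip: of_nat_power of_nat_mult)
  also have "\<dots> \<le> (\<eta> + \<gamma>) * n * n ^ l" using cB by (intro mult_right_mono) auto
  finally have CK: "real (card (C - K)) \<le> (\<eta> + \<gamma>) * n * n ^ l" .
  have "card K \<le> card C + card V + card V ^ l"
    using clone_max[OF v ij(1)] l by (simp add: K_def C_def U_def)
  moreover have "card K = card (K - C) + card (K \<inter> C)" "card C = card (C - K) + card (K \<inter> C)"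
    using card_Diff_subset_Int[of K C] card_Diff_subset_Int[of C K] fin
      card_mono[of K "K \<inter> C"] card_mono[of C "K \<inter> C"] by (auto simp: Int_commute)
  ultimately have "card (K - C) \<le> card (C - K) + card V + card V ^ l" by linarith
  then have "real (card (K - C)) \<le> real (card (C - K)) + n + n ^ l"
    by (simp flip: of_nat_power of_nat_add)
  moreover have "n \<le> n ^ l"
  proof -
    have "card V ^ 1 \<le> card V ^ l" using n_pos l by (intro power_increasing) auto
    then show ?thesis by (simp flip: of_nat_power)
  qed
  moreover have "2 * n ^ l \<le> \<eta> * n * n ^ l" using large by (intro mult_right_mono) auto
  ultimately have "real (card (K - C)) \<le> (\<eta> + \<gamma>) * n * n ^ l + \<eta> * n * n ^ l"
    using CK by linarith
  also have "\<dots> = (2 * \<eta> + \<gamma>) * n * n ^ l" by (simp add: distrib_right)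
  finally have KC: "real (card (K - C)) \<le> (2 * \<eta> + \<gamma>) * n * n ^ l" .
  \<comment> \<open>Besides \<open>j\<close>, another \<open>k - 2\<close> classes different from
    \<open>i\<close> are needed; they exist because \<open>k \<le> r\<close>.\<close>
  have "card ({..<r} - {i, j}) = r - 2" using ij by (simp add: card_Diff_subset)
  then have "l \<le> card ({..<r} - {i, j})" using l k by simp
  then obtain J' where J': "J' \<subseteq> {..<r} - {i, j}" "card J' = l" "finite J'"
    by (metis obtain_subset_with_card_n)
  define J where "J = insert j J'"
  define A where "A h = (if h = j then W j - N v else W h)" for h
  have J: "J \<subseteq> {..<r}" "card J = Suc l" "j \<in> J" "i \<notin> J" using J' ij by (auto simp: J_def card_insert_if)
  have AW: "A h \<subseteq> W h" for h by (auto simp: A_def)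
  have "transversals E J A \<subseteq> K - C"
  proof
    fix Q assume Q: "Q \<in> transversals E J A"
    have Q': "Q \<in> cliques (\<Union>j\<in>J. A j) E (Suc l)" "Q \<inter> A j \<noteq> {}"
      using transversals_in_cliques[OF J(1) AW Q] J by auto
    have "(\<Union>j\<in>J. A j) \<subseteq> U" using J AW unfolding U_def by blast
    then have "Q \<in> K" using Q'(1) cliques_mono[of _ U E E "Suc l"] l by (auto simp: K_def)
    moreover have "\<not> Q \<subseteq> N v" using Q'(2) by (auto simp: A_def)
    then have "Q \<notin> C" by (auto simp: C_def cliques_def)
    ultimately show "Q \<in> K - C" by blast
  qed
  then have "real (card (transversals E J A)) \<le> real (card (K - C))" using fin by (auto intro: card_mono)
  moreover have "(\<Prod>h\<in>J. real (card (A h))) = real (card (W j - N v)) * (\<Prod>h\<in>J'. real (card (W h)))"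
  proof -
    have "j \<notin> J'" using J' by blast
    moreover have "(\<Prod>h\<in>J'. real (card (A h))) = (\<Prod>h\<in>J'. real (card (W h)))"
      using J' by (intro prod.cong) (auto simp: A_def)
    ultimately show ?thesis using J' by (simp add: J_def) (simp add: A_def)
  qed
  moreover have "real (card (W j - N v)) * (n / (2 * real r)) ^ l \<le> real (card (W j - N v)) * (\<Prod>h\<in>J'. real (card (W h)))"
  proof (rule mult_left_mono)
    have "(\<Prod>h\<in>J'. n / (2 * real r)) \<le> (\<Prod>h\<in>J'. real (card (W h)))"
      using J' W(3) by (intro prod_mono) auto
    then show "(n / (2 * real r)) ^ l \<le> (\<Prod>h\<in>J'. real (card (W h)))" using J' by simp
  qed simp
  ultimately have "real (card (W j - N v)) * (n / (2 * real r)) ^ l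
      \<le> (2 * \<eta> + \<gamma>) * n * n ^ l + (real (Suc l))\<^sup>2 * \<eta> * n ^ Suc l"
    using transversals_ge[OF J(1), of A] AW KC J(2) by fastforce
  also have "\<dots> = (2 * \<eta> + \<gamma> + (real (Suc l))\<^sup>2 * \<eta>) * n * n ^ l" by (simp add: algebra_simps)
  also have "\<dots> \<le> (\<gamma> + (2 + (real k)\<^sup>2) * \<eta>) * n * n ^ l"
  proof (intro mult_right_mono)
    have "(real (Suc l))\<^sup>2 \<le> (real k)\<^sup>2" using l k by (intro power_mono) auto
    then have "(real (Suc l))\<^sup>2 * \<eta> \<le> (real k)\<^sup>2 * \<eta>" using \<eta> by (intro mult_right_mono) auto
    then show "2 * \<eta> + \<gamma> + (real (Suc l))\<^sup>2 * \<eta> \<le> \<gamma> + (2 + (real k)\<^sup>2) * \<eta>" by (simp add: algebra_simps)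
  qed auto
  finally have "real (card (W j - N v)) / (2 * real r) ^ l * n ^ l \<le> (\<gamma> + (2 + (real k)\<^sup>2) * \<eta>) * n * n ^ l"
    by (simp add: power_divide)
  then have "real (card (W j - N v)) / (2 * real r) ^ l \<le> (\<gamma> + (2 + (real k)\<^sup>2) * \<eta>) * n"
    using n_pos by (simp only: mult_le_cancel_right_pos zero_less_power)
  then show ?thesis using l k by (simp add: pos_divide_le_eq mult_ac)
qed

text \<open>By \<open>few_nonneighbours\<close>, \<open>u\<close> sees almost all of every class
  except \<open>i\<close>, and an arbitrary \<open>v\<close> sees a proportion of every class except
  at most one, \<open>i'\<close>. As \<open>r - 2 \<ge> k - 2\<close>, there are enough classes
  avoiding both for a transversal \<open>(k - 2)\<close>-clique of common neighbours. A bound linear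
  in \<open>n\<close> suffices later; it needs \<open>k - 2 > 0\<close>.\<close>

lemma many_common_neighbour_cliques:
  fixes \<beta> \<gamma> :: real
  defines "\<kappa> \<equiv> (2 * real r) ^ (k - 2)"
  assumes \<beta>: "0 < \<beta>" "\<kappa> * \<beta> \<le> 1 / (8 * real r)" and \<gamma>: "\<kappa> * \<gamma> \<le> \<beta> / 4"
    and small: "\<kappa> * ((2 + (real k)\<^sup>2) * \<eta>) \<le> \<beta> / 4" "(real k)\<^sup>2 * \<eta> \<le> (\<beta> / 2) ^ (k - 2) / 2"
    and u: "u \<in> V" "i < r" "real (card (N u \<inter> W i)) \<le> \<gamma> * n" and v: "v \<in> V"
  shows "real (card (cliques (nbh V E {u, v}) E (k - 2))) \<ge> (\<beta> / 2) ^ (k - 2) / 2 * n"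
proof -
  define l where "l = k - 2"
  have l: "l > 0" "l = k - 2" using k by (auto simp: l_def)
  have \<kappa>: "\<kappa> \<ge> 1" using r_pos unfolding \<kappa>_def by (intro one_le_power) auto
  have \<beta>r: "\<beta> \<le> 1 / (8 * real r)"
  proof -
    have "1 * \<beta> \<le> \<kappa> * \<beta>" using \<kappa> \<beta> by (intro mult_right_mono) auto
    then show ?thesis using \<beta>(2) by linarith
  qed
  have fu: "real (card (W j - N u)) \<le> \<beta> / 2 * n" if "j < r" "j \<noteq> i" for j
  proof -
    have "real (card (W j - N u)) \<le> \<kappa> * (\<gamma> + (2 + (real k)\<^sup>2) * \<eta>) * n"
      unfolding \<kappa>_def by (rule few_nonneighbours[OF u(1,2) that u(3)])
    also have "\<dots> \<le> \<beta> / 2 * n" using \<gamma> small by (intro mult_right_mono) (auto simp: distrib_left)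
    finally show ?thesis .
  qed
  \<comment> \<open>If no class is poor for \<open>v\<close>, any index serves. Otherwise
    \<open>i'\<close> is a poor class, and elsewhere \<open>v\<close> misses at most
    \<open>n / (4 * r)\<close> of at least \<open>n / (2 * r)\<close> vertices.\<close>
  have "\<exists>i'<r. \<forall>j<r. j \<noteq> i' \<longrightarrow> real (card (N v \<inter> W j)) \<ge> \<beta> * n"
  proof (cases "\<exists>i'<r. real (card (N v \<inter> W i')) \<le> \<beta> * n")
    case False
    then show ?thesis using r_pos by (intro exI[of _ 0]) force
  next
    case True
    then obtain i' where i': "i' < r" "real (card (N v \<inter> W i')) \<le> \<beta> * n" by blast
    have "real (card (N v \<inter> W j)) \<ge> \<beta> * n" if j: "j < r" "j \<noteq> i'" for j
    proof -
      have "real (card (W j - N v)) \<le> \<kappa> * (\<beta> + (2 + (real k)\<^sup>2) * \<eta>) * n"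
        unfolding \<kappa>_def by (rule few_nonneighbours[OF v i'(1) j i'(2)])
      also have "\<dots> \<le> (1 / (8 * real r) + 1 / (8 * real r)) * n"
        using \<beta> \<beta>r small by (intro mult_right_mono) (auto simp: distrib_left)
      finally have "real (card (W j - N v)) \<le> (1 / (8 * real r) + 1 / (8 * real r)) * n" .
      moreover have "card (W j) = card (W j - N v) + card (N v \<inter> W j)"
        using card_Diff_subset_Int[of "W j" "N v"] card_mono[of "W j" "N v \<inter> W j"] finite_W[OF j(1)]
        by (auto simp: Int_commute)
      moreover have "1 / (2 * real r) * n \<le> real (card (W j))" using W(3)[OF j(1)] by simp
      moreover have "\<beta> * n \<le> 1 / (8 * real r) * n" using \<beta>r by (intro mult_right_mono) auto
      moreover have "1 / (2 * real r) * n = 4 * (1 / (8 * real r) * n)" by simp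
      moreover have "(1 / (8 * real r) + 1 / (8 * real r)) * n = 2 * (1 / (8 * real r) * n)" by simp
      moreover have "1 / (8 * real r) * n \<ge> 0" by simp
      ultimately show ?thesis by linarith
    qed
    then show ?thesis using i' by blast
  qed
  then obtain i' where i': "i' < r" "\<And>j. j < r \<Longrightarrow> j \<noteq> i' \<Longrightarrow> real (card (N v \<inter> W j)) \<ge> \<beta> * n" by blast
  \<comment> \<open>Only an inequality, since \<open>i\<close> and \<open>i'\<close> may
    coincide.\<close>
  have "r - 2 \<le> card ({..<r} - {i, i'})"
    using diff_card_le_card_Diff[of "{i, i'}" "{..<r}"] card_insert_le_m1[of 2 "{i'}" i] by (simp add: card_insert_if split: if_splits)
  then have "l \<le> card ({..<r} - {i, i'})" using k by (simp add: l_def)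
  then obtain J where J: "J \<subseteq> {..<r} - {i, i'}" "card J = l" "finite J"
    by (metis obtain_subset_with_card_n)
  define A where "A j = nbh V E {u, v} \<inter> W j" for j
  have Jr: "J \<subseteq> {..<r}" using J by blast
  have AW: "A j \<subseteq> W j" for j by (simp add: A_def)
  have A_ge: "real (card (A j)) \<ge> \<beta> / 2 * n" if "j \<in> J" for j
  proof -
    have j: "j < r" "j \<noteq> i" "j \<noteq> i'" using that J by auto
    have "N v \<inter> W j \<subseteq> A j \<union> (W j - N u)" by (auto simp: A_def nbh_def)
    then have "card (N v \<inter> W j) \<le> card (A j) + card (W j - N u)"
      using finite_W[OF j(1)] by (intro order_trans[OF card_mono card_Un_le]) (auto simp: A_def)
    then show ?thesis using fu[OF j(1,2)] i'(2)[OF j(1,3)] by simp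
  qed
  have "transversals E J A \<subseteq> cliques (nbh V E {u, v}) E l"
  proof
    fix Q assume "Q \<in> transversals E J A"
    from transversals_in_cliques(1)[OF Jr AW this] show "Q \<in> cliques (nbh V E {u, v}) E l"
      using J by (auto simp: cliques_def A_def)
  qed
  then have "real (card (transversals E J A)) \<le> real (card (cliques (nbh V E {u, v}) E l))"
    using V by (auto intro!: card_mono)
  moreover have "(\<Prod>j\<in>J. \<beta> / 2 * n) \<le> (\<Prod>j\<in>J. real (card (A j)))"
    using A_ge \<beta> by (intro prod_mono) auto
  then have "(\<beta> / 2) ^ l * n ^ l \<le> (\<Prod>j\<in>J. real (card (A j)))"
    unfolding prod_constant J(2) power_mult_distrib .
  moreover have "(real l)\<^sup>2 * \<eta> * n ^ l \<le> (\<beta> / 2) ^ l / 2 * n ^ l"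
  proof (intro mult_right_mono)
    have "(real l)\<^sup>2 * \<eta> \<le> (real k)\<^sup>2 * \<eta>" using \<eta> by (intro mult_right_mono power_mono) (auto simp: l_def)
    then show "(real l)\<^sup>2 * \<eta> \<le> (\<beta> / 2) ^ l / 2" using small(2) l by simp
  qed auto
  ultimately have "real (card (cliques (nbh V E {u, v}) E l)) \<ge> (\<beta> / 2) ^ l / 2 * n ^ l"
    using transversals_ge[OF Jr, of A] AW J(2) by fastforce
  moreover have "(\<beta> / 2) ^ l / 2 * n \<le> (\<beta> / 2) ^ l / 2 * n ^ l"
  proof (rule mult_left_mono)
    have "card V ^ 1 \<le> card V ^ l" using n_pos l by (intro power_increasing) auto
    then show "n \<le> n ^ l" by (simp flip: of_nat_power)
  qed (use \<beta> in auto)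
  ultimately show ?thesis using l by simp
qed

lemma rich_vertex_cliques:
  assumes "v \<in> V" "\<And>i. i < r \<Longrightarrow> real (card (N v \<inter> W i)) \<ge> \<gamma> * n" "\<gamma> \<ge> 0" "(real r)\<^sup>2 * \<eta> \<le> \<gamma> ^ r / 2"
  shows "real (card (cliques (N v) E r)) \<ge> \<gamma> ^ r / 2 * n ^ r"
proof -
  define A where "A j = N v \<inter> W j" for j
  have AW: "A j \<subseteq> W j" for j by (simp add: A_def)
  have "transversals E {..<r} A \<subseteq> cliques (N v) E r"
  proof
    fix Q assume "Q \<in> transversals E {..<r} A"
    from transversals_in_cliques(1)[OF order_refl AW this] show "Q \<in> cliques (N v) E r"
      by (auto simp: cliques_def A_def)
  qed
  then have "real (card (transversals E {..<r} A)) \<le> real (card (cliques (N v) E r))"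
    using V by (auto intro!: card_mono)
  moreover have "(\<Prod>j<r. \<gamma> * n) \<le> (\<Prod>j<r. real (card (A j)))"
    using assms by (intro prod_mono) (auto simp: A_def)
  then have "\<gamma> ^ r * n ^ r \<le> (\<Prod>j<r. real (card (A j)))" by (simp add: power_mult_distrib)
  moreover have "(real r)\<^sup>2 * \<eta> * n ^ r \<le> \<gamma> ^ r / 2 * n ^ r"
    using assms by (intro mult_right_mono) auto
  ultimately show ?thesis using transversals_ge[OF order_refl, of A] AW by fastforce
qed

end

text \<open>\<open>Z\<close> consists of the vertices with at least \<open>\<gamma> * n\<close>
  neighbours in every class; \<open>rich_vertex_cliques\<close> and \<open>few_rich_vertices\<close>
  bound it independently of \<open>n\<close>. A vertex outside \<open>Z\<close> is poor in some
  class, as required of \<open>u\<close> in \<open>many_common_neighbour_cliques\<close>, and the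
  linear bound there exceeds any fixed \<open>M\<close>.\<close>

theorem pairs_in_many_cliques:
  assumes k: "3 \<le> k" "k \<le> r" and s: "s > 0"
  shows "\<exists>\<eta>>0. \<exists>C n0. \<forall>(V :: 'a set) E m W T. near_turan_graph V E r m \<eta> W T k \<longrightarrow> card V \<ge> n0 \<longrightarrow>
    \<not> has_multipartite V E (Suc r) s \<longrightarrow>
    (\<exists>Z\<subseteq>V. card Z \<le> C \<and> (\<forall>u\<in>V - Z. \<forall>v\<in>V. M \<le> card (cliques (nbh V E {u, v}) E (k - 2))))"
proof -
  \<comment> \<open>\<open>\<kappa>\<close> is the factor lost in \<open>few_nonneighbours\<close>.
    Applying that lemma once to \<open>v\<close> and once to \<open>u\<close> forces
    \<open>\<beta>\<close> to be small against \<open>1 / \<kappa>\<close> and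
    \<open>\<gamma>\<close> against \<open>\<beta> / \<kappa>\<close>; \<open>\<eta>\<close> comes
    last.\<close>
  define \<kappa> where "\<kappa> = (2 * real r) ^ (k - 2)"
  define \<beta> where "\<beta> = 1 / (8 * real r * \<kappa>)"
  define \<gamma> where "\<gamma> = \<beta> / (4 * \<kappa>)"
  define \<eta> where "\<eta> = Min {\<beta> / (4 * \<kappa> * (2 + (real k)\<^sup>2)), (\<beta> / 2) ^ (k - 2) / (2 * (real k)\<^sup>2), \<gamma> ^ r / (2 * (real r)\<^sup>2)}"
  have r: "real r > 0" and \<kappa>: "\<kappa> > 0" using k by (auto simp: \<kappa>_def)
  have \<beta>: "\<beta> > 0" using r \<kappa> by (simp add: \<beta>_def)
  have \<gamma>: "\<gamma> > 0" using \<beta> \<kappa> by (simp add: \<gamma>_def)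
  have k2: "2 + (real k)\<^sup>2 > 0" by (simp add: add_pos_nonneg)
  have \<eta>: "\<eta> > 0" using \<beta> \<gamma> \<kappa> r k k2 by (auto simp: \<eta>_def)
  have e1: "\<eta> \<le> \<beta> / (4 * \<kappa> * (2 + (real k)\<^sup>2))" "\<eta> \<le> (\<beta> / 2) ^ (k - 2) / (2 * (real k)\<^sup>2)" "\<eta> \<le> \<gamma> ^ r / (2 * (real r)\<^sup>2)"
    by (auto simp: \<eta>_def)
  have small: "\<kappa> * ((2 + (real k)\<^sup>2) * \<eta>) \<le> \<beta> / 4"
    using e1(1) \<kappa> k2 by (simp add: pos_le_divide_eq mult_ac)
  have small2: "(real k)\<^sup>2 * \<eta> \<le> (\<beta> / 2) ^ (k - 2) / 2"
    using e1(2) k by (simp add: pos_le_divide_eq mult_ac)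
  have small3: "(real r)\<^sup>2 * \<eta> \<le> \<gamma> ^ r / 2"
    using e1(3) r by (simp add: pos_le_divide_eq mult_ac)
  have "\<gamma> ^ r / 2 > 0" using \<gamma> by simp
  from few_rich_vertices[OF this s, of r, where 'a = 'a] obtain C n1 where C: "\<forall>(V :: 'a set) E Z. finite V \<longrightarrow> card V \<ge> n1 \<longrightarrow> Z \<subseteq> V \<longrightarrow>
    \<not> has_multipartite V E (Suc r) s \<longrightarrow>
    (\<forall>z\<in>Z. real (card (cliques (nbh V E {z}) E r)) \<ge> \<gamma> ^ r / 2 * real (card V) ^ r) \<longrightarrow> card Z \<le> C"
    by (elim exE)
  define c where "c = (\<beta> / 2) ^ (k - 2) / 2"
  have c: "c > 0" using \<beta> by (simp add: c_def)
  obtain n2 :: nat where n2: "real n2 \<ge> real M / c" using real_arch_simple by blast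
  show ?thesis
  proof (rule exI[of _ \<eta>], rule conjI[OF \<eta>], rule exI[of _ C], rule exI[of _ "max n1 n2"], intro allI impI)
    fix V :: "'a set" and E m W T
    assume "near_turan_graph V E r m \<eta> W T k" and big: "max n1 n2 \<le> card V"
      and free: "\<not> has_multipartite V E (Suc r) s"
    then interpret near_turan_graph V E r m \<eta> W T k by simp
    define Z where "Z = {v\<in>V. \<forall>i<r. real (card (N v \<inter> W i)) \<ge> \<gamma> * n}"
    have "card Z \<le> C"
    proof (rule C[rule_format, OF V(1) _ _ free])
      show "\<gamma> ^ r / 2 * n ^ r \<le> real (card (cliques (N z) E r))" if "z \<in> Z" for z
        using that \<gamma> small3 by (intro rich_vertex_cliques) (auto simp: Z_def)
    qed (use big in \<open>auto simp: Z_def\<close>)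
    moreover have "M \<le> card (cliques (nbh V E {u, v}) E (k - 2))" if u: "u \<in> V - Z" and v: "v \<in> V" for u v
    proof -
      obtain i where i: "i < r" "real (card (N u \<inter> W i)) \<le> \<gamma> * n" using u by (force simp: Z_def)
      have "c * n \<le> real (card (cliques (nbh V E {u, v}) E (k - 2)))"
        unfolding c_def
      proof (rule many_common_neighbour_cliques[OF \<beta> _ _ _ _ _ i v])
        show "(2 * real r) ^ (k - 2) * \<beta> \<le> 1 / (8 * real r)" using \<kappa> unfolding \<kappa>_def[symmetric] by (simp add: \<beta>_def)
        show "(2 * real r) ^ (k - 2) * \<gamma> \<le> \<beta> / 4" using \<kappa> unfolding \<kappa>_def[symmetric] by (simp add: \<gamma>_def)
        show "(2 * real r) ^ (k - 2) * ((2 + (real k)\<^sup>2) * \<eta>) \<le> \<beta> / 4" using small by (simp add: \<kappa>_def)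
      qed (use small2 u in auto)
      moreover have "real M \<le> c * n"
      proof -
        have "real M / c \<le> n" using n2 big by (meson max.bounded_iff of_nat_mono order_trans)
        then show ?thesis using c by (simp add: pos_divide_le_eq mult.commute)
      qed
      ultimately show ?thesis by linarith
    qed
    ultimately show "\<exists>Z\<subseteq>V. card Z \<le> C \<and> (\<forall>u\<in>V - Z. \<forall>v\<in>V. M \<le> card (cliques (nbh V E {u, v}) E (k - 2)))"
      by (intro exI[of _ Z]) (auto simp: Z_def)
  qed
qed

section \<open>Berge copies, embeddings and the Turan graph\<close>

text \<open>Induction on \<open>card A\<close>. If every nonempty proper subset has a surplus, one
  element is matched arbitrarily and its partner deleted. Otherwise a tight subset \<open>B\<close>,
  and its complement with the neighbours of \<open>B\<close> deleted, satisfy the condition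
  separately.\<close>

theorem hall:
  assumes "finite A" "\<And>a. a \<in> A \<Longrightarrow> finite (N a)" "\<And>B. B \<subseteq> A \<Longrightarrow> card B \<le> card (\<Union>(N ` B))"
  shows "\<exists>\<phi>. inj_on \<phi> A \<and> (\<forall>a\<in>A. \<phi> a \<in> N a)"
  using assms
proof (induction "card A" arbitrary: A N rule: less_induct)
  case less
  note fin = less.prems(1) and finN = less.prems(2) and hall = less.prems(3)
  have finU: "finite (\<Union>(N ` B))" if "B \<subseteq> A" for B
    using that finN finite_subset[OF that fin] by auto
  show ?case
  proof (cases "A = {}")
    case False
    then obtain a where a: "a \<in> A" by blast
    show ?thesis
    proof (cases "\<exists>B. B \<subset> A \<and> B \<noteq> {} \<and> card (\<Union>(N ` B)) \<le> card B")
      case False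
      have "card {a} \<le> card (\<Union>(N ` {a}))" using a by (intro hall) auto
      then obtain x where x: "x \<in> N a" by (auto simp: Suc_le_eq card_gt_0_iff)
      have "\<exists>\<phi>. inj_on \<phi> (A - {a}) \<and> (\<forall>b\<in>A - {a}. \<phi> b \<in> N b - {x})"
      proof (rule less.hyps)
        show "card (A - {a}) < card A" using a fin by (meson card_Diff1_less)
        fix B assume B: "B \<subseteq> A - {a}"
        show "card B \<le> card (\<Union>b\<in>B. N b - {x})"
        proof (cases "B = {}")
          case False
          have "B \<subset> A" using B a by blast
          then have "card B < card (\<Union>(N ` B))"
            using \<open>\<not> (\<exists>B. B \<subset> A \<and> B \<noteq> {} \<and> card (\<Union>(N ` B)) \<le> card B)\<close> False by (meson not_le)
          moreover have "(\<Union>b\<in>B. N b - {x}) = \<Union>(N ` B) - {x}" by blast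
          moreover have "card (\<Union>(N ` B)) \<le> Suc (card (\<Union>(N ` B) - {x}))"
            using diff_card_le_card_Diff[of "{x}" "\<Union>(N ` B)"] by simp
          ultimately show ?thesis by simp
        qed simp
      qed (use fin finN in auto)
      then obtain \<phi> where \<phi>: "inj_on \<phi> (A - {a})" "\<And>b. b \<in> A - {a} \<Longrightarrow> \<phi> b \<in> N b - {x}" by blast
      have "inj_on (\<phi>(a := x)) (insert a (A - {a}))"
      proof -
        have "x \<notin> \<phi> ` (A - {a})" using \<phi>(2) by blast
        then show ?thesis
          unfolding inj_on_insert using inj_on_fun_updI[OF \<phi>(1), of x a] by auto
      qed
      then have "inj_on (\<phi>(a := x)) A" using a by (simp add: insert_absorb)
      then show ?thesis using \<phi>(2) x by (intro exI[of _ "\<phi>(a := x)"]) auto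
    next
      case True
      then obtain B where B: "B \<subset> A" "B \<noteq> {}" "card (\<Union>(N ` B)) \<le> card B" by blast
      have finB: "finite B" using B fin finite_subset by blast
      have "\<exists>\<phi>. inj_on \<phi> B \<and> (\<forall>b\<in>B. \<phi> b \<in> N b)"
      proof (rule less.hyps)
        show "card B < card A" using B fin by (meson psubset_card_mono)
        show "card C \<le> card (\<Union>(N ` C))" if "C \<subseteq> B" for C using hall[of C] that B by blast
      qed (use finB finN B in auto)
      then obtain \<phi> where \<phi>: "inj_on \<phi> B" "\<And>b. b \<in> B \<Longrightarrow> \<phi> b \<in> N b" by blast
      have "\<exists>\<psi>. inj_on \<psi> (A - B) \<and> (\<forall>b\<in>A - B. \<psi> b \<in> N b - \<Union>(N ` B))"
      proof (rule less.hyps)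
        show "card (A - B) < card A" using B fin by (intro psubset_card_mono) auto
        fix C assume C: "C \<subseteq> A - B"
        have finC: "finite C" using C fin finite_subset by blast
        have "card B + card C = card (B \<union> C)" using C finB finC by (subst card_Un_disjoint) auto
        also have "\<dots> \<le> card (\<Union>(N ` (B \<union> C)))" using B C by (intro hall) auto
        also have "\<Union>(N ` (B \<union> C)) = \<Union>(N ` B) \<union> (\<Union>c\<in>C. N c - \<Union>(N ` B))" by auto
        also have "card \<dots> \<le> card (\<Union>(N ` B)) + card (\<Union>c\<in>C. N c - \<Union>(N ` B))" by (rule card_Un_le)
        finally show "card C \<le> card (\<Union>c\<in>C. N c - \<Union>(N ` B))" using B by linarith
      qed (use fin finN in auto)
      then obtain \<psi> where \<psi>: "inj_on \<psi> (A - B)" "\<And>b. b \<in> A - B \<Longrightarrow> \<psi> b \<in> N b - \<Union>(N ` B)" by blast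
      define \<theta> where "\<theta> b = (if b \<in> B then \<phi> b else \<psi> b)" for b
      have "\<theta> b \<in> N b" if "b \<in> A" for b using \<phi> \<psi> that by (auto simp: \<theta>_def)
      moreover have "inj_on \<theta> A"
      proof (rule inj_onI)
        fix b c assume bc: "b \<in> A" "c \<in> A" "\<theta> b = \<theta> c"
        have "\<phi> b' \<noteq> \<psi> c'" if "b' \<in> B" "c' \<in> A - B" for b' c' using \<phi>(2)[OF that(1)] \<psi>(2)[OF that(2)] that by auto
        then show "b = c" using bc \<phi>(1) \<psi>(1) by (auto simp: \<theta>_def inj_on_def split: if_splits) metis+
      qed
      ultimately show ?thesis by blast
    qed
  qed simp
qed

lemma finite_argmax:
  fixes f :: "'b \<Rightarrow> 'c::linorder"
  assumes "finite S" "S \<noteq> {}"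
  shows "\<exists>x\<in>S. \<forall>y\<in>S. f y \<le> f x"
proof -
  have "Max (f ` S) \<in> f ` S" using assms by (intro Max_in) auto
  then obtain x where "x \<in> S" "f x = Max (f ` S)" by auto
  then show ?thesis using assms by (intro bexI[of _ x]) auto
qed

text \<open>A set of maximal deficiency splits the instance into two parts, each satisfying Hall's condition.\<close>

lemma deficiency_decomposition:
  fixes N :: "'a \<Rightarrow> 'b set"
  assumes "finite X" "\<And>x. x \<in> X \<Longrightarrow> finite (N x)"
  shows "\<exists>A\<subseteq>X. (\<exists>\<phi>. inj_on \<phi> (X - A) \<and> (\<forall>x\<in>X - A. \<phi> x \<in> N x - \<Union>(N ` A)))
    \<and> (\<exists>\<psi>. inj_on \<psi> (\<Union>(N ` A)) \<and> (\<forall>p\<in>\<Union>(N ` A). \<psi> p \<in> A \<and> p \<in> N (\<psi> p)))"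
proof -
  define f where "f A = int (card A) - int (card (\<Union>(N ` A)))" for A
  have "\<exists>A\<in>Pow X. \<forall>B\<in>Pow X. f B \<le> f A" using assms(1) by (intro finite_argmax) auto
  then obtain A where A: "A \<subseteq> X" "\<And>B. B \<subseteq> X \<Longrightarrow> f B \<le> f A" by blast
  have finX: "finite B" if "B \<subseteq> X" for B using that assms(1) finite_subset by blast
  have finU: "finite (\<Union>(N ` B))" if "B \<subseteq> X" for B using that finX[OF that] assms(2) by auto
  \<comment> \<open>Adding \<open>B\<close> to \<open>A\<close> does not increase the deficiency, so
    \<open>B\<close> has at least \<open>card B\<close> neighbours outside those of
    \<open>A\<close>.\<close>
  have "\<exists>\<phi>. inj_on \<phi> (X - A) \<and> (\<forall>x\<in>X - A. \<phi> x \<in> N x - \<Union>(N ` A))"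
  proof (rule hall)
    fix B assume B: "B \<subseteq> X - A"
    have "card (A \<union> B) = card A + card B" using B finX A by (intro card_Un_disjoint) (auto intro: finX)
    moreover have "\<Union>(N ` (A \<union> B)) = \<Union>(N ` A) \<union> (\<Union>b\<in>B. N b - \<Union>(N ` A))" by auto
    then have "card (\<Union>(N ` (A \<union> B))) \<le> card (\<Union>(N ` A)) + card (\<Union>b\<in>B. N b - \<Union>(N ` A))"
      by (simp only: card_Un_le)
    moreover have "f (A \<union> B) \<le> f A" using A B by (intro A(2)) auto
    ultimately show "card B \<le> card (\<Union>b\<in>B. N b - \<Union>(N ` A))" unfolding f_def by linarith
  qed (use assms in auto)
  \<comment> \<open>Removing from \<open>A\<close> all elements adjacent to \<open>P\<close> removes
    \<open>P\<close> from the neighbourhood; if these elements were fewer than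
    \<open>card P\<close>, the deficiency would grow.\<close>
  moreover have "\<exists>\<psi>. inj_on \<psi> (\<Union>(N ` A)) \<and> (\<forall>p\<in>\<Union>(N ` A). \<psi> p \<in> {a\<in>A. p \<in> N a})"
  proof (rule hall)
    fix P assume P: "P \<subseteq> \<Union>(N ` A)"
    define C where "C = (\<Union>p\<in>P. {a\<in>A. p \<in> N a})"
    have C: "C \<subseteq> A" by (auto simp: C_def)
    have "\<Union>(N ` (A - C)) \<subseteq> \<Union>(N ` A) - P" by (auto simp: C_def)
    then have "card (\<Union>(N ` (A - C))) \<le> card (\<Union>(N ` A) - P)"
      using finU[OF A(1)] by (intro card_mono) auto
    also have "\<dots> = card (\<Union>(N ` A)) - card P"
      using P finU[OF A(1)] finite_subset by (intro card_Diff_subset) auto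
    finally have "card (\<Union>(N ` (A - C))) \<le> card (\<Union>(N ` A)) - card P" .
    moreover have "card P \<le> card (\<Union>(N ` A))" using P finU[OF A(1)] by (intro card_mono) auto
    moreover have "card (A - C) = card A - card C" "card C \<le> card A"
      using C finX[OF A(1)] by (auto simp: card_Diff_subset finite_subset card_mono)
    moreover have "f (A - C) \<le> f A" using A by (intro A(2)) auto
    ultimately show "card P \<le> card (\<Union>p\<in>P. {a\<in>A. p \<in> N a})"
      unfolding f_def C_def[symmetric] by linarith
  qed (use finU[OF A(1)] finX[OF A(1)] in auto)
  ultimately show ?thesis using A(1) by (intro exI[of _ A]) blast
qed

section \<open>Graphs as sets of pairs, copies as embeddings, and red-blue graphs from
  hypergraphs\<close>

definition pairs :: "'a set \<Rightarrow> 'a set set" where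
  "pairs V = {e. e \<subseteq> V \<and> card e = 2}"

lemma finite_pairs: "finite V \<Longrightarrow> finite (pairs V)"
  by (rule finite_subset[of _ "Pow V"]) (auto simp: pairs_def)

lemma loopless_pairs: "E \<subseteq> pairs V \<Longrightarrow> loopless E"
  by (auto simp: loopless_def pairs_def)

lemma pairs_in_clique: "Q \<in> cliques V E k \<Longrightarrow> pairs Q \<subseteq> E"
  by (auto simp: pairs_def cliques_def card_2_iff)

lemma graph_iff: "finite V \<Longrightarrow> graph (Hypergraph V E) \<longleftrightarrow> E \<subseteq> pairs V"
  by (auto simp: uniform_def hypergraph_def pairs_def)

text \<open>Equivalent to containing a copy of \<open>F\<close> (\<open>graph_free_iff\<close>), but
  stated for a bare vertex set and edge set, so that edge sets can be united and modified
  freely.\<close>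

definition embeds :: "'b hypergraph \<Rightarrow> 'a set \<Rightarrow> 'a set set \<Rightarrow> bool" where
  "embeds F V E \<longleftrightarrow> (\<exists>f. inj_on f (verts F) \<and> f ` verts F \<subseteq> V \<and> (\<forall>e\<in>edges F. f ` e \<in> E))"

lemma embedsE:
  assumes "embeds F V E"
  obtains f where "inj_on f (verts F)" "f ` verts F \<subseteq> V" "\<forall>e\<in>edges F. f ` e \<in> E"
  using assms unfolding embeds_def by blast

lemma embedding_image:
  assumes "graph F" "inj_on f (verts F)"
  shows "isomorphic F (Hypergraph (f ` verts F) ((\<lambda>e. f ` e) ` edges F))"
    "hypergraph (Hypergraph (f ` verts F) ((\<lambda>e. f ` e) ` edges F))"
  using assms by (auto simp: isomorphic_def bij_betw_def uniform_def hypergraph_def)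

lemma graph_free_iff:
  assumes "graph F"
  shows "graph_free F G \<longleftrightarrow> \<not> embeds F (verts G) (edges G)"
proof
  assume free: "graph_free F G"
  show "\<not> embeds F (verts G) (edges G)"
  proof
    assume "embeds F (verts G) (edges G)"
    then obtain f where f: "inj_on f (verts F)" "f ` verts F \<subseteq> verts G" "\<forall>e\<in>edges F. f ` e \<in> edges G"
      by (rule embedsE)
    then have "Hypergraph (f ` verts F) ((\<lambda>e. f ` e) ` edges F) \<in> copies F G"
      using embedding_image[OF assms f(1)] by (auto simp: copies_def subhypergraph_def)
    then show False using free by (simp add: graph_free_def)
  qed
next
  assume no: "\<not> embeds F (verts G) (edges G)"
  have "S \<notin> copies F G" for S
  proof
    assume "S \<in> copies F G"
    then obtain f where S: "verts S \<subseteq> verts G" "edges S \<subseteq> edges G"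
      and f: "bij_betw f (verts F) (verts S)" "edges S = (\<lambda>e. f ` e) ` edges F"
      by (auto simp: copies_def subhypergraph_def isomorphic_def)
    then have "embeds F (verts G) (edges G)"
      unfolding embeds_def by (intro exI[of _ f]) (auto simp: bij_betw_def)
    then show False using no by blast
  qed
  then show "graph_free F G" by (auto simp: graph_free_def)
qed

lemma image_pairs:
  assumes "bij_betw f A B"
  shows "(\<lambda>e. f ` e) ` pairs A = pairs B"
proof
  have inj: "inj_on f A" and img: "f ` A = B" using assms by (auto simp: bij_betw_def)
  show "(\<lambda>e. f ` e) ` pairs A \<subseteq> pairs B"
    using inj img by (auto simp: pairs_def card_image inj_on_subset)
  show "pairs B \<subseteq> (\<lambda>e. f ` e) ` pairs A"
  proof
    fix e assume e: "e \<in> pairs B"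
    then have "e \<subseteq> f ` A" using img by (simp add: pairs_def)
    then obtain d where d: "d \<subseteq> A" "f ` d = e" unfolding subset_image_iff by blast
    then have "card d = card e" using inj by (metis card_image inj_on_subset)
    then show "e \<in> (\<lambda>e. f ` e) ` pairs A" using e d by (auto simp: pairs_def)
  qed
qed

lemma num_copies_complete_graph:
  assumes "graph G"
  shows "num_copies (complete_graph k) G = card (cliques (verts G) (edges G) k)"
proof -
  have fin: "finite (verts G)" and E: "edges G \<subseteq> pairs (verts G)"
    using assms by (auto simp: uniform_def hypergraph_def pairs_def)
  have K: "verts (complete_graph k) = {..<k}" "edges (complete_graph k) = pairs {..<k}"
    by (auto simp: complete_graph_def pairs_def)
  have "copies (complete_graph k) G = (\<lambda>Q. Hypergraph Q (pairs Q)) ` cliques (verts G) (edges G) k"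
  proof (intro equalityI subsetI)
    fix S assume "S \<in> copies (complete_graph k) G"
    then obtain f where S: "verts S \<subseteq> verts G" "edges S \<subseteq> edges G" and f: "bij_betw f {..<k} (verts S)"
      and eS: "edges S = (\<lambda>e. f ` e) ` pairs {..<k}"
      by (auto simp: copies_def subhypergraph_def isomorphic_def K)
    have eq: "edges S = pairs (verts S)" using eS image_pairs[OF f] by simp
    have "card (verts S) = k" using bij_betw_same_card[OF f] by simp
    then have "verts S \<in> cliques (verts G) (edges G) k" using S eq by (auto simp: cliques_def pairs_def)
    moreover have "S = Hypergraph (verts S) (pairs (verts S))" using eq by (cases S) auto
    ultimately show "S \<in> (\<lambda>Q. Hypergraph Q (pairs Q)) ` cliques (verts G) (edges G) k" by blast
  next
    fix S assume "S \<in> (\<lambda>Q. Hypergraph Q (pairs Q)) ` cliques (verts G) (edges G) k"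
    then obtain Q where Q: "S = Hypergraph Q (pairs Q)" "Q \<in> cliques (verts G) (edges G) k" by blast
    have "finite Q" "card Q = k" using Q fin by (auto simp: cliques_def finite_subset)
    then obtain f where f: "bij_betw f {..<k} Q" by (metis atLeast0LessThan ex_bij_betw_nat_finite)
    have "isomorphic (complete_graph k) S"
      unfolding isomorphic_def K Q(1) using f image_pairs[OF f] by auto
    moreover have "subhypergraph S G"
      using Q pairs_in_clique[OF Q(2)] \<open>finite Q\<close> by (auto simp: subhypergraph_def hypergraph_def cliques_def pairs_def)
    ultimately show "S \<in> copies (complete_graph k) G" by (simp add: copies_def)
  qed
  moreover have "inj_on (\<lambda>Q. Hypergraph Q (pairs Q)) (cliques (verts G) (edges G) k)"
    by (auto intro: inj_onI)
  ultimately show ?thesis by (simp add: num_copies_def card_image)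
qed

text \<open>This gives the lower bound. The edges of the core of a Berge copy lie inside cliques of
  \<open>G\<close>, so they are edges of \<open>G\<close> and the core is a copy of
  \<open>F\<close>.\<close>

lemma berge_free_clique_hypergraph:
  fixes k :: nat
  assumes "graph F" "graph G" "graph_free F G"
  defines "H \<equiv> Hypergraph (verts G) (cliques (verts G) (edges G) k)"
  shows "uniform k H" "berge_free F H"
proof -
  show "uniform k H" using assms by (auto simp: H_def uniform_def hypergraph_def cliques_def)
  show "berge_free F H"
    unfolding berge_free_def
  proof
    assume "\<exists>H' F'. subhypergraph H' H \<and> isomorphic F F' \<and> is_berge F' H'"
    then obtain H' F' f \<phi> where H': "verts H' \<subseteq> verts G" "edges H' \<subseteq> cliques (verts G) (edges G) k"
      and f: "bij_betw f (verts F) (verts F')" "edges F' = (\<lambda>e. f ` e) ` edges F"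
      and \<phi>: "verts F' \<subseteq> verts H'" "bij_betw \<phi> (edges H') (edges F')" "\<And>h. h \<in> edges H' \<Longrightarrow> \<phi> h \<subseteq> h"
      by (auto simp: subhypergraph_def isomorphic_def is_berge_def H_def)
    have inj: "inj_on f (verts F)" "f ` verts F = verts F'" using f by (auto simp: bij_betw_def)
    have "f ` e \<in> edges G" if e: "e \<in> edges F" for e
    proof -
      have "f ` e \<in> edges F'" using f e by simp
      then obtain h where h: "h \<in> edges H'" "\<phi> h = f ` e" using \<phi>(2) by (metis bij_betw_def imageE)
      have "e \<subseteq> verts F" "card e = 2" using assms(1) e by (auto simp: uniform_def hypergraph_def)
      then have "card (f ` e) = 2" using inj by (simp add: card_image inj_on_subset)
      then have "f ` e \<in> pairs h" using \<phi>(3)[OF h(1)] h by (auto simp: pairs_def)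
      then show ?thesis using pairs_in_clique H' h by blast
    qed
    then have "embeds F (verts G) (edges G)"
      unfolding embeds_def using inj \<phi>(1) H' by (intro exI[of _ f]) auto
    then show False using assms graph_free_iff by blast
  qed
qed

text \<open>\<open>deficiency_decomposition\<close> is applied to the hyperedges and the pairs they
  contain. All pairs inside members of \<open>A\<close> become red, so these hyperedges are red
  cliques; each remaining hyperedge contributes its own blue pair. The two matchings assign distinct
  hyperedges to all coloured pairs, so a copy of \<open>F\<close> would be the core of a Berge
  copy.\<close>

lemma berge_free_red_blue:
  assumes F: "graph F" and H: "uniform k H" and free: "berge_free F H"
  shows "\<exists>R B. R \<subseteq> pairs (verts H) \<and> B \<subseteq> pairs (verts H) \<and> R \<inter> B = {} \<and>
    \<not> embeds F (verts H) (R \<union> B) \<and> card (edges H) \<le> card (cliques (verts H) R k) + card B"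
proof -
  have fin: "finite (verts H)" "finite (edges H)" and eH: "\<And>h. h \<in> edges H \<Longrightarrow> h \<subseteq> verts H \<and> card h = k"
    using H card_edges_le(1)[of H] by (auto simp: uniform_def hypergraph_def)
  have "finite (pairs h)" if "h \<in> edges H" for h
    using eH[OF that] fin finite_subset by (intro finite_pairs) blast
  then have "\<exists>A\<subseteq>edges H. (\<exists>\<phi>. inj_on \<phi> (edges H - A) \<and> (\<forall>h\<in>edges H - A. \<phi> h \<in> pairs h - \<Union>(pairs ` A)))
    \<and> (\<exists>\<psi>. inj_on \<psi> (\<Union>(pairs ` A)) \<and> (\<forall>p\<in>\<Union>(pairs ` A). \<psi> p \<in> A \<and> p \<in> pairs (\<psi> p)))"
    by (rule deficiency_decomposition[OF fin(2)])
  then obtain A where A: "A \<subseteq> edges H"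
    and ex: "\<exists>\<phi>. inj_on \<phi> (edges H - A) \<and> (\<forall>h\<in>edges H - A. \<phi> h \<in> pairs h - \<Union>(pairs ` A))"
      "\<exists>\<psi>. inj_on \<psi> (\<Union>(pairs ` A)) \<and> (\<forall>p\<in>\<Union>(pairs ` A). \<psi> p \<in> A \<and> p \<in> pairs (\<psi> p))"
    by - (erule exE, (erule conjE)+, rule that)
  obtain \<phi> where \<phi>: "inj_on \<phi> (edges H - A)" "\<forall>h\<in>edges H - A. \<phi> h \<in> pairs h - \<Union>(pairs ` A)"
    using ex(1) by (elim exE conjE)
  obtain \<psi> where \<psi>: "inj_on \<psi> (\<Union>(pairs ` A))" "\<forall>p\<in>\<Union>(pairs ` A). \<psi> p \<in> A \<and> p \<in> pairs (\<psi> p)"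
    using ex(2) by (elim exE conjE)
  define R where "R = \<Union>(pairs ` A)"
  define B where "B = \<phi> ` (edges H - A)"
  have RB: "R \<subseteq> pairs (verts H)" "B \<subseteq> pairs (verts H)"
    using A eH \<phi>(2) unfolding R_def B_def pairs_def by blast+
  have disj: "R \<inter> B = {}" using \<phi>(2) unfolding R_def B_def by blast
  have "A \<subseteq> cliques (verts H) R k"
    using A eH by (auto simp: cliques_def R_def pairs_def card_2_iff)
  then have "card A \<le> card (cliques (verts H) R k)" using fin by (intro card_mono) auto
  moreover have "card B = card (edges H - A)" unfolding B_def using \<phi>(1) by (rule card_image)
  moreover have "card (edges H) = card A + card (edges H - A)"
    using A fin by (metis card_Diff_subset card_mono finite_subset le_add_diff_inverse)
  ultimately have le: "card (edges H) \<le> card (cliques (verts H) R k) + card B" by simp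
  \<comment> \<open>The hyperedge representing a coloured pair: a member of \<open>A\<close> for a
    red pair, a hyperedge outside \<open>A\<close> for a blue one. The ranges are disjoint, which
    gives injectivity.\<close>
  define \<chi> where "\<chi> p = (if p \<in> R then \<psi> p else inv_into (edges H - A) \<phi> p)" for p
  have \<chi>B: "\<chi> p \<in> edges H - A" "\<phi> (\<chi> p) = p" if "p \<in> B" for p
    using that disj inv_into_into[of p \<phi> "edges H - A"] f_inv_into_f[of p \<phi> "edges H - A"]
    by (auto simp: \<chi>_def B_def)
  have \<chi>R: "\<chi> p \<in> A" "p \<in> pairs (\<chi> p)" if "p \<in> R" for p
    using \<psi>(2) that by (auto simp: \<chi>_def R_def)
  have \<chi>: "\<chi> p \<in> edges H" "p \<subseteq> \<chi> p" if "p \<in> R \<union> B" for p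
    using that \<chi>B[of p] \<chi>R[of p] \<phi>(2)[rule_format, of "\<chi> p"] A by (auto simp: pairs_def)
  have inj: "inj_on \<chi> (R \<union> B)"
  proof (rule inj_onI)
    fix p q assume pq: "p \<in> R \<union> B" "q \<in> R \<union> B" "\<chi> p = \<chi> q"
    show "p = q"
    proof (cases "p \<in> R")
      case True
      then have "q \<in> R" using pq \<chi>R(1)[of p] \<chi>B(1)[of q] by auto
      then show ?thesis using True pq \<psi>(1) by (auto simp: \<chi>_def R_def[symmetric] dest: inj_onD)
    next
      case False
      then have "p \<in> B" using pq by blast
      moreover from this have "q \<in> B" using pq \<chi>R(1)[of q] \<chi>B(1)[of p] by auto
      ultimately show ?thesis using \<chi>B(2) pq by metis
    qed
  qed
  have "\<not> embeds F (verts H) (R \<union> B)"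
  proof
    assume "embeds F (verts H) (R \<union> B)"
    then obtain f where f: "inj_on f (verts F)" "f ` verts F \<subseteq> verts H" "\<forall>e\<in>edges F. f ` e \<in> R \<union> B"
      by (rule embedsE)
    define P where "P = (\<lambda>e. f ` e) ` edges F"
    have P: "P \<subseteq> R \<union> B" using f by (auto simp: P_def)
    have b: "bij_betw \<chi> P (\<chi> ` P)" using inj P by (auto simp: bij_betw_def intro: inj_on_subset)
    have "\<chi> ` P \<subseteq> edges H" using \<chi>(1) P by blast
    then have "subhypergraph (Hypergraph (verts H) (\<chi> ` P)) H"
      using eH fin by (auto simp: subhypergraph_def hypergraph_def dest!: subsetD)
    moreover have "isomorphic F (Hypergraph (f ` verts F) P)"
      unfolding P_def by (rule embedding_image[OF F f(1)])
    moreover have "is_berge (Hypergraph (f ` verts F) P) (Hypergraph (verts H) (\<chi> ` P))"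
      unfolding is_berge_def
    proof (intro conjI exI[of _ "inv_into P \<chi>"] ballI)
      fix h assume h: "h \<in> edges (Hypergraph (verts H) (\<chi> ` P))"
      then have "inv_into P \<chi> h \<in> P" "\<chi> (inv_into P \<chi> h) = h"
        using inv_into_into[of h \<chi> P] f_inv_into_f[of h \<chi> P] by simp_all
      then show "inv_into P \<chi> h \<subseteq> h" using \<chi>(2)[of "inv_into P \<chi> h"] P by auto
    qed (use f(2) bij_betw_inv_into[OF b] in auto)
    ultimately show False using free unfolding berge_free_def by blast
  qed
  then show ?thesis using RB disj le by blast
qed

text \<open>Colour class \<open>i\<close> of \<open>F\<close> is placed injectively into
  \<open>T i\<close>, which has room for all of \<open>F\<close>.\<close>

lemma embeds_of_has_multipartite:
  assumes F: "graph F" and c: "proper_colouring F (Suc r) c"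
    and V: "finite V" "loopless E" and mp: "has_multipartite V E (Suc r) s" "card (verts F) \<le> s"
  shows "embeds F V E"
proof -
  obtain T :: "nat \<Rightarrow> 'b set" where T: "\<forall>i<Suc r. T i \<subseteq> V \<and> s \<le> card (T i)"
    "\<forall>i<Suc r. \<forall>j<Suc r. i \<noteq> j \<longrightarrow> (\<forall>x\<in>T i. \<forall>y\<in>T j. {x, y} \<in> E)"
    using mp(1) unfolding has_multipartite_def by (elim exE conjE)
  have finF: "finite (verts F)" and eF: "\<And>e. e \<in> edges F \<Longrightarrow> e \<subseteq> verts F \<and> card e = 2"
    using F by (auto simp: uniform_def hypergraph_def)
  have c: "\<And>v. v \<in> verts F \<Longrightarrow> c v < Suc r" "\<And>u v. {u, v} \<in> edges F \<Longrightarrow> u \<noteq> v \<Longrightarrow> c u \<noteq> c v"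
    using c by (auto simp: proper_colouring_def)
  have "\<forall>i\<in>{..<Suc r}. \<exists>g. inj_on g {v\<in>verts F. c v = i} \<and> g ` {v\<in>verts F. c v = i} \<subseteq> T i"
  proof
    fix i assume "i \<in> {..<Suc r}"
    then have "finite (T i)" "s \<le> card (T i)" using T V by (auto intro: finite_subset)
    moreover have "card {v\<in>verts F. c v = i} \<le> card (verts F)" using finF by (intro card_mono) auto
    ultimately have "card {v\<in>verts F. c v = i} \<le> card (T i)" using mp(2) by linarith
    then show "\<exists>g. inj_on g {v\<in>verts F. c v = i} \<and> g ` {v\<in>verts F. c v = i} \<subseteq> T i"
      using card_le_inj[of "{v\<in>verts F. c v = i}" "T i"] \<open>finite (T i)\<close> finF by auto
  qed
  from bchoice[OF this] obtain g where g': "\<forall>i\<in>{..<Suc r}. inj_on (g i) {v\<in>verts F. c v = i} \<and> g i ` {v\<in>verts F. c v = i} \<subseteq> T i"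
    by (elim exE)
  have g: "inj_on (g i) {v\<in>verts F. c v = i} \<and> g i ` {v\<in>verts F. c v = i} \<subseteq> T i" if "i < Suc r" for i
    using g' that by blast
  define f where "f v = g (c v) v" for v
  have fT: "f v \<in> T (c v)" if "v \<in> verts F" for v
    using g[OF c(1)[OF that]] that by (auto simp: f_def)
  have disj: "x \<noteq> y" if "x \<in> T i" "y \<in> T j" "i < Suc r" "j < Suc r" "i \<noteq> j" for x y i j
  proof
    assume "x = y"
    then have "{x} \<in> E" using T(2)[rule_format, OF that(3,4,5,1,2)] by simp
    then show False using V(2) by (simp add: loopless_def)
  qed
  have "inj_on f (verts F)"
  proof (rule inj_onI)
    fix u v assume uv: "u \<in> verts F" "v \<in> verts F" "f u = f v"
    have "c u = c v" using disj[OF fT[OF uv(1)] fT[OF uv(2)]] c(1) uv by blast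
    then show "u = v" using g[OF c(1)[OF uv(1)]] uv by (auto simp: f_def dest: inj_onD)
  qed
  moreover have "f ` verts F \<subseteq> V" using fT T(1) c(1) by blast
  moreover have "f ` e \<in> E" if e: "e \<in> edges F" for e
  proof -
    obtain u v where uv: "e = {u, v}" "u \<noteq> v" using eF[OF e] by (auto simp: card_2_iff)
    then have "u \<in> verts F" "v \<in> verts F" "c u \<noteq> c v" using eF[OF e] c(2) e by auto
    then have "{f u, f v} \<in> E" using T(2) fT c(1) by blast
    then show ?thesis using uv by simp
  qed
  ultimately show ?thesis unfolding embeds_def by blast
qed

section \<open>Chromatic number and the Turan graph\<close>

lemma colourings_chromatic_number:
  assumes "graph F"
  shows "\<exists>c. proper_colouring F (chromatic_number F) c" "j < chromatic_number F \<Longrightarrow> \<not> proper_colouring F j c"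
proof -
  have "finite (verts F)" and eF: "\<And>e. e \<in> edges F \<Longrightarrow> e \<subseteq> verts F"
    using assms by (auto simp: uniform_def hypergraph_def)
  obtain f :: "'a \<Rightarrow> nat" and m where f: "f ` verts F = {i. i < m}" "inj_on f (verts F)"
    using finite_imp_inj_to_nat_seg[OF \<open>finite (verts F)\<close>] by (elim exE conjE)
  have "proper_colouring F m f" unfolding proper_colouring_def
  proof (intro conjI ballI allI impI)
    show "f v < m" if "v \<in> verts F" for v using f that by auto
    show "f u \<noteq> f v" if "{u, v} \<in> edges F \<and> u \<noteq> v" for u v using f(2) eF that by (auto dest!: inj_onD)
  qed
  then have ex: "\<exists>j c. proper_colouring F j c" by blast
  show "\<exists>c. proper_colouring F (chromatic_number F) c"
    unfolding chromatic_number_def by (rule LeastI_ex[OF ex])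
  show "\<not> proper_colouring F j c" if "j < chromatic_number F"
    using not_less_Least[OF that[unfolded chromatic_number_def]] by blast
qed

lemma balanced_partition:
  assumes "finite V" "r > 0"
  shows "\<exists>c. (\<forall>v\<in>V. c v < r) \<and> (\<forall>i. real (card {v\<in>V. c v = i}) \<le> real (card V) / real r + 1)"
proof -
  obtain g where g: "bij_betw g V {0..<card V}" using ex_bij_betw_finite_nat[OF assms(1)] by blast
  \<comment> \<open>Within a residue class the vertices are told apart by the quotient
    \<open>g v div r\<close>, which takes at most \<open>card V div r + 1\<close> values.\<close>
  define c where "c v = g v mod r" for v
  have "real (card {v\<in>V. c v = i}) \<le> real (card V) / real r + 1" for i
  proof -
    have "inj_on (\<lambda>v. g v div r) {v\<in>V. c v = i}"
    proof (rule inj_onI)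
      fix u v assume uv: "u \<in> {v\<in>V. c v = i}" "v \<in> {v\<in>V. c v = i}" "g u div r = g v div r"
      then have "g u = g v" unfolding c_def by (metis (mono_tags, lifting) div_mult_mod_eq mem_Collect_eq)
      then show "u = v" using uv g by (auto simp: bij_betw_def dest: inj_onD)
    qed
    moreover have "(\<lambda>v. g v div r) ` {v\<in>V. c v = i} \<subseteq> {..card V div r}"
    proof
      fix y assume "y \<in> (\<lambda>v. g v div r) ` {v\<in>V. c v = i}"
      then obtain v where v: "v \<in> V" "y = g v div r" by blast
      then have "g v \<le> card V" using bij_betwE[OF g] by (auto intro: less_imp_le)
      then show "y \<in> {..card V div r}" using v by (simp add: div_le_mono)
    qed
    ultimately have "card {v\<in>V. c v = i} \<le> card {..card V div r}" by (meson card_inj_on_le finite_atMost)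
    then have "card {v\<in>V. c v = i} \<le> card V div r + 1" by simp
    then have "real (card {v\<in>V. c v = i}) \<le> real (card V div r) + 1" by (metis of_nat_1 of_nat_add of_nat_mono)
    then show ?thesis using of_nat_div_le_of_nat[of "card V" r, where 'a = real] by linarith
  qed
  then show ?thesis using assms by (intro exI[of _ c]) (auto simp: c_def)
qed

text \<open>A copy of \<open>F\<close> would pull the partition back to a proper
  \<open>r\<close>-colouring. For the count, a \<open>j\<close>-clique excludes \<open>j\<close>
  classes of size at most \<open>n / r + 1\<close> each, and the resulting codegree bounds are
  multiplied by means of \<open>sum_codegree\<close>.\<close>

lemma turan_graph:
  assumes F: "graph F" and nc: "\<And>c. \<not> proper_colouring F r c" and V: "finite V" and k: "0 < k" "k \<le> r"
    and large: "real (card V) \<ge> (real r)\<^sup>2"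
  shows "\<exists>E\<subseteq>pairs V. \<not> embeds F V E \<and>
    fact k * real (card (cliques V E k)) \<ge> (\<Prod>i<k. real (card V) - real i * (real (card V) / real r + 1))"
proof -
  define n where "n = real (card V)"
  obtain c where c: "\<And>v. v \<in> V \<Longrightarrow> c v < r" "\<And>i. real (card {v\<in>V. c v = i}) \<le> n / real r + 1"
    using balanced_partition[OF V, of r] k unfolding n_def by auto
  define E where "E = {e\<in>pairs V. inj_on c e}"
  have EV: "E \<subseteq> pairs V" by (auto simp: E_def)
  have E_iff: "{x, y} \<in> E \<longleftrightarrow> x \<in> V \<and> y \<in> V \<and> c x \<noteq> c y" for x y
    by (auto simp: E_def pairs_def card_2_iff)
  have "\<not> embeds F V E"
  proof
    assume "embeds F V E"
    then obtain f where f: "inj_on f (verts F)" "f ` verts F \<subseteq> V" "\<forall>e\<in>edges F. f ` e \<in> E" by (rule embedsE)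
    have "proper_colouring F r (c \<circ> f)"
      unfolding proper_colouring_def
    proof (intro conjI ballI allI impI)
      show "(c \<circ> f) v < r" if "v \<in> verts F" for v using c(1) f(2) that by auto
      show "(c \<circ> f) u \<noteq> (c \<circ> f) v" if "{u, v} \<in> edges F \<and> u \<noteq> v" for u v
        using f(3)[rule_format, of "{u, v}"] E_iff[of "f u" "f v"] that by simp
    qed
    then show False using nc by blast
  qed
  moreover have "fact j * real (card (cliques V E j)) \<ge> (\<Prod>i<j. n - real i * (n / real r + 1))" if "j \<le> k" for j
    using that
  proof (induction j)
    case 0
    then show ?case using V by simp
  next
    case (Suc j)
    \<comment> \<open>This is where \<open>n \<ge> r^2\<close> is used: even for
      \<open>j = r - 1\<close> the rounding errors do not make the factor negative.\<close>
    have pos: "n - real j * (n / real r + 1) \<ge> 0"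
    proof -
      have "real j + 1 \<le> real r" using Suc.prems k by linarith
      then have "real j * (n / real r + 1) \<le> (real r - 1) * (n / real r + 1)"
        by (intro mult_right_mono) (auto simp: n_def)
      moreover have "(real r - 1) * (n / real r + 1) = n + real r - n / real r - 1" using k by (simp add: field_simps)
      moreover have "n / real r \<ge> real r" using large k by (simp add: n_def pos_le_divide_eq power2_eq_square)
      ultimately show ?thesis by linarith
    qed
    have "n - real j * (n / real r + 1) \<le> real (card (nbh V E Q))" if Q: "Q \<in> cliques V E j" for Q
    proof -
      have Q': "Q \<subseteq> V" "card Q = j" "finite Q" using Q V by (auto simp: cliques_def finite_subset)
      have "V \<subseteq> nbh V E Q \<union> (\<Union>x\<in>Q. {v\<in>V. c v = c x})"
        using Q' by (auto simp: nbh_def E_iff)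
      then have "card V \<le> card (nbh V E Q) + card (\<Union>x\<in>Q. {v\<in>V. c v = c x})"
        using V Q' by (intro order_trans[OF card_mono card_Un_le]) auto
      also have "card (\<Union>x\<in>Q. {v\<in>V. c v = c x}) \<le> (\<Sum>x\<in>Q. card {v\<in>V. c v = c x})"
        by (rule card_UN_le[OF Q'(3)])
      finally have "n \<le> real (card (nbh V E Q)) + (\<Sum>x\<in>Q. real (card {v\<in>V. c v = c x}))"
        by (simp add: n_def flip: of_nat_sum of_nat_add)
      also have "(\<Sum>x\<in>Q. real (card {v\<in>V. c v = c x})) \<le> (\<Sum>x\<in>Q. n / real r + 1)" by (intro sum_mono c(2))
      finally show ?thesis using Q'(2) by simp
    qed
    then have "(\<Sum>Q\<in>cliques V E j. n - real j * (n / real r + 1)) \<le> (\<Sum>Q\<in>cliques V E j. real (card (nbh V E Q)))"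
      by (intro sum_mono)
    then have "(n - real j * (n / real r + 1)) * real (card (cliques V E j)) \<le> real (Suc j) * real (card (cliques V E (Suc j)))"
      unfolding sum_codegree[OF V loopless_pairs[OF EV]] by (simp add: mult.commute)
    then have step: "fact j * ((n - real j * (n / real r + 1)) * real (card (cliques V E j)))
        \<le> fact j * (real (Suc j) * real (card (cliques V E (Suc j))))" by (intro mult_left_mono) auto
    have "(\<Prod>i<j. n - real i * (n / real r + 1)) * (n - real j * (n / real r + 1))
        \<le> fact j * real (card (cliques V E j)) * (n - real j * (n / real r + 1))"
      using Suc pos by (intro mult_right_mono) auto
    also have "\<dots> = fact j * ((n - real j * (n / real r + 1)) * real (card (cliques V E j)))"
      by (simp only: mult_ac)
    also note step
    finally show ?case by (simp add: mult_ac)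
  qed
  ultimately show ?thesis using EV by (intro exI[of _ E]) (auto simp: n_def)
qed

lemma eventually_turan_count:
  assumes "\<delta> > 0"
  shows "\<forall>\<^sub>F n in sequentially. (turan_density r k - \<delta>) * real n ^ k
    \<le> (\<Prod>i<k. real n - real i * (real n / real r + 1))"
proof -
  have "(\<lambda>n. \<Prod>i<k. 1 - real i / real r - real i / real n) \<longlonglongrightarrow> (\<Prod>i<k. 1 - real i / real r - 0)"
    by (intro tendsto_prod tendsto_diff tendsto_const lim_const_over_n)
  then have "(\<lambda>n. \<Prod>i<k. 1 - real i / real r - real i / real n) \<longlonglongrightarrow> turan_density r k"
    by (simp add: turan_density_def)
  then have "\<forall>\<^sub>F n in sequentially. turan_density r k - \<delta> < (\<Prod>i<k. 1 - real i / real r - real i / real n)"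
    using assms by (intro order_tendstoD(1)) auto
  then show ?thesis
    using eventually_gt_at_top[of 0]
  proof eventually_elim
    case (elim n)
    have "(turan_density r k - \<delta>) * real n ^ k \<le> (\<Prod>i<k. 1 - real i / real r - real i / real n) * real n ^ k"
      using elim by (intro mult_right_mono) auto
    also have "\<dots> = (\<Prod>i<k. (1 - real i / real r - real i / real n) * real n)"
      by (simp add: prod.distrib)
    also have "\<dots> = (\<Prod>i<k. real n - real i * (real n / real r + 1))"
      using elim by (intro prod.cong) (auto simp: algebra_simps)
    finally show ?case .
  qed
qed

section \<open>Red-blue graphs of maximal weight\<close>

definition admissible :: "'b hypergraph \<Rightarrow> 'a set \<Rightarrow> ('a set set \<times> 'a set set) \<Rightarrow> bool" where
  "admissible F V = (\<lambda>(R, B). R \<subseteq> pairs V \<and> B \<subseteq> pairs V \<and> R \<inter> B = {} \<and> \<not> embeds F V (R \<union> B))"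

text \<open>The upper bound of \<open>berge_free_red_blue\<close>. It is maximised over all
  admissible pairs, not only those arising from hypergraphs, so that local changes are
  permitted.\<close>

definition weight :: "nat \<Rightarrow> 'a set \<Rightarrow> ('a set set \<times> 'a set set) \<Rightarrow> nat" where
  "weight k V = (\<lambda>(R, B). card (cliques V R k) + card B)"

lemma exists_max_weight:
  assumes "finite V" "admissible F V P"
  shows "\<exists>P'. admissible F V P' \<and> (\<forall>P''. admissible F V P'' \<longrightarrow> weight k V P'' \<le> weight k V P') \<and>
    weight k V P \<le> weight k V P'"
proof -
  have "{P. admissible F V P} \<subseteq> Pow (pairs V) \<times> Pow (pairs V)" by (auto simp: admissible_def)
  then have "finite {P. admissible F V P}" using finite_pairs[OF assms(1)] by (auto intro: finite_subset)
  from finite_argmax[OF this, of "weight k V"] show ?thesis using assms(2) by blast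
qed

lemma embeds_mono:
  assumes "embeds F V E" "E \<subseteq> E'"
  shows "embeds F V E'"
proof -
  from assms(1) obtain f where "inj_on f (verts F)" "f ` verts F \<subseteq> V" "\<forall>e\<in>edges F. f ` e \<in> E" by (rule embedsE)
  then show ?thesis unfolding embeds_def using assms(2) by (intro exI[of _ f]) auto
qed

lemma card_pairs_containing:
  assumes "finite V" "B \<subseteq> pairs V" "v \<in> V"
  shows "card {e\<in>B. v \<in> e} \<le> card V"
proof -
  have "{e\<in>B. v \<in> e} \<subseteq> (\<lambda>w. {v, w}) ` V" using assms(2) by (auto simp: pairs_def card_2_iff)
  then show ?thesis using assms(1) by (meson card_image_le card_mono finite_imageI order_trans)
qed

text \<open>If \<open>S\<close> has at least \<open>|V(F)|\<close> vertices, then replacing the neighbourhood of \<open>v\<close> by the common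
  neighbourhood of \<open>S\<close> creates no copy of \<open>F\<close>: in such a copy \<open>v\<close> could be swapped for an
  unused vertex of \<open>S\<close>.\<close>

lemma clone_not_embeds:
  assumes F: "graph F" and E: "E \<subseteq> pairs V" "\<not> embeds F V E"
    and S: "S \<subseteq> V" "finite S" "card (verts F) \<le> card S" "v \<notin> S" and X: "X \<subseteq> nbh V E S"
  shows "\<not> embeds F V ({e\<in>E. v \<notin> e} \<union> (\<lambda>w. {v, w}) ` (X - {v}))"
proof
  assume "embeds F V ({e\<in>E. v \<notin> e} \<union> (\<lambda>w. {v, w}) ` (X - {v}))"
  then obtain f where f: "inj_on f (verts F)" "f ` verts F \<subseteq> V"
    "\<forall>e\<in>edges F. f ` e \<in> {e\<in>E. v \<notin> e} \<union> (\<lambda>w. {v, w}) ` (X - {v})" by (rule embedsE)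
  have finF: "finite (verts F)" and eF: "\<And>e. e \<in> edges F \<Longrightarrow> e \<subseteq> verts F \<and> card e = 2"
    using F by (auto simp: uniform_def hypergraph_def)
  have old: "f ` e \<in> E" if "e \<in> edges F" "v \<notin> f ` e" for e
    using f(3)[rule_format, OF that(1)] that(2) by auto
  show False
  proof (cases "v \<in> f ` verts F")
    case False
    then have "f ` e \<in> E" if "e \<in> edges F" for e using old[OF that] eF[OF that] by blast
    then have "embeds F V E" unfolding embeds_def using f by blast
    then show False using E by blast
  next
    case True
    then obtain a where a: "a \<in> verts F" "f a = v" by blast
    have "card (f ` verts F - {v}) < card (verts F)"
      using f(1) True finF by (metis card_Diff1_less card_image finite_imageI)
    then have "card (f ` verts F - {v}) < card S" using S by linarith
    then have "\<not> S \<subseteq> f ` verts F - {v}" using finF card_mono[of "f ` verts F - {v}" S] by auto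
    then obtain w where w: "w \<in> S" "w \<notin> f ` verts F" using S(4) by blast
    define g where "g = f(a := w)"
    have "inj_on g (verts F)" unfolding g_def using f(1) w by (intro inj_on_fun_updI) auto
    moreover have "g ` verts F \<subseteq> V" using f(2) w S by (auto simp: g_def)
    moreover have "g ` e \<in> E" if e: "e \<in> edges F" for e
    proof (cases "a \<in> e")
      case False
      then have "g ` e = f ` e" by (auto simp: g_def)
      moreover have "v \<notin> f ` e"
      proof
        assume "v \<in> f ` e"
        then obtain b where "b \<in> e" "f b = f a" using a by auto
        then have "b = a" using f(1) a eF[OF e] by (auto dest: inj_onD)
        then show False using False \<open>b \<in> e\<close> by simp
      qed
      ultimately show ?thesis using old[OF e] by simp
    next
      case True
      then obtain b where b: "e = {a, b}" "a \<noteq> b" using eF[OF e] by (auto simp: card_2_iff)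
      have "b \<in> verts F" using b eF[OF e] by auto
      then have "f b \<noteq> v" using f(1) a b by (auto dest: inj_onD)
      have "{v, f b} \<in> {e\<in>E. v \<notin> e} \<union> (\<lambda>w. {v, w}) ` (X - {v})"
        using f(3)[rule_format, OF e] b a by simp
      then have "f b \<in> X" using \<open>f b \<noteq> v\<close> by (auto simp: doubleton_eq_iff)
      then have "{w, f b} \<in> E" using X w(1) by (auto simp: nbh_def)
      then show ?thesis using b by (simp add: g_def insert_commute)
    qed
    ultimately have "embeds F V E" unfolding embeds_def by blast
    then show False using E by blast
  qed
qed

section \<open>Weight gained and lost by cloning\<close>

lemma card_cliques_containing:
  assumes "finite V" "loopless E" "v \<in> V"
  shows "card {Q\<in>cliques V E (Suc j). v \<in> Q} \<le> card (cliques (nbh V E {v}) E j)"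
proof (rule card_inj_on_le[of "\<lambda>Q. Q - {v}"])
  show "inj_on (\<lambda>Q. Q - {v}) {Q\<in>cliques V E (Suc j). v \<in> Q}" by (auto intro!: inj_onI)
  show "(\<lambda>Q. Q - {v}) ` {Q\<in>cliques V E (Suc j). v \<in> Q} \<subseteq> cliques (nbh V E {v}) E j"
    using finite_subset[OF _ assms(1)] by (auto simp: cliques_def nbh_def)
qed (use assms in simp)

text \<open>Red cliques avoiding \<open>v\<close> survive, and each \<open>(k - 1)\<close>-clique of
  \<open>X\<close> avoiding \<open>v\<close> becomes a \<open>k\<close>-clique with
  \<open>v\<close>. By maximality this gain is at most the loss: the old red cliques through
  \<open>v\<close> and at most \<open>card V\<close> blue edges. The last summand bounds the cliques
  of \<open>X\<close> that contain \<open>v\<close> already.\<close>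

lemma clone_weight:
  assumes V: "finite V" "v \<in> V" and R: "R \<subseteq> pairs V" "B \<subseteq> pairs V" and k: "k \<ge> 2"
    and max: "weight k V ({e\<in>R. v \<notin> e} \<union> (\<lambda>w. {v, w}) ` (X - {v}), {e\<in>B. v \<notin> e}) \<le> weight k V (R, B)"
    and X: "X \<subseteq> V"
  shows "card (cliques X R (k - 1)) \<le> card (cliques (nbh V R {v}) R (k - 1)) + card V + card V ^ (k - 2)"
proof -
  obtain l where l: "k - 1 = Suc l" "k - 2 = l" "k = Suc (Suc l)" using that[of "k - 2"] k by simp
  let ?R' = "{e\<in>R. v \<notin> e} \<union> (\<lambda>w. {v, w}) ` (X - {v})"
  define \<A> where "\<A> = {Q\<in>cliques V R k. v \<notin> Q}"
  define \<P> where "\<P> = {P\<in>cliques X R (k - 1). v \<notin> P}"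
  have lR: "loopless R" using loopless_pairs[OF R(1)] .
  have finX: "finite X" using X V finite_subset by blast
  have fin: "finite \<A>" "finite \<P>" using V finX by (auto simp: \<A>_def \<P>_def)
  have "insert v ` \<P> \<subseteq> cliques V ?R' k"
  proof
    fix Q assume "Q \<in> insert v ` \<P>"
    then obtain P where P: "Q = insert v P" "P \<subseteq> X" "card P = Suc l" "v \<notin> P"
      "\<And>x y. x \<in> P \<Longrightarrow> y \<in> P \<Longrightarrow> x \<noteq> y \<Longrightarrow> {x, y} \<in> R" using l by (auto simp: \<P>_def cliques_def)
    have "finite P" using P finX finite_subset by blast
    have vx: "{v, x} \<in> ?R'" "{x, v} \<in> ?R'" if "x \<in> P" for x
      using that P by (auto simp: insert_commute[of x v])
    have xy: "{x, y} \<in> ?R'" if "x \<in> P" "y \<in> P" "x \<noteq> y" for x y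
      using P(4,5) that by auto
    have "card Q = k" using P \<open>finite P\<close> l by simp
    moreover have "Q \<subseteq> V" using P X V by auto
    moreover have "{x, y} \<in> ?R'" if "x \<in> Q" "y \<in> Q" "x \<noteq> y" for x y
      using that vx[of x] vx[of y] xy[of x y] unfolding P(1) by (elim insertE) simp_all
    ultimately show "Q \<in> cliques V ?R' k" unfolding cliques_def by blast
  qed
  moreover have "\<A> \<subseteq> cliques V ?R' k" by (auto simp: \<A>_def cliques_def)
  moreover have "\<A> \<inter> insert v ` \<P> = {}" by (auto simp: \<A>_def)
  ultimately have "card \<A> + card (insert v ` \<P>) \<le> card (cliques V ?R' k)"
    using fin V by (subst card_Un_disjoint[symmetric]) (auto intro!: card_mono)
  moreover have "card (insert v ` \<P>) = card \<P>"
  proof (rule card_image, rule inj_onI)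
    fix P Q assume "P \<in> \<P>" "Q \<in> \<P>" "insert v P = insert v Q"
    then show "P = Q" by (simp add: \<P>_def) (metis Diff_insert_absorb)
  qed
  ultimately have new: "card \<A> + card \<P> \<le> card (cliques V ?R' k)" by simp
  have "card (cliques V R k) = card \<A> + card {Q\<in>cliques V R k. v \<in> Q}"
    unfolding \<A>_def using V by (subst card_Un_disjoint[symmetric]) (auto intro!: arg_cong[of _ _ card])
  also have "card {Q\<in>cliques V R k. v \<in> Q} \<le> card (cliques (nbh V R {v}) R (k - 1))"
    unfolding l using card_cliques_containing[OF V(1) lR V(2), of "Suc l"] l by simp
  finally have old: "card (cliques V R k) \<le> card \<A> + card (cliques (nbh V R {v}) R (k - 1))" by simp
  have "finite B" using R(2) finite_pairs[OF V(1)] finite_subset by blast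
  then have "card B = card {e\<in>B. v \<notin> e} + card {e\<in>B. v \<in> e}"
    by (subst card_Un_disjoint[symmetric]) (auto intro!: arg_cong[of _ _ card])
  then have blue: "card B \<le> card {e\<in>B. v \<notin> e} + card V"
    using card_pairs_containing[OF V(1) R(2) V(2)] by simp
  have "card (cliques X R (k - 1)) = card \<P> + card {P\<in>cliques X R (k - 1). v \<in> P}"
    unfolding \<P>_def using finX by (subst card_Un_disjoint[symmetric]) (auto intro!: arg_cong[of _ _ card])
  moreover have "card {P\<in>cliques X R (k - 1). v \<in> P} \<le> card {v} * card V ^ l"
    using X l V by (intro card_subsets_meeting_le[OF V(1)]) (auto simp: cliques_def)
  ultimately have "card (cliques X R (k - 1)) \<le> card \<P> + card V ^ (k - 2)" using l by simp
  moreover have "card (cliques V ?R' k) + card {e\<in>B. v \<notin> e} \<le> card (cliques V R k) + card B"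
    using max by (simp add: weight_def)
  ultimately show ?thesis using new old blue by linarith
qed

lemma near_turan_graph_of_max:
  assumes F: "graph F" and V: "finite V" and adm: "admissible F V (R, B)"
    and max: "\<And>P. admissible F V P \<Longrightarrow> weight k V P \<le> weight k V (R, B)"
    and nt: "near_turan V R r (Suc (card (verts F))) \<eta> W T" and k: "3 \<le> k" "k \<le> r"
    and \<eta>: "\<eta> > 0" "2 \<le> \<eta> * real (card V)"
  shows "near_turan_graph V R r (Suc (card (verts F))) \<eta> W T k"
proof
  have RB: "R \<subseteq> pairs V" "B \<subseteq> pairs V" "R \<inter> B = {}" "\<not> embeds F V (R \<union> B)"
    using adm by (auto simp: admissible_def)
  show "loopless R" using loopless_pairs[OF RB(1)] .
  fix v i assume v: "v \<in> V" and i: "i < r"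
  have T: "T i \<subseteq> V" "card (T i) = Suc (card (verts F))" using nt i by (auto simp: near_turan_def)
  \<comment> \<open>The classes \<open>T i\<close> have one vertex more than \<open>F\<close>
    because \<open>v\<close> itself may lie in \<open>T i\<close>.\<close>
  have "card (verts F) \<le> card (T i - {v})"
    using T(2) diff_card_le_card_Diff[of "{v}" "T i"] by simp
  from obtain_subset_with_card_n[OF this] obtain S where S: "S \<subseteq> T i - {v}" "card S = card (verts F)" "finite S" .
  \<comment> \<open>The clone receives red edges only, to the red common neighbours of
    \<open>S\<close>. These are also common neighbours in \<open>R \<union> B\<close>, as
    \<open>clone_not_embeds\<close> requires.\<close>
  define X where "X = nbh V R S"
  have XV: "X \<subseteq> V" "X \<subseteq> nbh V (R \<union> B) S" by (auto simp: X_def nbh_def)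
  have "(\<Union>j\<in>{..<r} - {i}. W j) \<subseteq> X"
  proof
    fix w assume "w \<in> (\<Union>j\<in>{..<r} - {i}. W j)"
    then obtain j where j: "j < r" "j \<noteq> i" "w \<in> W j" by blast
    have "W j \<subseteq> V" "\<forall>x\<in>T i. \<forall>w\<in>W j. {x, w} \<in> R"
      using nt i j unfolding near_turan_def by blast+
    then show "w \<in> X" using j S by (auto simp: X_def nbh_def)
  qed
  then have "card (cliques (\<Union>j\<in>{..<r} - {i}. W j) R (k - 1)) \<le> card (cliques X R (k - 1))"
    using V XV finite_subset by (intro card_mono cliques_mono finite_cliques) auto
  also have "\<dots> \<le> card (cliques (nbh V R {v}) R (k - 1)) + card V + card V ^ (k - 2)"
  proof (rule clone_weight[OF V v RB(1,2)])
    let ?R' = "{e\<in>R. v \<notin> e} \<union> (\<lambda>w. {v, w}) ` (X - {v})" and ?B' = "{e\<in>B. v \<notin> e}"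
    have "\<not> embeds F V ({e\<in>R \<union> B. v \<notin> e} \<union> (\<lambda>w. {v, w}) ` (X - {v}))"
      using S T RB XV by (intro clone_not_embeds[OF F, of _ V S]) auto
    moreover have "{e\<in>R \<union> B. v \<notin> e} \<union> (\<lambda>w. {v, w}) ` (X - {v}) = ?R' \<union> ?B'" by auto
    moreover have "?R' \<subseteq> pairs V" using RB(1) v XV by (auto simp: pairs_def)
    moreover have "?B' \<subseteq> pairs V" "?R' \<inter> ?B' = {}" using RB(2,3) by auto
    ultimately have "admissible F V (?R', ?B')" by (simp add: admissible_def)
    then show "weight k V (?R', ?B') \<le> weight k V (R, B)" by (rule max)
  qed (use k XV in auto)
  finally show "card (cliques (\<Union>j\<in>{..<r} - {i}. W j) R (k - 1))
    \<le> card (cliques (nbh V R {v}) R (k - 1)) + card V + card V ^ (k - 2)" .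
qed (use assms in auto)

text \<open>Every blue edge lying in at least \<open>2^k\<close> cliques is paid for by the cliques that are not entirely
  red, since a \<open>k\<close>-clique contains fewer than \<open>2^k\<close> edges.\<close>

lemma weight_le_cliques:
  assumes V: "finite V" and RB: "R \<subseteq> pairs V" "B \<subseteq> pairs V" "R \<inter> B = {}" and k: "k \<ge> 2" and Z: "Z \<subseteq> V"
    and rich: "\<And>u v. u \<in> V - Z \<Longrightarrow> v \<in> V \<Longrightarrow> 2 ^ k \<le> card (cliques (nbh V R {u, v}) R (k - 2))"
  shows "weight k V (R, B) \<le> card (cliques V (R \<union> B) k) + 2 ^ card Z"
proof -
  define \<H> where "\<H> = {e\<in>B. \<not> e \<subseteq> Z}"
  define \<K> where "\<K> = cliques V (R \<union> B) k - cliques V R k"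
  have finB: "finite B" using RB(2) finite_pairs[OF V] finite_subset by blast
  have fin: "finite \<H>" "finite \<K>" using finB V by (auto simp: \<H>_def \<K>_def)
  have "2 ^ k \<le> card {Q\<in>\<K>. e \<subseteq> Q}" if e: "e \<in> \<H>" for e
  proof -
    obtain u v where uv: "e = {u, v}" "u \<noteq> v" "u \<in> V - Z" "v \<in> V"
    proof -
      have "e \<subseteq> V" "card e = 2" "\<not> e \<subseteq> Z" using e RB(2) by (auto simp: \<H>_def pairs_def)
      then obtain x y where xy: "e = {x, y}" "x \<noteq> y" by (auto simp: card_2_iff)
      show ?thesis
      proof (cases "x \<in> Z")
        case True
        then show ?thesis using that[of y x] xy \<open>e \<subseteq> V\<close> \<open>\<not> e \<subseteq> Z\<close> by auto
      next
        case False
        then show ?thesis using that[of x y] xy \<open>e \<subseteq> V\<close> by auto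
      qed
    qed
    have eB: "e \<in> B" "e \<notin> R" using e RB(3) by (auto simp: \<H>_def)
    have lR: "loopless R" using loopless_pairs[OF RB(1)] .
    \<comment> \<open>A \<open>(k - 2)\<close>-clique in the common red neighbourhood of
      \<open>u\<close> and \<open>v\<close>, together with the blue edge \<open>e\<close>, is a
      \<open>k\<close>-clique of the union that is not entirely red.\<close>
    have "card (cliques (nbh V R {u, v}) R (k - 2)) \<le> card {Q\<in>\<K>. e \<subseteq> Q}"
    proof (rule card_inj_on_le[of "\<lambda>P. P \<union> e"])
      have dis: "P \<inter> e = {}" if "P \<in> cliques (nbh V R {u, v}) R (k - 2)" for P
        using that nbh_disjoint[OF lR] uv(1) by (auto simp: cliques_def)
      then show "inj_on (\<lambda>P. P \<union> e) (cliques (nbh V R {u, v}) R (k - 2))"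
        by (intro inj_onI) blast
      show "(\<lambda>P. P \<union> e) ` cliques (nbh V R {u, v}) R (k - 2) \<subseteq> {Q\<in>\<K>. e \<subseteq> Q}"
      proof
        fix Q assume "Q \<in> (\<lambda>P. P \<union> e) ` cliques (nbh V R {u, v}) R (k - 2)"
        then obtain P where P: "Q = P \<union> e" "P \<in> cliques (nbh V R {u, v}) R (k - 2)" by blast
        have P': "P \<subseteq> V" "card P = k - 2" "\<And>x. x \<in> P \<Longrightarrow> {u, x} \<in> R \<and> {v, x} \<in> R"
          "\<And>x y. x \<in> P \<Longrightarrow> y \<in> P \<Longrightarrow> x \<noteq> y \<Longrightarrow> {x, y} \<in> R"
          using P(2) by (auto simp: cliques_def nbh_def)
        have "finite P" using P'(1) V finite_subset by blast
        then have "card Q = k" using P P'(2) dis[OF P(2)] uv k by (simp add: card_Un_disjoint)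
        moreover have "Q \<subseteq> V" using P P' uv by auto
        moreover have "{x, y} \<in> R \<union> B" if "x \<in> Q" "y \<in> Q" "x \<noteq> y" for x y
          using that P'(3)[of x] P'(3)[of y] P'(4)[of x y] eB unfolding P(1) uv(1)
          by (auto simp: insert_commute)
        ultimately have "Q \<in> cliques V (R \<union> B) k" by (simp add: cliques_def)
        moreover have "Q \<notin> cliques V R k" using eB(2) uv P(1) by (auto simp: cliques_def)
        ultimately show "Q \<in> {Q\<in>\<K>. e \<subseteq> Q}" using P by (auto simp: \<K>_def)
      qed
    qed (use fin in auto)
    then show ?thesis using rich[OF uv(3,4)] by linarith
  qed
  then have "(\<Sum>e\<in>\<H>. 2 ^ k) \<le> (\<Sum>e\<in>\<H>. card {Q\<in>\<K>. e \<subseteq> Q})" by (rule sum_mono)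
  also have "\<dots> = (\<Sum>e\<in>\<H>. \<Sum>Q\<in>\<K>. of_bool (e \<subseteq> Q))"
    using fin by (intro sum.cong refl) (simp add: of_bool_def sum.If_cases Int_def)
  also have "\<dots> = (\<Sum>Q\<in>\<K>. \<Sum>e\<in>\<H>. of_bool (e \<subseteq> Q))" by (rule sum.swap)
  also have "\<dots> = (\<Sum>Q\<in>\<K>. card {e\<in>\<H>. e \<subseteq> Q})"
    using fin by (intro sum.cong refl) (simp add: of_bool_def sum.If_cases Int_def)
  also have "\<dots> \<le> (\<Sum>Q\<in>\<K>. 2 ^ k)"
  proof (rule sum_mono)
    fix Q assume "Q \<in> \<K>"
    then have Q: "card Q = k" "finite Q" using V by (auto simp: \<K>_def cliques_def finite_subset)
    have "card {e\<in>\<H>. e \<subseteq> Q} \<le> card (Pow Q)" using Q by (intro card_mono) auto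
    then show "card {e\<in>\<H>. e \<subseteq> Q} \<le> 2 ^ k" using Q by (simp add: card_Pow)
  qed
  finally have heavy: "card \<H> \<le> card \<K>" by simp
  have "card {e\<in>B. e \<subseteq> Z} \<le> card (Pow Z)" using Z V by (intro card_mono) (auto intro: finite_subset)
  then have light: "card {e\<in>B. e \<subseteq> Z} \<le> 2 ^ card Z" using Z V by (simp add: card_Pow finite_subset)
  have "card B = card \<H> + card {e\<in>B. e \<subseteq> Z}"
    unfolding \<H>_def using finB by (subst card_Un_disjoint[symmetric]) (auto intro!: arg_cong[of _ _ card])
  moreover have "card (cliques V (R \<union> B) k) = card \<K> + card (cliques V R k)"
  proof -
    have "cliques V R k \<subseteq> cliques V (R \<union> B) k" by (intro cliques_mono) auto
    then show ?thesis unfolding \<K>_def using V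
      by (simp add: card_Diff_subset card_mono finite_subset[OF _ finite_cliques])
  qed
  ultimately show ?thesis using heavy light by (simp add: weight_def)
qed

text \<open>Stability is applied to the red graph alone. It inherits \<open>F\<close>-freeness from
  the union, and it has almost the Turan number of \<open>k\<close>-cliques because the blue edges
  contribute at most \<open>n^2\<close> to the weight, which is negligible against
  \<open>n ^ k\<close> for \<open>k \<ge> 3\<close>.\<close>

lemma max_weight_le_cliques:
  assumes F: "graph F" and \<chi>: "chromatic_number F > k" and k: "k \<ge> 3"
  shows "\<exists>C n0. \<forall>(V :: 'a set) R B. finite V \<longrightarrow> card V \<ge> n0 \<longrightarrow> admissible F V (R, B) \<longrightarrow>
    (\<forall>P. admissible F V P \<longrightarrow> weight k V P \<le> weight k V (R, B)) \<longrightarrow>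
    weight k V (R, B) \<le> card (cliques V (R \<union> B) k) + C"
proof -
  define r where "r = chromatic_number F - 1"
  have r: "Suc r = chromatic_number F" "k \<le> r" using \<chi> by (auto simp: r_def)
  obtain c where c: "proper_colouring F (Suc r) c" using colourings_chromatic_number(1)[OF F] r by auto
  have nc: "\<not> proper_colouring F r c'" for c' using colourings_chromatic_number(2)[OF F, of r] r by simp
  define s where "s = card (verts F)"
  have "finite (verts F)" using F by (auto simp: uniform_def hypergraph_def)
  moreover have "verts F \<noteq> {}"
  proof
    assume "verts F = {}"
    then have "proper_colouring F r c" using F by (auto simp: proper_colouring_def uniform_def hypergraph_def)
    then show False using nc by blast
  qed
  ultimately have s: "s > 0" by (simp add: s_def card_gt_0_iff)
  obtain \<eta> C n1 where \<eta>: "\<eta> > 0" and pc: "\<forall>(V :: 'a set) E m W T. near_turan_graph V E r m \<eta> W T k \<longrightarrow> card V \<ge> n1 \<longrightarrow>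
    \<not> has_multipartite V E (Suc r) s \<longrightarrow>
    (\<exists>Z\<subseteq>V. card Z \<le> C \<and> (\<forall>u\<in>V - Z. \<forall>v\<in>V. 2 ^ k \<le> card (cliques (nbh V E {u, v}) E (k - 2))))"
    using pairs_in_many_cliques[OF k r(2) s, where 'a = 'a and M = "2 ^ k"] by (elim exE conjE)
  have "2 \<le> k" using k by simp
  from near_turan_structure[OF this r(2) s, of "Suc s" \<eta>, where 'a = 'a] \<eta> obtain \<delta> n2 where \<delta>: "\<delta> > 0" and
    nts: "\<forall>(V :: 'a set) E. finite V \<longrightarrow> loopless E \<longrightarrow> card V \<ge> n2 \<longrightarrow>
    \<not> has_multipartite V E (Suc r) s \<longrightarrow>
    fact k * real (card (cliques V E k)) \<ge> (turan_density r k - \<delta>) * real (card V) ^ k \<longrightarrow>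
    (\<exists>W T. near_turan V E r (Suc s) \<eta> W T)"
    by auto
  \<comment> \<open>One half of \<open>\<delta>\<close> covers the rounding in the Turan graph, the
    other half the blue edges.\<close>
  have "\<delta> / 2 > 0" using \<delta> by simp
  from eventually_turan_count[OF this, of r k] obtain n3 where n3: "\<And>n. n \<ge> n3 \<Longrightarrow>
    (turan_density r k - \<delta> / 2) * real n ^ k \<le> (\<Prod>i<k. real n - real i * (real n / real r + 1))"
    by (auto simp: eventually_sequentially)
  obtain n4 :: nat where n4: "real n4 \<ge> 2 * fact k / \<delta>" using real_arch_simple by blast
  obtain n5 :: nat where n5: "real n5 \<ge> 2 / \<eta>" using real_arch_simple by blast
  define n0 where "n0 = 1 + n1 + n2 + n3 + n4 + n5 + r\<^sup>2"
  show ?thesis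
  proof (rule exI[of _ "2 ^ C"], rule exI[of _ n0], intro allI impI)
    fix V :: "'a set" and R B
    assume V: "finite V" and n: "card V \<ge> n0" and adm: "admissible F V (R, B)"
      and max: "\<forall>P. admissible F V P \<longrightarrow> weight k V P \<le> weight k V (R, B)"
    have ns: "1 \<le> card V" "n1 \<le> card V" "n2 \<le> card V" "n3 \<le> card V" "n4 \<le> card V" "n5 \<le> card V" "r\<^sup>2 \<le> card V"
      using n by (simp_all add: n0_def)
    have RB: "R \<subseteq> pairs V" "B \<subseteq> pairs V" "R \<inter> B = {}" "\<not> embeds F V (R \<union> B)"
      using adm by (auto simp: admissible_def)
    have lR: "loopless R" using loopless_pairs[OF RB(1)] .
    have "\<not> embeds F V R" using RB(4) embeds_mono[of F V R "R \<union> B"] by blast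
    then have free: "\<not> has_multipartite V R (Suc r) s"
      using embeds_of_has_multipartite[OF F c V lR, of s] by (auto simp: s_def)
    have "real (r\<^sup>2) \<le> real (card V)" using ns by (intro of_nat_mono)
    then have "(real r)\<^sup>2 \<le> real (card V)" by simp
    then obtain E where E: "E \<subseteq> pairs V" "\<not> embeds F V E"
      "fact k * real (card (cliques V E k)) \<ge> (\<Prod>i<k. real (card V) - real i * (real (card V) / real r + 1))"
      using turan_graph[OF F nc V _ r(2)] k by auto
    have "admissible F V (E, {})" using E by (simp add: admissible_def)
    then have "weight k V (E, {}) \<le> weight k V (R, B)" using max by blast
    then have "card (cliques V E k) \<le> card (cliques V R k) + card B" by (simp add: weight_def)
    moreover have "card B \<le> card V ^ 2"
      using RB(2) by (intro card_subsets_le_power[OF V]) (auto simp: pairs_def)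
    ultimately have "card (cliques V E k) \<le> card (cliques V R k) + card V ^ 2" by linarith
    then have "real (card (cliques V E k)) \<le> real (card (cliques V R k) + card V ^ 2)" by (rule of_nat_mono)
    then have "fact k * real (card (cliques V E k)) \<le> fact k * (real (card (cliques V R k)) + (real (card V))\<^sup>2)"
      by (intro mult_left_mono) auto
    then have "(turan_density r k - \<delta> / 2) * real (card V) ^ k
        \<le> fact k * real (card (cliques V R k)) + fact k * (real (card V))\<^sup>2"
      using E(3) n3[OF ns(4)] by (simp add: distrib_left)
    moreover have "fact k * (real (card V))\<^sup>2 \<le> \<delta> / 2 * real (card V) ^ k"
    proof -
      have "2 * fact k / \<delta> \<le> real (card V)" using n4 ns(5) by linarith
      then have "fact k \<le> \<delta> / 2 * real (card V)" using \<delta> by (simp add: pos_divide_le_eq mult.commute)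
      then have "fact k * (real (card V))\<^sup>2 \<le> \<delta> / 2 * real (card V) * (real (card V))\<^sup>2"
        by (intro mult_right_mono) auto
      also have "\<dots> = \<delta> / 2 * real (card V) ^ 3" by (simp add: power2_eq_square power3_eq_cube)
      also have "\<dots> \<le> \<delta> / 2 * real (card V) ^ k"
        using k ns(1) \<delta> by (intro mult_left_mono power_increasing) auto
      finally show ?thesis .
    qed
    ultimately have "fact k * real (card (cliques V R k)) \<ge> (turan_density r k - \<delta>) * real (card V) ^ k"
      by (simp add: left_diff_distrib)
    then have "\<exists>W T. near_turan V R r (Suc s) \<eta> W T"
      by (intro nts[rule_format, OF V lR ns(3) free])
    then obtain W T where nt: "near_turan V R r (Suc s) \<eta> W T" by (elim exE)
    have "2 / \<eta> \<le> real (card V)" using n5 ns(6) by linarith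
    then have "2 \<le> \<eta> * real (card V)" using \<eta> by (simp add: pos_divide_le_eq mult.commute)
    then have "near_turan_graph V R r (Suc s) \<eta> W T k"
      using near_turan_graph_of_max[OF F V adm _ _ k r(2) \<eta>, of W T] max nt by (simp add: s_def)
    from pc[rule_format, OF this ns(2) free] obtain Z where Z: "Z \<subseteq> V" "card Z \<le> C"
      "\<forall>u\<in>V - Z. \<forall>v\<in>V. 2 ^ k \<le> card (cliques (nbh V R {u, v}) R (k - 2))"
      by (elim exE conjE)
    have "weight k V (R, B) \<le> card (cliques V (R \<union> B) k) + 2 ^ card Z"
      using Z k by (intro weight_le_cliques[OF V RB(1-3)]) auto
    also have "(2::nat) ^ card Z \<le> 2 ^ C" using Z by (intro power_increasing) auto
    finally show "weight k V (R, B) \<le> card (cliques V (R \<union> B) k) + 2 ^ C" by simp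
  qed
qed

section \<open>Comparison of the two extremal numbers\<close>

lemma edges_nonempty:
  assumes "chromatic_number F > k" "k \<ge> 3"
  shows "edges F \<noteq> {}"
proof
  assume "edges F = {}"
  then have "\<exists>c. proper_colouring F 1 c" by (intro exI[of _ "\<lambda>_. 0"]) (simp add: proper_colouring_def)
  then have "chromatic_number F \<le> 1" unfolding chromatic_number_def by (rule Least_le)
  then show False using assms by simp
qed

lemma ex_copies_le_ex_berge:
  assumes "graph F" "edges F \<noteq> {}"
  shows "ex_copies n (complete_graph k) F \<le> ex_berge k n F"
proof -
  have "ex_copies n (complete_graph k) F \<in> {num_copies (complete_graph k) G | G :: nat hypergraph.
     graph G \<and> card (verts G) = n \<and> graph_free F G}"
    unfolding ex_copies_def by (rule Max_in[OF ex_copies_set(1) ex_copies_set(2)[OF assms(2)]])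
  then obtain G :: "nat hypergraph" where G: "graph G" "card (verts G) = n" "graph_free F G"
    "ex_copies n (complete_graph k) F = num_copies (complete_graph k) G" by blast
  let ?H = "Hypergraph (verts G) (cliques (verts G) (edges G) k)"
  have "card (edges ?H) \<in> {card (edges H) | H :: nat hypergraph.
     uniform k H \<and> card (verts H) = n \<and> berge_free F H}"
    using berge_free_clique_hypergraph[OF assms(1) G(1,3)] G(2) by (intro CollectI exI[of _ ?H]) simp
  then have "card (edges ?H) \<le> ex_berge k n F"
    unfolding ex_berge_def using ex_berge_set(1) by (intro Max_ge) auto
  then show ?thesis using G num_copies_complete_graph[OF G(1)] by simp
qed

text \<open>For the upper bound an extremal hypergraph is replaced by a coloured graph, and this by
  one of maximal weight on the same vertices. The union of its colours is \<open>F\<close>-free, so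
  \<open>ex_copies\<close> bounds its number of \<open>k\<close>-cliques.\<close>

theorem theorem1p3:
  fixes k :: nat and F :: "'a hypergraph"
  assumes "k \<ge> 3"
    and "graph F"
    and "chromatic_number F > k"
  shows "(\<lambda>n. real (ex_berge k n F) - real (ex_copies n (complete_graph k) F)) \<in> O(\<lambda>_. 1)"
proof -
  note F = assms(2)
  have ne: "edges F \<noteq> {}" using edges_nonempty assms by blast
  obtain C n0 where C: "\<forall>(V :: nat set) R B. finite V \<longrightarrow> card V \<ge> n0 \<longrightarrow> admissible F V (R, B) \<longrightarrow>
    (\<forall>P. admissible F V P \<longrightarrow> weight k V P \<le> weight k V (R, B)) \<longrightarrow>
    weight k V (R, B) \<le> card (cliques V (R \<union> B) k) + C"
    using max_weight_le_cliques[OF F assms(3,1), where 'a = nat] by (elim exE)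
  have "ex_berge k n F \<le> ex_copies n (complete_graph k) F + C" if n: "n \<ge> n0" for n
  proof -
    have "ex_berge k n F \<in> {card (edges H) | H :: nat hypergraph.
       uniform k H \<and> card (verts H) = n \<and> berge_free F H}"
      unfolding ex_berge_def by (rule Max_in[OF ex_berge_set(1) ex_berge_set(2)[OF ne]])
    then obtain H :: "nat hypergraph" where H: "uniform k H" "card (verts H) = n" "berge_free F H"
      "ex_berge k n F = card (edges H)" by blast
    define V where "V = verts H"
    have V: "finite V" "card V = n" using H by (auto simp: V_def uniform_def hypergraph_def)
    obtain R0 B0 where RB0: "R0 \<subseteq> pairs V" "B0 \<subseteq> pairs V" "R0 \<inter> B0 = {}" "\<not> embeds F V (R0 \<union> B0)"
      and le0: "card (edges H) \<le> card (cliques V R0 k) + card B0"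
      using berge_free_red_blue[OF F H(1,3)] unfolding V_def by (elim exE conjE)
    have "admissible F V (R0, B0)" using RB0 by (simp add: admissible_def)
    from exists_max_weight[OF V(1) this, of k] obtain P where P: "admissible F V P"
      "\<forall>P'. admissible F V P' \<longrightarrow> weight k V P' \<le> weight k V P" "weight k V (R0, B0) \<le> weight k V P"
      by (elim exE conjE)
    obtain R B where RB: "P = (R, B)" by (cases P)
    have "weight k V (R, B) \<le> card (cliques V (R \<union> B) k) + C"
      using C V n P(1,2) unfolding RB by blast
    moreover have "card (cliques V (R \<union> B) k) \<le> ex_copies n (complete_graph k) F"
    proof -
      let ?G = "Hypergraph V (R \<union> B)"
      have "graph ?G" using P(1) V unfolding RB by (simp add: graph_iff admissible_def)
      moreover have "graph_free F ?G" using P(1) unfolding RB by (simp add: graph_free_iff[OF F] admissible_def)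
      ultimately have "num_copies (complete_graph k) ?G \<in> {num_copies (complete_graph k) G | G :: nat hypergraph.
          graph G \<and> card (verts G) = n \<and> graph_free F G}"
        using V(2) by (intro CollectI exI[of _ ?G]) simp
      then have "num_copies (complete_graph k) ?G \<le> ex_copies n (complete_graph k) F"
        unfolding ex_copies_def using ex_copies_set(1) by (intro Max_ge) auto
      then show ?thesis using num_copies_complete_graph[OF \<open>graph ?G\<close>] by simp
    qed
    ultimately show ?thesis using le0 P(3) H(4) unfolding RB by (simp add: weight_def)
  qed
  then have "norm (real (ex_berge k n F) - real (ex_copies n (complete_graph k) F)) \<le> real C * norm (1::real)" if "n \<ge> n0" for n
    using ex_copies_le_ex_berge[OF F ne, of n k] that by fastforce
  then have "\<forall>\<^sub>F n in sequentially. norm (real (ex_berge k n F) - real (ex_copies n (complete_graph k) F)) \<le> real C * norm (1::real)"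
    unfolding eventually_sequentially by auto
  then show ?thesis by (rule bigoI)
qed

end
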